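(* Let $\mathcal{C}$ be a standard category over a field $K$ and let $T\in\mathcal{C}$ be a tilting object. For each $\lambda\in\Lambda$ let $G_T^\lambda=\{g_i^\lambda \mid i\in\mathcal{I}_T^\lambda\}$ be any $K$-basis of $\mathrm{Hom}_{\mathcal{C}}(\Delta(\lambda),T)$ with any choice of lifts $\hat G_T^\lambda=\{\hat g_i^\lambda\mid i\in\mathcal{I}_T^\lambda\}$, and let $F_T^\lambda=\{f_j^\lambda\mid j\in\mathcal{J}_T^\lambda\}$ be any $K$-basis of $\mathrm{Hom}_{\mathcal{C}}(T,\nabla(\lambda))$ with any choice of lifts $\hat F_T^\lambda=\{\hat f_j^\lambda\mid j\in\mathcal{J}_T^\lambda\}$. Put $c_{ij}^\lambda=\hat g_i^\lambda\circ\hat f_j^\lambda$ and $\hat G_T^\lambda\hat F_T^\lambda=\{c_{ij}^\lambda\mid (i,j)\in\mathcal{I}_T^\lambda\times\mathcal{J}_T^\lambda\}$. Then $\hat G_T\hat F_T=\coprod_{\lambda\in\Lambda}\hat G_T^\lambda\hat F_T^\lambda$, with this decomposition and indexing, is a standard basis (in the sense of Du--Rui) of the $K$-algebra $E_T=\mathrm{End}_{\mathcal{C}}(T)$.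
   Context: **Standard categories.** Let $K$ be a field. A standard category over $K$ is a $K$-linear abelian category $\mathcal{C}$ satisfying the following. (A1) $\mathcal{C}$ is essentially small and locally finite: all objects have finite length and all $\mathrm{Hom}_{\mathcal{C}}(X,Y)$ are finite-dimensional over $K$. Write $[X:S]$ for the multiplicity of a simple object $S$ in a composition series of $X$; $\mathrm{Rad}\,X$ is the intersection of all maximal subobjects, $\mathrm{Hd}\,X=X/\mathrm{Rad}\,X$, and $\mathrm{Soc}\,X$ is the union (sum) of all minimal subobjects. (A2) There is a complete set $\{L(\lambda)\}_{\lambda\in\Lambda}$ of representatives of isomorphism classes of simple objects, indexed by a (possibly infinite) partially ordered set $(\Lambda,\le)$. (A3) Each $L(\lambda)$ has a costandard object $\nabla(\lambda)$ (i.e. $\mathrm{Soc}\,\nabla(\lambda)\simeq L(\lambda)$ and all composition factors $L(\mu)$ of $\nabla(\lambda)/\mathrm{Soc}\,\nabla(\lambda)$ satisfy $\mu<\lambda$) and a standard object $\Delta(\lambda)$ (i.e. $\mathrm{Hd}\,\Delta(\lambda)\simeq L(\lambda)$ and all composition factors $L(\mu)$ of $\mathrm{Rad}\,\Delta(\lambda)$ satisfy $\mu<\lambda$), such that for all $\lambda,\mu\in\Lambda$ and $0\le i\le 2$ the Yoneda Ext-group $\mathrm{Ext}^i_{\mathcal{C}}(\Delta(\lambda),\nabla(\mu))$ is $K$ if $i=0$ and $\lambda=\mu$, and is $0$ otherwise. An object has a costandard (resp. standard) filtration if it has a finite filtration by subobjects whose successive quotients are isomorphic to objects $\nabla(\lambda_i)$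 (resp. $\Delta(\lambda_i)$). $\mathcal{C}^\nabla$, $\mathcal{C}^\Delta$ denote the full subcategories of objects with a costandard, resp. standard, filtration. A tilting object is an object of $\mathcal{C}^t=\mathcal{C}^\Delta\cap\mathcal{C}^\nabla$. (A4) For each $\lambda\in\Lambda$ there is an indecomposable tilting object $T(\lambda)$ such that: $[T(\lambda):L(\mu)]\ne 0$ implies $\mu\le\lambda$, and $[T(\lambda):L(\lambda)]=1$; there is a monomorphism $\Delta(\lambda)\hookrightarrow T(\lambda)$; there is an epimorphism $T(\lambda)\twoheadrightarrow\nabla(\lambda)$. Moreover $\lambda\mapsto T(\lambda)$ is a bijection between $\Lambda$ and the set of isomorphism classes of indecomposable tilting objects. **Fixed morphisms and lifts.** For each $\lambda$ fix a monomorphism $i^\lambda:\Delta(\lambda)\hookrightarrow T(\lambda)$ and an epimorphism $\pi^\lambda:T(\lambda)\twoheadrightarrow\nabla(\lambda)$. For $M\in\mathcal{C}^\Delta$, a lift of $f:M\to\nabla(\lambda)$ is a morphism $\hat f:M\to T(\lambda)$ with $\pi^\lambda\circ\hat f=f$. For $N\in\mathcal{C}^\nabla$, a lift of $g:\Delta(\lambda)\to N$ is a morphism $\hat g:T(\lambda)\to N$ with $\hat g\circ i^\lambda=g$. Lifts exist but are not unique. $\mathcal{I}_T^\lambda=\{1,\dots,\dim_K\mathrm{Hom}_{\mathcal{C}}(\Delta(\lambda),T)\}$ and $\mathcal{J}_T^\lambda=\{1,\dots,\dim_K\mathrm{Hom}_{\mathcal{C}}(T,\nabla(\lambda))\}$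 (the multiplicities of $\nabla(\lambda)$, resp. $\Delta(\lambda)$, in a costandard, resp. standard, filtration of $T$). **Standard basis (Du--Rui).** A standard basis of a finite-dimensional $K$-algebra $E$ is a $K$-basis $\mathcal{B}$ of $E$ fibered over a poset $\Lambda$, $\mathcal{B}=\coprod_{\lambda\in\Lambda}\mathcal{B}^\lambda$, together with index sets $\mathcal{I}^\lambda,\mathcal{J}^\lambda$ (possibly empty) with $\mathcal{B}^\lambda=\{c_{ij}^\lambda\mid(i,j)\in\mathcal{I}^\lambda\times\mathcal{J}^\lambda\}$, such that for all $\varphi\in E$ and $c_{ij}^\lambda\in\mathcal{B}^\lambda$ $$\varphi\cdot c_{ij}^\lambda\equiv\sum_{k\in\mathcal{I}^\lambda}r_k^\lambda(\varphi,i)\,c_{kj}^\lambda \pmod{E^{<\lambda}},\qquad c_{ij}^\lambda\cdot\varphi\equiv\sum_{l\in\mathcal{J}^\lambda}r_l^\lambda(j,\varphi)\,c_{il}^\lambda \pmod{E^{<\lambda}},$$ where $r_k^\lambda(\varphi,i)\in K$ is independent of $j$, $r_l^\lambda(j,\varphi)\in K$ is independent of $i$, and $E^{<\lambda}$ is the $K$-span of $\bigcup_{\mu<\lambda}\mathcal{B}^\mu$. *)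

theory Defs
  imports Main "HOL.Vector_Spaces"
begin

section \<open>Linear and abelian categories\<close>

text \<open>
  A small category whose object set is the type \<open>'o\<close>.  All Hom-spaces are subspaces of one ambient
  vector space \<open>'m\<close> with scalar multiplication \<open>scl\<close>, so that span, dependence and dimension are the
  library notions.  This is no restriction: for an arbitrary small linear category take \<open>'m\<close> to be
  the direct sum of all Hom-spaces.  In particular an arrow does not determine its domain and
  codomain (at least \<open>0\<close> lies in every Hom-space), and all notions below carry the objects
  explicitly.  \<open>cmp C g f\<close> is \<open>g\<close> after \<open>f\<close>; it is unconstrained on pairs that are not composable.
\<close>

record ('o, 'm, 'k) lincat =
  hom :: "'o \<Rightarrow> 'o \<Rightarrow> 'm set"
  idn :: "'o \<Rightarrow> 'm"
  cmp :: "'m \<Rightarrow> 'm \<Rightarrow> 'm"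
  scl :: "'k \<Rightarrow> 'm \<Rightarrow> 'm"

locale linear_category = vector_space "scl C"
  for C :: "('o, 'm::ab_group_add, 'k::field) lincat" +
  assumes hom_subspace: "subspace (hom C X Y)"
    and idn_in_hom: "idn C X \<in> hom C X X"
    and cmp_in_hom: "f \<in> hom C X Y \<Longrightarrow> g \<in> hom C Y Z \<Longrightarrow> cmp C g f \<in> hom C X Z"
    and cmp_idn_right: "f \<in> hom C X Y \<Longrightarrow> cmp C f (idn C X) = f"
    and cmp_idn_left: "f \<in> hom C X Y \<Longrightarrow> cmp C (idn C Y) f = f"
    and cmp_assoc: "f \<in> hom C W X \<Longrightarrow> g \<in> hom C X Y \<Longrightarrow> h \<in> hom C Y Z \<Longrightarrow>
      cmp C (cmp C h g) f = cmp C h (cmp C g f)"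
    and cmp_add_right: "f \<in> hom C X Y \<Longrightarrow> f' \<in> hom C X Y \<Longrightarrow> g \<in> hom C Y Z \<Longrightarrow>
      cmp C g (f + f') = cmp C g f + cmp C g f'"
    and cmp_add_left: "f \<in> hom C X Y \<Longrightarrow> g \<in> hom C Y Z \<Longrightarrow> g' \<in> hom C Y Z \<Longrightarrow>
      cmp C (g + g') f = cmp C g f + cmp C g' f"
    and cmp_scl_right: "f \<in> hom C X Y \<Longrightarrow> g \<in> hom C Y Z \<Longrightarrow> cmp C g (scl C a f) = scl C a (cmp C g f)"
    and cmp_scl_left: "f \<in> hom C X Y \<Longrightarrow> g \<in> hom C Y Z \<Longrightarrow> cmp C (scl C a g) f = scl C a (cmp C g f)"

definition mono_arr :: "('o, 'm::ab_group_add, 'k::field) lincat \<Rightarrow> 'o \<Rightarrow> 'o \<Rightarrow> 'm \<Rightarrow> bool" where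
  "mono_arr C X Y f \<longleftrightarrow> f \<in> hom C X Y \<and>
     (\<forall>W. \<forall>g\<in>hom C W X. \<forall>h\<in>hom C W X. cmp C f g = cmp C f h \<longrightarrow> g = h)"

definition epi_arr :: "('o, 'm::ab_group_add, 'k::field) lincat \<Rightarrow> 'o \<Rightarrow> 'o \<Rightarrow> 'm \<Rightarrow> bool" where
  "epi_arr C X Y f \<longleftrightarrow> f \<in> hom C X Y \<and>
     (\<forall>Z. \<forall>g\<in>hom C Y Z. \<forall>h\<in>hom C Y Z. cmp C g f = cmp C h f \<longrightarrow> g = h)"

definition iso_arr :: "('o, 'm::ab_group_add, 'k::field) lincat \<Rightarrow> 'o \<Rightarrow> 'o \<Rightarrow> 'm \<Rightarrow> bool" where
  "iso_arr C X Y f \<longleftrightarrow> f \<in> hom C X Y \<and>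
     (\<exists>g\<in>hom C Y X. cmp C g f = idn C X \<and> cmp C f g = idn C Y)"

definition isomorphic :: "('o, 'm::ab_group_add, 'k::field) lincat \<Rightarrow> 'o \<Rightarrow> 'o \<Rightarrow> bool" where
  "isomorphic C X Y \<longleftrightarrow> (\<exists>f. iso_arr C X Y f)"

definition zero_object :: "('o, 'm::ab_group_add, 'k::field) lincat \<Rightarrow> 'o \<Rightarrow> bool" where
  "zero_object C Z \<longleftrightarrow> (\<forall>X. hom C X Z = {0} \<and> hom C Z X = {0})"

definition biproduct ::
  "('o, 'm::ab_group_add, 'k::field) lincat \<Rightarrow> 'o \<Rightarrow> 'o \<Rightarrow> 'o \<Rightarrow> 'm \<Rightarrow> 'm \<Rightarrow> 'm \<Rightarrow> 'm \<Rightarrow> bool" where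
  "biproduct C A B P i\<^sub>1 i\<^sub>2 p\<^sub>1 p\<^sub>2 \<longleftrightarrow>
     i\<^sub>1 \<in> hom C A P \<and> i\<^sub>2 \<in> hom C B P \<and> p\<^sub>1 \<in> hom C P A \<and> p\<^sub>2 \<in> hom C P B \<and>
     cmp C p\<^sub>1 i\<^sub>1 = idn C A \<and> cmp C p\<^sub>2 i\<^sub>2 = idn C B \<and>
     cmp C p\<^sub>1 i\<^sub>2 = 0 \<and> cmp C p\<^sub>2 i\<^sub>1 = 0 \<and>
     cmp C i\<^sub>1 p\<^sub>1 + cmp C i\<^sub>2 p\<^sub>2 = idn C P"

definition is_kernel ::
  "('o, 'm::ab_group_add, 'k::field) lincat \<Rightarrow> 'o \<Rightarrow> 'o \<Rightarrow> 'm \<Rightarrow> 'o \<Rightarrow> 'm \<Rightarrow> bool" where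
  "is_kernel C X Y f K k \<longleftrightarrow> f \<in> hom C X Y \<and> k \<in> hom C K X \<and> cmp C f k = 0 \<and>
     (\<forall>W. \<forall>h\<in>hom C W X. cmp C f h = 0 \<longrightarrow> (\<exists>!h'. h' \<in> hom C W K \<and> cmp C k h' = h))"

definition is_cokernel ::
  "('o, 'm::ab_group_add, 'k::field) lincat \<Rightarrow> 'o \<Rightarrow> 'o \<Rightarrow> 'm \<Rightarrow> 'o \<Rightarrow> 'm \<Rightarrow> bool" where
  "is_cokernel C X Y f Q q \<longleftrightarrow> f \<in> hom C X Y \<and> q \<in> hom C Y Q \<and> cmp C q f = 0 \<and>
     (\<forall>Z. \<forall>h\<in>hom C Y Z. cmp C h f = 0 \<longrightarrow> (\<exists>!h'. h' \<in> hom C Q Z \<and> cmp C h' q = h))"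

locale abelian_category = linear_category C
  for C :: "('o, 'm::ab_group_add, 'k::field) lincat" +
  assumes zero_exists: "\<exists>Z. zero_object C Z"
    and biproduct_exists: "\<exists>P i\<^sub>1 i\<^sub>2 p\<^sub>1 p\<^sub>2. biproduct C A B P i\<^sub>1 i\<^sub>2 p\<^sub>1 p\<^sub>2"
    and kernel_exists: "f \<in> hom C X Y \<Longrightarrow> \<exists>K k. is_kernel C X Y f K k"
    and cokernel_exists: "f \<in> hom C X Y \<Longrightarrow> \<exists>Q q. is_cokernel C X Y f Q q"
    and mono_is_kernel: "mono_arr C K X k \<Longrightarrow> \<exists>Y f. is_kernel C X Y f K k"
    and epi_is_cokernel: "epi_arr C Y Q q \<Longrightarrow> \<exists>X f. is_cokernel C X Y f Q q"

definition short_exact ::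
  "('o, 'm::ab_group_add, 'k::field) lincat \<Rightarrow> 'o \<Rightarrow> 'o \<Rightarrow> 'o \<Rightarrow> 'm \<Rightarrow> 'm \<Rightarrow> bool" where
  "short_exact C X Y Z f g \<longleftrightarrow> is_kernel C Y Z g X f \<and> is_cokernel C X Y f Z g"

text \<open>The image of \<open>f\<close> is the kernel of its cokernel.\<close>

definition is_image ::
  "('o, 'm::ab_group_add, 'k::field) lincat \<Rightarrow> 'o \<Rightarrow> 'o \<Rightarrow> 'm \<Rightarrow> 'o \<Rightarrow> 'm \<Rightarrow> bool" where
  "is_image C X Y f I i \<longleftrightarrow> (\<exists>Q q. is_cokernel C X Y f Q q \<and> is_kernel C Y Q q I i)"

definition exact_at ::
  "('o, 'm::ab_group_add, 'k::field) lincat \<Rightarrow> 'o \<Rightarrow> 'o \<Rightarrow> 'o \<Rightarrow> 'm \<Rightarrow> 'm \<Rightarrow> bool" where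
  "exact_at C X Y Z f g \<longleftrightarrow> (\<exists>I i. is_image C X Y f I i \<and> is_kernel C Y Z g I i)"


section \<open>Subobjects, simple objects, filtrations\<close>

definition simple_object :: "('o, 'm::ab_group_add, 'k::field) lincat \<Rightarrow> 'o \<Rightarrow> bool" where
  "simple_object C S \<longleftrightarrow> \<not> zero_object C S \<and>
     (\<forall>U u. mono_arr C U S u \<longrightarrow> zero_object C U \<or> iso_arr C U S u)"

definition indecomposable :: "('o, 'm::ab_group_add, 'k::field) lincat \<Rightarrow> 'o \<Rightarrow> bool" where
  "indecomposable C X \<longleftrightarrow> \<not> zero_object C X \<and>
     (\<forall>A B i\<^sub>1 i\<^sub>2 p\<^sub>1 p\<^sub>2. biproduct C A B X i\<^sub>1 i\<^sub>2 p\<^sub>1 p\<^sub>2 \<longrightarrow> zero_object C A \<or> zero_object C B)"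

text \<open>
  A subobject of an object is given by an object \<open>U\<close> and a monomorphism \<open>u\<close> from \<open>U\<close>;
  \<open>sub_le C U u V v\<close> is the inclusion of \<open>(U, u)\<close> in \<open>(V, v)\<close>.
\<close>

definition sub_le ::
  "('o, 'm::ab_group_add, 'k::field) lincat \<Rightarrow> 'o \<Rightarrow> 'm \<Rightarrow> 'o \<Rightarrow> 'm \<Rightarrow> bool" where
  "sub_le C U u V v \<longleftrightarrow> (\<exists>h\<in>hom C U V. u = cmp C v h)"

definition maximal_subobject ::
  "('o, 'm::ab_group_add, 'k::field) lincat \<Rightarrow> 'o \<Rightarrow> 'o \<Rightarrow> 'm \<Rightarrow> bool" where
  "maximal_subobject C X U u \<longleftrightarrow> mono_arr C U X u \<and> \<not> iso_arr C U X u \<and>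
     (\<forall>V v. mono_arr C V X v \<and> sub_le C U u V v \<longrightarrow> sub_le C V v U u \<or> iso_arr C V X v)"

definition minimal_subobject ::
  "('o, 'm::ab_group_add, 'k::field) lincat \<Rightarrow> 'o \<Rightarrow> 'o \<Rightarrow> 'm \<Rightarrow> bool" where
  "minimal_subobject C X U u \<longleftrightarrow> mono_arr C U X u \<and> \<not> zero_object C U \<and>
     (\<forall>V v. mono_arr C V X v \<and> sub_le C V v U u \<longrightarrow> sub_le C U u V v \<or> zero_object C V)"

text \<open>
  Intersections and sums of (possibly infinite) families of subobjects are greatest lower and least
  upper bounds for inclusion of subobjects.
\<close>

definition is_radical :: "('o, 'm::ab_group_add, 'k::field) lincat \<Rightarrow> 'o \<Rightarrow> 'o \<Rightarrow> 'm \<Rightarrow> bool" where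
  "is_radical C X R r \<longleftrightarrow> mono_arr C R X r \<and>
     (\<forall>U u. maximal_subobject C X U u \<longrightarrow> sub_le C R r U u) \<and>
     (\<forall>W w. mono_arr C W X w \<and> (\<forall>U u. maximal_subobject C X U u \<longrightarrow> sub_le C W w U u)
        \<longrightarrow> sub_le C W w R r)"

definition is_socle :: "('o, 'm::ab_group_add, 'k::field) lincat \<Rightarrow> 'o \<Rightarrow> 'o \<Rightarrow> 'm \<Rightarrow> bool" where
  "is_socle C X S s \<longleftrightarrow> mono_arr C S X s \<and>
     (\<forall>U u. minimal_subobject C X U u \<longrightarrow> sub_le C U u S s) \<and>
     (\<forall>W w. mono_arr C W X w \<and> (\<forall>U u. minimal_subobject C X U u \<longrightarrow> sub_le C U u W w)
        \<longrightarrow> sub_le C S s W w)"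

text \<open>
  \<open>filtration C Qs X\<close>: there is a chain \<open>0 = X\<^sub>0 \<subseteq> X\<^sub>1 \<subseteq> \<dots> \<subseteq> X\<^sub>n = X\<close> of subobjects with successive
  quotients \<open>Qs\<close>, listed from the bottom to the top.
\<close>

inductive filtration :: "('o, 'm::ab_group_add, 'k::field) lincat \<Rightarrow> 'o list \<Rightarrow> 'o \<Rightarrow> bool"
  for C where
  filtration_zero: "zero_object C X \<Longrightarrow> filtration C [] X"
| filtration_step: "filtration C Qs X \<Longrightarrow> short_exact C X Y Q i p \<Longrightarrow> filtration C (Qs @ [Q]) Y"

definition composition_series ::
  "('o, 'm::ab_group_add, 'k::field) lincat \<Rightarrow> 'o list \<Rightarrow> 'o \<Rightarrow> bool" where
  "composition_series C Ss X \<longleftrightarrow> filtration C Ss X \<and> (\<forall>S\<in>set Ss. simple_object C S)"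

definition finite_length :: "('o, 'm::ab_group_add, 'k::field) lincat \<Rightarrow> 'o \<Rightarrow> bool" where
  "finite_length C X \<longleftrightarrow> (\<exists>Ss. composition_series C Ss X)"

text \<open>
  The multiplicity \<open>[X : S]\<close>; by Jordan--Hoelder it does not depend on the chosen composition series.
  It is used only for objects of finite length.
\<close>

definition multiplicity :: "('o, 'm::ab_group_add, 'k::field) lincat \<Rightarrow> 'o \<Rightarrow> 'o \<Rightarrow> nat" where
  "multiplicity C X S =
     length (filter (\<lambda>Q. isomorphic C Q S) (SOME Ss. composition_series C Ss X))"


section \<open>Yoneda extensions\<close>

text \<open>
  For \<open>n \<ge> 1\<close>, an \<open>n\<close>-extension \<open>0 \<rightarrow> Y \<rightarrow> E\<^sub>n \<rightarrow> \<dots> \<rightarrow> E\<^sub>1 \<rightarrow> X \<rightarrow> 0\<close> is the pair of the list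
  \<open>[Y, E\<^sub>n, \<dots>, E\<^sub>1, X]\<close> of its objects and the list of its \<open>n + 1\<close> arrows.
\<close>

definition extensions ::
  "('o, 'm::ab_group_add, 'k::field) lincat \<Rightarrow> nat \<Rightarrow> 'o \<Rightarrow> 'o \<Rightarrow> ('o list \<times> 'm list) set" where
  "extensions C n X Y = {(Es, ds).
     length Es = n + 2 \<and> length ds = n + 1 \<and> Es ! 0 = Y \<and> Es ! (n + 1) = X \<and>
     mono_arr C (Es ! 0) (Es ! 1) (ds ! 0) \<and>
     epi_arr C (Es ! n) (Es ! (n + 1)) (ds ! n) \<and>
     (\<forall>i<n. exact_at C (Es ! i) (Es ! (i + 1)) (Es ! (i + 2)) (ds ! i) (ds ! (i + 1)))}"

definition extension_morphism ::
  "('o, 'm::ab_group_add, 'k::field) lincat \<Rightarrow> nat \<Rightarrow> 'o \<Rightarrow> 'o \<Rightarrow>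
     (('o list \<times> 'm list) \<times> ('o list \<times> 'm list)) set" where
  "extension_morphism C n X Y = {((Es, ds), (Es', ds')).
     (Es, ds) \<in> extensions C n X Y \<and> (Es', ds') \<in> extensions C n X Y \<and>
     (\<exists>as. length as = n + 2 \<and> as ! 0 = idn C Y \<and> as ! (n + 1) = idn C X \<and>
        (\<forall>i\<le>n + 1. as ! i \<in> hom C (Es ! i) (Es' ! i)) \<and>
        (\<forall>i\<le>n. cmp C (as ! (i + 1)) (ds ! i) = cmp C (ds' ! i) (as ! i)))}"

text \<open>
  The underlying set of the Yoneda group \<open>Ext\<^sup>n(X, Y)\<close>, \<open>n \<ge> 1\<close>: classes of \<open>n\<close>-extensions for the
  equivalence relation generated by the morphisms of extensions that are the identity on \<open>X\<close> and
  \<open>Y\<close>.  Only the vanishing of these groups is needed, and a group is zero iff its underlying set is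
  a singleton, so the Baer sum does not occur.
\<close>

definition yoneda_ext ::
  "('o, 'm::ab_group_add, 'k::field) lincat \<Rightarrow> nat \<Rightarrow> 'o \<Rightarrow> 'o \<Rightarrow> ('o list \<times> 'm list) set set" where
  "yoneda_ext C n X Y =
     extensions C n X Y // (extension_morphism C n X Y \<union> (extension_morphism C n X Y)\<inverse>)\<^sup>*"

definition ext_is_zero :: "('o, 'm::ab_group_add, 'k::field) lincat \<Rightarrow> nat \<Rightarrow> 'o \<Rightarrow> 'o \<Rightarrow> bool" where
  "ext_is_zero C n X Y \<longleftrightarrow>
     (if n = 0 then hom C X Y = {0} else is_singleton (yoneda_ext C n X Y))"


section \<open>Standard categories\<close>

definition costandard_object ::
  "('o, 'm::ab_group_add, 'k::field) lincat \<Rightarrow> ('l::order) set \<Rightarrow> ('l \<Rightarrow> 'o) \<Rightarrow> 'l \<Rightarrow> 'o \<Rightarrow> bool" where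
  "costandard_object C \<Lambda> L l N \<longleftrightarrow> (\<exists>S s Q q.
     is_socle C N S s \<and> short_exact C S N Q s q \<and> isomorphic C S (L l) \<and>
     (\<forall>m\<in>\<Lambda>. multiplicity C Q (L m) \<noteq> 0 \<longrightarrow> m < l))"

definition standard_object ::
  "('o, 'm::ab_group_add, 'k::field) lincat \<Rightarrow> ('l::order) set \<Rightarrow> ('l \<Rightarrow> 'o) \<Rightarrow> 'l \<Rightarrow> 'o \<Rightarrow> bool" where
  "standard_object C \<Lambda> L l D \<longleftrightarrow> (\<exists>R r H h.
     is_radical C D R r \<and> short_exact C R D H r h \<and> isomorphic C H (L l) \<and>
     (\<forall>m\<in>\<Lambda>. multiplicity C R (L m) \<noteq> 0 \<longrightarrow> m < l))"

definition filtered_by ::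
  "('o, 'm::ab_group_add, 'k::field) lincat \<Rightarrow> 'l set \<Rightarrow> ('l \<Rightarrow> 'o) \<Rightarrow> 'o \<Rightarrow> bool" where
  "filtered_by C \<Lambda> F X \<longleftrightarrow> (\<exists>Qs. filtration C Qs X \<and> (\<forall>Q\<in>set Qs. \<exists>l\<in>\<Lambda>. isomorphic C Q (F l)))"

definition tilting_object ::
  "('o, 'm::ab_group_add, 'k::field) lincat \<Rightarrow> 'l set \<Rightarrow> ('l \<Rightarrow> 'o) \<Rightarrow> ('l \<Rightarrow> 'o) \<Rightarrow> 'o \<Rightarrow> bool" where
  "tilting_object C \<Lambda> \<Delta> Nabla X \<longleftrightarrow> filtered_by C \<Lambda> \<Delta> X \<and> filtered_by C \<Lambda> Nabla X"

text \<open>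
  The poset is a subset \<open>\<Lambda>\<close> of an ordered type, so that it may be empty.  The families \<open>L\<close>, \<open>\<Delta>\<close>,
  \<open>Nabla\<close> and \<open>Tilt\<close> are meaningful on \<open>\<Lambda>\<close> only.
\<close>

locale standard_category = abelian_category C
  for C :: "('o, 'm::ab_group_add, 'k::field) lincat" +
  fixes \<Lambda> :: "('l::order) set"
    and L \<Delta> Nabla Tilt :: "'l \<Rightarrow> 'o"
  assumes finite_length: "finite_length C X"
    and hom_finite_dim: "\<exists>B. finite B \<and> span B = hom C X Y"
    and L_simple: "l \<in> \<Lambda> \<Longrightarrow> simple_object C (L l)"
    and L_distinct: "l \<in> \<Lambda> \<Longrightarrow> m \<in> \<Lambda> \<Longrightarrow> isomorphic C (L l) (L m) \<Longrightarrow> l = m"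
    and L_complete: "simple_object C S \<Longrightarrow> \<exists>l\<in>\<Lambda>. isomorphic C S (L l)"
    and Nabla_costandard: "l \<in> \<Lambda> \<Longrightarrow> costandard_object C \<Lambda> L l (Nabla l)"
    and Delta_standard: "l \<in> \<Lambda> \<Longrightarrow> standard_object C \<Lambda> L l (\<Delta> l)"
    and hom_Delta_Nabla: "l \<in> \<Lambda> \<Longrightarrow> dim (hom C (\<Delta> l) (Nabla l)) = 1"
    and ext_Delta_Nabla: "l \<in> \<Lambda> \<Longrightarrow> m \<in> \<Lambda> \<Longrightarrow> n \<le> 2 \<Longrightarrow> \<not> (n = 0 \<and> l = m) \<Longrightarrow>
      ext_is_zero C n (\<Delta> l) (Nabla m)"
    and Tilt_tilting: "l \<in> \<Lambda> \<Longrightarrow> tilting_object C \<Lambda> \<Delta> Nabla (Tilt l)"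
    and Tilt_indecomposable: "l \<in> \<Lambda> \<Longrightarrow> indecomposable C (Tilt l)"
    and Tilt_weights: "l \<in> \<Lambda> \<Longrightarrow> m \<in> \<Lambda> \<Longrightarrow> multiplicity C (Tilt l) (L m) \<noteq> 0 \<Longrightarrow> m \<le> l"
    and Tilt_top_weight: "l \<in> \<Lambda> \<Longrightarrow> multiplicity C (Tilt l) (L l) = 1"
    and Tilt_mono: "l \<in> \<Lambda> \<Longrightarrow> \<exists>i. mono_arr C (\<Delta> l) (Tilt l) i"
    and Tilt_epi: "l \<in> \<Lambda> \<Longrightarrow> \<exists>p. epi_arr C (Tilt l) (Nabla l) p"
    and Tilt_distinct: "l \<in> \<Lambda> \<Longrightarrow> m \<in> \<Lambda> \<Longrightarrow> isomorphic C (Tilt l) (Tilt m) \<Longrightarrow> l = m"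
    and Tilt_complete: "tilting_object C \<Lambda> \<Delta> Nabla X \<Longrightarrow> indecomposable C X \<Longrightarrow>
      \<exists>l\<in>\<Lambda>. isomorphic C X (Tilt l)"


section \<open>Standard bases of algebras\<close>

definition indexed_basis ::
  "('k::field \<Rightarrow> 'v::ab_group_add \<Rightarrow> 'v) \<Rightarrow> 'v set \<Rightarrow> 'i set \<Rightarrow> ('i \<Rightarrow> 'v) \<Rightarrow> bool" where
  "indexed_basis scale V I b \<longleftrightarrow>
     inj_on b I \<and> \<not> module.dependent scale (b ` I) \<and> module.span scale (b ` I) = V"

text \<open>
  A finite-dimensional unital associative algebra carried by a subspace \<open>E\<close>; the multiplication is
  unconstrained outside \<open>E\<close>.
\<close>

definition fin_dim_algebra ::
  "('k::field \<Rightarrow> 'v::ab_group_add \<Rightarrow> 'v) \<Rightarrow> ('v \<Rightarrow> 'v \<Rightarrow> 'v) \<Rightarrow> 'v \<Rightarrow> 'v set \<Rightarrow> bool" where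
  "fin_dim_algebra scale mult one E \<longleftrightarrow>
     vector_space scale \<and> (\<exists>B. finite B \<and> module.span scale B = E) \<and>
     one \<in> E \<and> (\<forall>x\<in>E. mult one x = x \<and> mult x one = x) \<and>
     (\<forall>x\<in>E. \<forall>y\<in>E. mult x y \<in> E) \<and>
     (\<forall>x\<in>E. \<forall>y\<in>E. \<forall>z\<in>E. mult (mult x y) z = mult x (mult y z)) \<and>
     (\<forall>x\<in>E. \<forall>y\<in>E. \<forall>z\<in>E. mult x (y + z) = mult x y + mult x z \<and> mult (x + y) z = mult x z + mult y z) \<and>
     (\<forall>a. \<forall>x\<in>E. \<forall>y\<in>E. mult (scale a x) y = scale a (mult x y) \<and> mult x (scale a y) = scale a (mult x y))"

text \<open>\<open>span_below\<close> is \<open>E\<^sup>< \<^sup>l\<close>, the span of all \<open>c m i j\<close> with \<open>m < l\<close>.\<close>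

definition span_below ::
  "('k::field \<Rightarrow> 'v::ab_group_add \<Rightarrow> 'v) \<Rightarrow> ('l::order) set \<Rightarrow> ('l \<Rightarrow> 'i set) \<Rightarrow> ('l \<Rightarrow> 'j set) \<Rightarrow>
     ('l \<Rightarrow> 'i \<Rightarrow> 'j \<Rightarrow> 'v) \<Rightarrow> 'l \<Rightarrow> 'v set" where
  "span_below scale \<Lambda> I J c l =
     module.span scale (\<Union>m\<in>{m\<in>\<Lambda>. m < l}. {c m i j | i j. i \<in> I m \<and> j \<in> J m})"

text \<open>
  A standard basis in the sense of Du and Rui, as a family \<open>c\<close> indexed by the triples
  \<open>(l, i, j)\<close> with \<open>l \<in> \<Lambda>\<close>, \<open>i \<in> I l\<close>, \<open>j \<in> J l\<close>.  Injectivity of the indexing makes the fibres over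
  distinct \<open>l\<close> disjoint.  The independence of the structure constants of \<open>j\<close> resp. \<open>i\<close> is expressed
  by the arguments of \<open>r\<close> and \<open>r'\<close>: \<open>r l k \<phi> i\<close> is \<open>r\<^sub>k(\<phi>, i)\<close> and \<open>r' l k j \<phi>\<close> is \<open>r\<^sub>k(j, \<phi>)\<close>.
\<close>

definition standard_basis ::
  "('k::field \<Rightarrow> 'v::ab_group_add \<Rightarrow> 'v) \<Rightarrow> ('v \<Rightarrow> 'v \<Rightarrow> 'v) \<Rightarrow> 'v \<Rightarrow> 'v set \<Rightarrow>
     ('l::order) set \<Rightarrow> ('l \<Rightarrow> 'i set) \<Rightarrow> ('l \<Rightarrow> 'j set) \<Rightarrow> ('l \<Rightarrow> 'i \<Rightarrow> 'j \<Rightarrow> 'v) \<Rightarrow> bool" where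
  "standard_basis scale mult one E \<Lambda> I J c \<longleftrightarrow>
     fin_dim_algebra scale mult one E \<and>
     indexed_basis scale E (SIGMA l:\<Lambda>. I l \<times> J l) (\<lambda>(l, i, j). c l i j) \<and>
     (\<exists>r. \<forall>\<phi>\<in>E. \<forall>l\<in>\<Lambda>. \<forall>i\<in>I l. \<forall>j\<in>J l.
        mult \<phi> (c l i j) - (\<Sum>k\<in>I l. scale (r l k \<phi> i) (c l k j)) \<in> span_below scale \<Lambda> I J c l) \<and>
     (\<exists>r'. \<forall>\<phi>\<in>E. \<forall>l\<in>\<Lambda>. \<forall>i\<in>I l. \<forall>j\<in>J l.
        mult (c l i j) \<phi> - (\<Sum>k\<in>J l. scale (r' l k j \<phi>) (c l i k)) \<in> span_below scale \<Lambda> I J c l)"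

end

theory Submission
  imports Defs
begin

text \<open>
  Every morphism \<open>\<phi> : M \<rightarrow> N\<close> from an object with a standard filtration to an object with a costandard
  filtration is a sum of composites \<open>M \<rightarrow> Tilt m \<rightarrow> N\<close>.  In the case \<open>N = Nabla m\<close> this says that \<open>\<phi>\<close>
  lifts along \<open>\<pi> m : Tilt m \<rightarrow> Nabla m\<close> (lemma \<open>lift_along_pi\<close>); the general case follows by
  induction on the costandard filtration, as \<open>Ext\<^sup>1(Tilt m, Nabla l) = 0\<close> lifts factorizations through
  \<open>Tilt m\<close> from a quotient of \<open>N\<close> to \<open>N\<close> (lemma \<open>hom_spanned_via_Tilt\<close>).

  Each factor can be compared with the given bases.  A morphism \<open>u : Tilt l \<rightarrow> N\<close> agrees on \<open>\<Delta> l\<close>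
  with a linear combination of the lifts of the basis of \<open>Hom(\<Delta> l, N)\<close>.  The difference kills \<open>\<Delta> l\<close>,
  and a morphism \<open>h\<close> that kills \<open>\<Delta> l\<close> is a sum of composites \<open>Tilt l \<rightarrow> Tilt m \<rightarrow> N\<close> with \<open>m < l\<close>
  (lemma \<open>killing_iota_factors_below\<close>): \<open>h\<close> is defined on \<open>Tilt l / \<Delta> l\<close>, which has nonzero
  morphisms to \<open>Nabla m\<close> only for \<open>m < l\<close>.  Write \<open>c m i j\<close> for the composites of the given lifts.
  Together with the dual statement for \<open>v : M \<rightarrow> Tilt l\<close> this shows that \<open>u \<cdot> v\<close> lies in the span of
  the \<open>c m i j\<close> with \<open>m \<le> l\<close> (lemma \<open>cmp_via_Tilt\<close>), by an induction that terminates because only the finitely many \<open>m\<close> with \<open>Hom(\<Delta> m, N) \<noteq> 0\<close> or \<open>Hom(M, Nabla m) \<noteq> 0\<close>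
  occur.  So the \<open>c m i j\<close> span.  They are independent because their number is at most the dimension
  of \<open>Hom(M, N)\<close>, by additivity of dimensions along the filtrations (lemma \<open>dim_hom_ge\<close>).

  For the multiplication rule, \<open>\<phi>\<close> times a lift of \<open>x : \<Delta> l \<rightarrow> T\<close> is a lift of \<open>\<phi> \<cdot> x\<close>.  Up to the same
  linear combination of the chosen lifts as for \<open>\<phi> \<cdot> x\<close>, it kills \<open>\<Delta> l\<close>, so that the error lies in the
  span of the \<open>c m i j\<close> with \<open>m < l\<close>.

  The existence of lifts rests on the condition \<open>[Tilt l : L l] = 1\<close>.  Two nonzero morphisms
  \<open>a : \<Delta> l \<rightarrow> Tilt l\<close> and \<open>b : Tilt l \<rightarrow> Nabla l\<close> with \<open>b \<cdot> a = 0\<close> would detect two different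
  composition factors \<open>L l\<close> (lemma \<open>filtration_two_factors\<close>).  In particular \<open>\<pi> l \<cdot> \<iota> l \<noteq> 0\<close>, and so
  \<open>Hom(\<Delta> m, Tilt l) \<rightarrow> Hom(\<Delta> m, Nabla l)\<close> is surjective for all \<open>m\<close>, which gives
  \<open>Ext\<^sup>1(\<Delta> m, ker \<pi> l) = 0\<close> and hence lifts along \<open>\<pi> l\<close>.

  The dual statements are obtained by reversing all arrows.
\<close>

section \<open>Maps that are linear on a subspace\<close>

text \<open>
  Composition with a fixed morphism is linear where it is defined, on a Hom-space, which is only a
  subspace of the ambient space.
\<close>

definition (in vector_space) linear_on :: "'b set \<Rightarrow> ('b \<Rightarrow> 'b) \<Rightarrow> bool" where
  "linear_on V F \<longleftrightarrow> subspace V \<and> (\<forall>x\<in>V. \<forall>y\<in>V. F (x + y) = F x + F y) \<and>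
     (\<forall>a. \<forall>x\<in>V. F (scale a x) = scale a (F x))"

context vector_space
begin

lemma linear_on_add: "linear_on V F \<Longrightarrow> x \<in> V \<Longrightarrow> y \<in> V \<Longrightarrow> F (x + y) = F x + F y"
  and linear_on_scale: "linear_on V F \<Longrightarrow> x \<in> V \<Longrightarrow> F (scale a x) = scale a (F x)"
  and linear_on_subspace: "linear_on V F \<Longrightarrow> subspace V"
  by (simp_all add: linear_on_def)

lemma linear_on_0:
  assumes "linear_on V F"
  shows "F 0 = 0"
  using linear_on_scale[OF assms subspace_0[OF linear_on_subspace[OF assms]], of 0] by simp

lemma linear_on_neg: "linear_on V F \<Longrightarrow> x \<in> V \<Longrightarrow> F (- x) = - F x"
  using linear_on_scale[of V F x "- 1"] by simp

lemma linear_on_diff: "linear_on V F \<Longrightarrow> x \<in> V \<Longrightarrow> y \<in> V \<Longrightarrow> F (x - y) = F x - F y"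
  using linear_on_add[of V F x "- y"] linear_on_neg[of V F y] subspace_neg[of V y]
  by (simp add: linear_on_subspace)

lemma linear_on_sum:
  assumes "linear_on V F" "\<And>i. i \<in> A \<Longrightarrow> x i \<in> V"
  shows "F (\<Sum>i\<in>A. x i) = (\<Sum>i\<in>A. F (x i))"
  using assms(2)
proof (induction A rule: infinite_finite_induct)
  case (insert i A)
  then have "(\<Sum>i\<in>A. x i) \<in> V"
    by (intro subspace_sum linear_on_subspace[OF assms(1)]) auto
  with insert show ?case by (simp add: linear_on_add[OF assms(1)])
qed (simp_all add: linear_on_0[OF assms(1)])

lemma linear_on_image_subspace:
  assumes "linear_on V F"
  shows "subspace (F ` V)"
proof (rule subspaceI)
  note V = linear_on_subspace[OF assms]
  show "0 \<in> F ` V" using linear_on_0[OF assms] subspace_0[OF V] by (metis imageI)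
  show "x + y \<in> F ` V" if "x \<in> F ` V" "y \<in> F ` V" for x y
    using that subspace_add[OF V] linear_on_add[OF assms] by (auto simp: image_iff) metis
  show "scale c x \<in> F ` V" if "x \<in> F ` V" for c x
    using that subspace_scale[OF V] linear_on_scale[OF assms] by (auto simp: image_iff) metis
qed

lemma linear_on_subset: "linear_on V F \<Longrightarrow> subspace W \<Longrightarrow> W \<subseteq> V \<Longrightarrow> linear_on W F"
  unfolding linear_on_def by blast

lemma linear_on_span_image:
  assumes F: "linear_on V F" and B: "B \<subseteq> V"
  shows "span (F ` B) = F ` span B"
proof
  have sub: "span B \<subseteq> V" using span_minimal[OF B linear_on_subspace[OF F]] .
  have F': "linear_on (span B) F" by (rule linear_on_subset[OF F _ sub]) simp
  show "span (F ` B) \<subseteq> F ` span B"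
    by (intro span_minimal linear_on_image_subspace[OF F'] image_mono span_superset)
  have "x \<in> V \<and> F x \<in> span (F ` B)" if "x \<in> span B" for x
    using that
  proof (induction x rule: span_induct_alt)
    case base
    show ?case
      by (simp add: linear_on_0[OF F] span_zero subspace_0[OF linear_on_subspace[OF F]])
  next
    case (step c x y)
    have "x \<in> V" "scale c x \<in> V" "y \<in> V"
      using step B linear_on_subspace[OF F] by (auto intro: subspace_scale)
    then have "F (scale c x + y) = scale c (F x) + F y" "scale c x + y \<in> V"
      using linear_on_subspace[OF F]
      by (simp_all add: linear_on_add[OF F] linear_on_scale[OF F] subspace_add)
    with step show ?case by (auto intro: span_add span_scale span_base)
  qed
  then show "F ` span B \<subseteq> span (F ` B)" by blast
qed

lemma basis_of_subspace:
  assumes "subspace V" "finite S" "V \<subseteq> span S"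
  obtains B where "B \<subseteq> V" "finite B" "independent B" "span B = V" "card B = dim V"
proof -
  obtain B where B: "B \<subseteq> V" "independent B" "V \<subseteq> span B" "card B = dim V"
    using basis_exists by blast
  have "finite B" using independent_span_bound[OF assms(2) B(2)] B(1) assms(3) by blast
  moreover have "span B = V" using span_subspace[OF B(1,3) assms(1)] .
  ultimately show thesis using that B by blast
qed

lemma dim_exact_sequence:
  assumes a: "linear_on V' a" and b: "linear_on V b"
    and fin: "finite S'" "V' \<subseteq> span S'" "finite S" "V \<subseteq> span S" 
    and ker: "{v \<in> V. b v = 0} = a ` V'" and inj: "inj_on a V'" and surj: "b ` V = V''"
  shows "dim V = dim V' + dim V''"
proof -
  obtain B' where B': "B' \<subseteq> V'" "finite B'" "independent B'" "span B' = V'" "card B' = dim V'"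
    using basis_of_subspace[OF linear_on_subspace[OF a] fin(1,2)] .
  have V: "subspace V" by (rule linear_on_subspace[OF b])
  have aV: "a ` V' \<subseteq> V" using ker by blast
  have spana: "span (a ` B') = a ` V'"
    using linear_on_span_image[OF a B'(1)] B'(4) by simp
  obtain K where K: "K \<subseteq> a ` V'" "finite K" "independent K" "span K = a ` V'" "card K = dim (a ` V')"
  proof (rule basis_of_subspace[OF linear_on_image_subspace[OF a] fin(3)])
    show "a ` V' \<subseteq> span S" using aV fin(4) by blast
  qed
  have dimV': "dim V' = card K"
  proof (rule antisym)
    \<comment> \<open>\<open>K\<close> pulls back along the injective \<open>a\<close> to a spanning set of \<open>V'\<close>.\<close>
    obtain K' where K': "K' \<subseteq> V'" "K = a ` K'" "inj_on a K'"
      using K(1) by (meson subset_image_inj)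
    have "a ` V' \<subseteq> a ` span K'" using K(4) K'(2) linear_on_span_image[OF a K'(1)] by simp
    then have "V' \<subseteq> span K'"
      using inj_onD[OF inj] span_minimal[OF K'(1) linear_on_subspace[OF a]] by blast
    moreover have "finite K'" using K(2) K' by (simp add: finite_image_iff)
    ultimately show "dim V' \<le> card K" using dim_le_card[of V' K'] K' by (simp add: card_image)
    have "card K \<le> card (a ` B')"
      using independent_span_bound[of "a ` B'" K] B'(2) K(1,3) spana by simp
    then show "card K \<le> dim V'" using card_image_le[OF B'(2), of a] B'(5) by linarith
  qed
  \<comment> \<open>For \<open>\<ge>\<close>: the vectors that complete \<open>K\<close> to a basis of \<open>V\<close> span \<open>V''\<close>.\<close>
  obtain B where B: "K \<subseteq> B" "B \<subseteq> V" "independent B" "V \<subseteq> span B"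
    using maximal_independent_subset_extend[of K V] K(1,3) aV by blast
  have finB: "finite B" using independent_span_bound[OF fin(3) B(3)] B(2) fin(4) by blast
  have cardB: "card B = dim V" using basis_card_eq_dim[OF B(2,4,3)] .
  have spanB: "span B = V" using span_subspace[OF B(2,4) V] .
  have "V'' \<subseteq> span (b ` (B - K))"
  proof -
    have "b ` B \<subseteq> insert 0 (b ` (B - K))" using K(1) ker by auto
    then have "span (b ` B) \<subseteq> span (b ` (B - K))"
      using span_mono span_insert_0 by blast
    then show ?thesis using linear_on_span_image[OF b B(2)] spanB surj by simp
  qed
  then have "dim V'' \<le> card (b ` (B - K))" using dim_le_card finB by blast
  also have "\<dots> \<le> card (B - K)" using card_image_le finB by blast
  finally have ge: "dim V'' + card K \<le> dim V"
    using card_Diff_subset[OF K(2) B(1)] cardB card_mono[OF finB B(1)] by linarith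
  \<comment> \<open>For \<open>\<le>\<close>: \<open>K\<close> and preimages \<open>D\<close> of a basis of \<open>V''\<close> span \<open>V\<close>.\<close>
  obtain B'' where B'': "B'' \<subseteq> V''" "finite B''" "span B'' = V''" "card B'' = dim V''"
  proof (rule basis_of_subspace[of V'' "b ` S \<union> b ` B"])
    show "subspace V''" using linear_on_image_subspace[OF b] surj by simp
    show "finite (b ` S \<union> b ` B)" using fin(3) finB by simp
    have "V'' = span (b ` B)" using linear_on_span_image[OF b B(2)] spanB surj by simp
    then show "V'' \<subseteq> span (b ` S \<union> b ` B)" using span_mono[of "b ` B" "b ` S \<union> b ` B"] by simp
  qed
  obtain D where D: "D \<subseteq> V" "B'' = b ` D" "inj_on b D"
    using B''(1) surj by (metis subset_image_inj)
  have finD: "finite D" using B''(2) D by (simp add: finite_image_iff)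
  have "V \<subseteq> span (K \<union> D)"
  proof
    fix v assume v: "v \<in> V"
    then have "b v \<in> b ` span D"
      using surj B''(3) D(2) linear_on_span_image[OF b D(1)] by auto
    then obtain w where w: "w \<in> span D" "b v = b w" by auto
    then have "w \<in> V" using span_minimal[OF D(1) V] by blast
    then have "v - w \<in> a ` V'"
      using v w ker linear_on_diff[OF b, of v w] subspace_diff[OF V, of v w] by auto
    then have "v - w \<in> span (K \<union> D)" using K(4) span_mono[of K "K \<union> D"] by auto
    moreover have "w \<in> span (K \<union> D)" using w span_mono[of D "K \<union> D"] by auto
    ultimately show "v \<in> span (K \<union> D)" using span_add by fastforce
  qed
  then have "dim V \<le> card (K \<union> D)" using dim_le_card K(2) finD by blast
  also have "\<dots> \<le> card K + card D" by (rule card_Un_le)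
  finally have "dim V \<le> card K + dim V''" using B''(4) D card_image[OF D(3)] by simp
  with ge dimV' show ?thesis by linarith
qed

lemma spanning_family_is_basis:
  assumes "finite I" "span (c ` I) = V" "card I \<le> dim V"
  shows "indexed_basis scale V I c"
proof -
  have cardI: "card I = card (c ` I)" and "dim V = card (c ` I)"
    using dim_le_card[of V "c ` I"] card_image_le[OF assms(1), of c] assms by auto
  obtain B where B: "B \<subseteq> c ` I" "independent B" "c ` I \<subseteq> span B"
    using maximal_independent_subset by blast
  have "span B = V"
    using span_mono[OF B(1)] span_minimal[OF B(3)] assms(2) by auto
  then have "card B = card (c ` I)"
    using dim_span_eq_card_independent[OF B(2)] \<open>dim V = card (c ` I)\<close> by simp
  then have "B = c ` I" using card_subset_eq[OF _ B(1)] assms(1) by simp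
  with B(2) assms(2) eq_card_imp_inj_on[OF assms(1) cardI[symmetric]] show ?thesis
    by (simp add: indexed_basis_def)
qed

end

section \<open>Linear categories\<close>

context linear_category
begin

abbreviation comp :: "'m \<Rightarrow> 'm \<Rightarrow> 'm" (infixr "\<cdot>" 70) where
  "g \<cdot> f \<equiv> cmp C g f"

lemma zero_in_hom [simp]: "0 \<in> hom C X Y"
  by (rule subspace_0[OF hom_subspace])

lemma linear_on_post: "g \<in> hom C Y Z \<Longrightarrow> linear_on (hom C X Y) (\<lambda>f. g \<cdot> f)"
  by (auto simp: linear_on_def hom_subspace intro: cmp_add_right cmp_scl_right)

lemma linear_on_pre: "f \<in> hom C X Y \<Longrightarrow> linear_on (hom C Y Z) (\<lambda>g. g \<cdot> f)"
  by (auto simp: linear_on_def hom_subspace intro: cmp_add_left cmp_scl_left)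

lemmas hom_add = subspace_add[OF hom_subspace]
  and hom_diff = subspace_diff[OF hom_subspace]
  and hom_scl = subspace_scale[OF hom_subspace]
  and hom_sum = subspace_sum[OF hom_subspace]

lemma cmp_zero_right: "g \<in> hom C Y Z \<Longrightarrow> g \<cdot> 0 = 0"
  by (rule linear_on_0[OF linear_on_post])

lemma cmp_zero_left: "f \<in> hom C X Y \<Longrightarrow> 0 \<cdot> f = 0"
  by (rule linear_on_0[OF linear_on_pre])

lemma cmp_diff_right: "f \<in> hom C X Y \<Longrightarrow> f' \<in> hom C X Y \<Longrightarrow> g \<in> hom C Y Z \<Longrightarrow>
    g \<cdot> (f - f') = g \<cdot> f - g \<cdot> f'"
  by (rule linear_on_diff[OF linear_on_post])

lemma cmp_diff_left: "f \<in> hom C X Y \<Longrightarrow> g \<in> hom C Y Z \<Longrightarrow> g' \<in> hom C Y Z \<Longrightarrow>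
    (g - g') \<cdot> f = g \<cdot> f - g' \<cdot> f"
  by (rule linear_on_diff[OF linear_on_pre])

lemma mono_arr_in_hom: "mono_arr C X Y f \<Longrightarrow> f \<in> hom C X Y"
  and epi_arr_in_hom: "epi_arr C X Y f \<Longrightarrow> f \<in> hom C X Y"
  and iso_arr_in_hom: "iso_arr C X Y f \<Longrightarrow> f \<in> hom C X Y"
  by (simp_all add: mono_arr_def epi_arr_def iso_arr_def)

lemma mono_arr_cancel:
  "mono_arr C X Y f \<Longrightarrow> g \<in> hom C W X \<Longrightarrow> h \<in> hom C W X \<Longrightarrow> f \<cdot> g = f \<cdot> h \<Longrightarrow> g = h"
  by (auto simp: mono_arr_def)

lemma epi_arr_cancel:
  "epi_arr C X Y f \<Longrightarrow> g \<in> hom C Y Z \<Longrightarrow> h \<in> hom C Y Z \<Longrightarrow> g \<cdot> f = h \<cdot> f \<Longrightarrow> g = h"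
  by (auto simp: epi_arr_def)

lemma mono_arr_eq_0: "mono_arr C X Y f \<Longrightarrow> g \<in> hom C W X \<Longrightarrow> f \<cdot> g = 0 \<Longrightarrow> g = 0"
  by (rule mono_arr_cancel) (auto simp: cmp_zero_right mono_arr_def)

lemma epi_arr_eq_0: "epi_arr C X Y f \<Longrightarrow> g \<in> hom C Y Z \<Longrightarrow> g \<cdot> f = 0 \<Longrightarrow> g = 0"
  by (rule epi_arr_cancel) (auto simp: cmp_zero_left epi_arr_def)

lemma mono_arrI:
  assumes f: "f \<in> hom C X Y" and z: "\<And>W g. g \<in> hom C W X \<Longrightarrow> f \<cdot> g = 0 \<Longrightarrow> g = 0"
  shows "mono_arr C X Y f"
  unfolding mono_arr_def
proof (intro conjI allI ballI impI f)
  fix W g h assume gh: "g \<in> hom C W X" "h \<in> hom C W X" "f \<cdot> g = f \<cdot> h"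
  then have "f \<cdot> (g - h) = 0" using f by (simp add: cmp_diff_right)
  then show "g = h" using z[of "g - h" W] gh by (simp add: hom_diff)
qed

lemma epi_arrI:
  assumes f: "f \<in> hom C X Y" and z: "\<And>Z g. g \<in> hom C Y Z \<Longrightarrow> g \<cdot> f = 0 \<Longrightarrow> g = 0"
  shows "epi_arr C X Y f"
  unfolding epi_arr_def
proof (intro conjI allI ballI impI f)
  fix Z g h assume gh: "g \<in> hom C Y Z" "h \<in> hom C Y Z" "g \<cdot> f = h \<cdot> f"
  then have "(g - h) \<cdot> f = 0" using f by (simp add: cmp_diff_left)
  then show "g = h" using z[of "g - h" Z] gh by (simp add: hom_diff)
qed

lemma iso_arr_mono: "iso_arr C X Y f \<Longrightarrow> mono_arr C X Y f"
proof (rule mono_arrI)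
  assume iso: "iso_arr C X Y f"
  then show f: "f \<in> hom C X Y" by (rule iso_arr_in_hom)
  fix W g assume g: "g \<in> hom C W X" "f \<cdot> g = 0"
  obtain f' where f': "f' \<in> hom C Y X" "f' \<cdot> f = idn C X" using iso by (auto simp: iso_arr_def)
  have "g = (f' \<cdot> f) \<cdot> g" using f' g by (simp add: cmp_idn_left)
  also have "\<dots> = 0" using cmp_assoc[OF g(1) f f'(1)] g(2) cmp_zero_right[OF f'(1)] by simp
  finally show "g = 0" .
qed

lemma iso_arr_epi: "iso_arr C X Y f \<Longrightarrow> epi_arr C X Y f"
proof (rule epi_arrI)
  assume iso: "iso_arr C X Y f"
  then show f: "f \<in> hom C X Y" by (rule iso_arr_in_hom)
  fix Z g assume g: "g \<in> hom C Y Z" "g \<cdot> f = 0"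
  obtain f' where f': "f' \<in> hom C Y X" "f \<cdot> f' = idn C Y" using iso by (auto simp: iso_arr_def)
  have "g = g \<cdot> (f \<cdot> f')" using f' g by (simp add: cmp_idn_right)
  also have "\<dots> = 0" using cmp_assoc[OF f'(1) f g(1)] g(2) cmp_zero_left[OF f'(1)] by simp
  finally show "g = 0" .
qed

lemma mono_comp:
  assumes "mono_arr C X Y f" "mono_arr C Y Z g"
  shows "mono_arr C X Z (g \<cdot> f)"
proof (rule mono_arrI)
  note fg = assms[THEN mono_arr_in_hom]
  show "g \<cdot> f \<in> hom C X Z" using fg by (rule cmp_in_hom)
  fix W h assume h: "h \<in> hom C W X" "(g \<cdot> f) \<cdot> h = 0"
  then have "g \<cdot> (f \<cdot> h) = 0" using cmp_assoc[OF h(1) fg] by simp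
  then show "h = 0" using assms h(1) fg cmp_in_hom by (metis mono_arr_eq_0)
qed

lemma epi_comp:
  assumes "epi_arr C X Y f" "epi_arr C Y Z g"
  shows "epi_arr C X Z (g \<cdot> f)"
proof (rule epi_arrI)
  note fg = assms[THEN epi_arr_in_hom]
  show "g \<cdot> f \<in> hom C X Z" using fg by (rule cmp_in_hom)
  fix W h assume h: "h \<in> hom C Z W" "h \<cdot> (g \<cdot> f) = 0"
  then have "(h \<cdot> g) \<cdot> f = 0" using cmp_assoc[OF fg h(1)] by simp
  then show "h = 0" using assms h(1) fg cmp_in_hom by (metis epi_arr_eq_0)
qed

lemma mono_right_factor:
  assumes f: "f \<in> hom C X Y" and g: "g \<in> hom C Y Z" and gf: "mono_arr C X Z (g \<cdot> f)"
  shows "mono_arr C X Y f"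
proof (rule mono_arrI[OF f])
  fix W h assume h: "h \<in> hom C W X" "f \<cdot> h = 0"
  then have "(g \<cdot> f) \<cdot> h = 0" using cmp_assoc[OF h(1) f g] cmp_zero_right[OF g] by simp
  then show "h = 0" using mono_arr_eq_0[OF gf h(1)] by simp
qed

lemma epi_left_factor:
  assumes f: "f \<in> hom C X Y" and g: "g \<in> hom C Y Z" and gf: "epi_arr C X Z (g \<cdot> f)"
  shows "epi_arr C Y Z g"
proof (rule epi_arrI[OF g])
  fix W h assume h: "h \<in> hom C Z W" "h \<cdot> g = 0"
  then have "h \<cdot> (g \<cdot> f) = 0" using cmp_assoc[OF f g h(1)] cmp_zero_left[OF f] by simp
  then show "h = 0" using epi_arr_eq_0[OF gf h(1)] by simp
qed

lemma zero_object_iff: "zero_object C Z \<longleftrightarrow> idn C Z = 0"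
proof
  assume "zero_object C Z"
  then show "idn C Z = 0" using idn_in_hom[of Z] by (auto simp: zero_object_def)
next
  assume id: "idn C Z = 0"
  have "f = 0" if "f \<in> hom C X Z" for X f
    using cmp_idn_left[OF that] cmp_zero_left[OF that] id by simp
  moreover have "f = 0" if "f \<in> hom C Z X" for X f
    using cmp_idn_right[OF that] cmp_zero_right[OF that] id by simp
  ultimately show "zero_object C Z" by (auto simp: zero_object_def)
qed

lemma into_zero_object: "zero_object C Z \<Longrightarrow> f \<in> hom C X Z \<Longrightarrow> f = 0"
  and from_zero_object: "zero_object C Z \<Longrightarrow> f \<in> hom C Z X \<Longrightarrow> f = 0"
  by (auto simp: zero_object_def)

lemma zero_mono_source: "mono_arr C X Y 0 \<Longrightarrow> zero_object C X"
  using mono_arr_eq_0[OF _ idn_in_hom] cmp_zero_left[OF idn_in_hom] by (auto simp: zero_object_iff)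

lemma zero_epi_target: "epi_arr C X Y 0 \<Longrightarrow> zero_object C Y"
  using epi_arr_eq_0[OF _ idn_in_hom] cmp_zero_right[OF idn_in_hom] by (auto simp: zero_object_iff)

lemma is_kernel_zero: "is_kernel C X Y f K k \<Longrightarrow> f \<cdot> k = 0"
  and is_kernel_hom: "is_kernel C X Y f K k \<Longrightarrow> k \<in> hom C K X"
  and is_kernel_hom': "is_kernel C X Y f K k \<Longrightarrow> f \<in> hom C X Y"
  by (simp_all add: is_kernel_def)

lemma is_cokernel_zero: "is_cokernel C X Y f Q q \<Longrightarrow> q \<cdot> f = 0"
  and is_cokernel_hom: "is_cokernel C X Y f Q q \<Longrightarrow> q \<in> hom C Y Q"
  by (simp_all add: is_cokernel_def)

lemma is_kernel_factor:
  assumes "is_kernel C X Y f K k" "h \<in> hom C W X" "f \<cdot> h = 0"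
  obtains h' where "h' \<in> hom C W K" "k \<cdot> h' = h"
  using assms unfolding is_kernel_def by blast

lemma is_cokernel_factor:
  assumes "is_cokernel C X Y f Q q" "h \<in> hom C Y Z" "h \<cdot> f = 0"
  obtains h' where "h' \<in> hom C Q Z" "h' \<cdot> q = h"
  using assms unfolding is_cokernel_def by blast

lemma is_kernel_mono:
  assumes "is_kernel C X Y f K k"
  shows "mono_arr C K X k"
proof (rule mono_arrI)
  show k: "k \<in> hom C K X" using assms by (rule is_kernel_hom)
  fix W g assume g: "g \<in> hom C W K" "k \<cdot> g = 0"
  have "\<exists>!h'. h' \<in> hom C W K \<and> k \<cdot> h' = 0"
    using assms zero_in_hom[of W X] cmp_zero_right unfolding is_kernel_def by blast
  then show "g = 0" using g cmp_zero_right[OF k] zero_in_hom by blast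
qed

lemma is_cokernel_epi:
  assumes "is_cokernel C X Y f Q q"
  shows "epi_arr C Y Q q"
proof (rule epi_arrI)
  show q: "q \<in> hom C Y Q" using assms by (rule is_cokernel_hom)
  fix Z g assume g: "g \<in> hom C Q Z" "g \<cdot> q = 0"
  have "\<exists>!h'. h' \<in> hom C Q Z \<and> h' \<cdot> q = 0"
    using assms zero_in_hom[of Y Z] cmp_zero_left unfolding is_cokernel_def by blast
  then show "g = 0" using g cmp_zero_left[OF q] zero_in_hom by blast
qed

lemma is_kernelI:
  assumes "mono_arr C K X k" "f \<in> hom C X Y" "f \<cdot> k = 0"
    and "\<And>W h. h \<in> hom C W X \<Longrightarrow> f \<cdot> h = 0 \<Longrightarrow> \<exists>h'\<in>hom C W K. k \<cdot> h' = h"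
  shows "is_kernel C X Y f K k"
  unfolding is_kernel_def
  using assms(2-4) mono_arr_in_hom[OF assms(1)] mono_arr_cancel[OF assms(1)]
  by (auto simp: Ex1_def Bex_def) metis

lemma short_exactD:
  assumes "short_exact C X Y Z i p"
  shows "mono_arr C X Y i" "epi_arr C Y Z p" "p \<cdot> i = 0" "i \<in> hom C X Y" "p \<in> hom C Y Z"
  using assms is_kernel_mono[of Y Z p X i] is_cokernel_epi[of X Y i Z p]
  by (auto simp: short_exact_def is_kernel_def)

lemma short_exact_factor:
  assumes "short_exact C X Y Z i p" "h \<in> hom C W Y" "p \<cdot> h = 0"
  obtains h' where "h' \<in> hom C W X" "i \<cdot> h' = h"
  using assms is_kernel_factor by (metis short_exact_def)

lemma short_exact_cofactor:
  assumes "short_exact C X Y Z i p" "h \<in> hom C Y W" "h \<cdot> i = 0"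
  obtains h' where "h' \<in> hom C Z W" "h' \<cdot> p = h"
  using assms is_cokernel_factor by (metis short_exact_def)

end

text \<open>
  Since the opposite of an abelian category is abelian, a statement that holds in all abelian
  categories also holds with all arrows reversed; the simplification rules below translate it back.
\<close>

definition opposite :: "('o, 'm, 'k) lincat \<Rightarrow> ('o, 'm, 'k) lincat" where
  "opposite C = \<lparr>hom = (\<lambda>X Y. hom C Y X), idn = idn C, cmp = (\<lambda>g f. cmp C f g), scl = scl C\<rparr>"

lemma opposite_simps [simp]:
  "hom (opposite C) X Y = hom C Y X" "idn (opposite C) = idn C"
  "cmp (opposite C) g f = cmp C f g" "scl (opposite C) = scl C"
  by (simp_all add: opposite_def)

lemma opposite_mono [simp]: "mono_arr (opposite C) X Y f \<longleftrightarrow> epi_arr C Y X f"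
  and opposite_epi [simp]: "epi_arr (opposite C) X Y f \<longleftrightarrow> mono_arr C Y X f"
  by (simp_all add: mono_arr_def epi_arr_def)

lemma opposite_kernel [simp]: "is_kernel (opposite C) X Y f K k \<longleftrightarrow> is_cokernel C Y X f K k"
  and opposite_cokernel [simp]: "is_cokernel (opposite C) X Y f K k \<longleftrightarrow> is_kernel C Y X f K k"
  by (simp_all add: is_kernel_def is_cokernel_def)

lemma opposite_short_exact [simp]: "short_exact (opposite C) X Y Z i p \<longleftrightarrow> short_exact C Z Y X p i"
  by (auto simp: short_exact_def)

lemma opposite_zero_object [simp]: "zero_object (opposite C) Z \<longleftrightarrow> zero_object C Z"
  by (auto simp: zero_object_def)

lemma opposite_biproduct [simp]:
  "biproduct (opposite C) A B P i\<^sub>1 i\<^sub>2 p\<^sub>1 p\<^sub>2 \<longleftrightarrow> biproduct C A B P p\<^sub>1 p\<^sub>2 i\<^sub>1 i\<^sub>2"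
  by (auto simp: biproduct_def)

lemma opposite_linear_category:
  assumes "linear_category C"
  shows "linear_category (opposite C)"
proof -
  interpret linear_category C by fact
  have vs: "vector_space (scl (opposite C))" using vector_space_axioms by simp
  then interpret op: vector_space "scl (opposite C)" .
  show ?thesis
    by (intro linear_category.intro vs linear_category_axioms.intro)
      (auto intro: hom_subspace idn_in_hom cmp_in_hom cmp_idn_left cmp_idn_right
        cmp_add_right cmp_add_left cmp_scl_right cmp_scl_left cmp_assoc[symmetric])
qed

lemma opposite_abelian_category:
  assumes "abelian_category C"
  shows "abelian_category (opposite C)"
proof -
  interpret abelian_category C by fact
  show ?thesis
  proof (intro abelian_category.intro abelian_category_axioms.intro)
    show "linear_category (opposite C)"
      by (rule opposite_linear_category) (rule linear_category_axioms)
    show "\<exists>Z. zero_object (opposite C) Z" using zero_exists by simp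
    show "\<exists>P i\<^sub>1 i\<^sub>2 p\<^sub>1 p\<^sub>2. biproduct (opposite C) A B P i\<^sub>1 i\<^sub>2 p\<^sub>1 p\<^sub>2" for A B
      using biproduct_exists[of A B] by (simp, blast)
    show "\<exists>K k. is_kernel (opposite C) X Y f K k" if "f \<in> hom (opposite C) X Y" for f X Y
      using cokernel_exists that by simp
    show "\<exists>Q q. is_cokernel (opposite C) X Y f Q q" if "f \<in> hom (opposite C) X Y" for f X Y
      using kernel_exists that by simp
    show "\<exists>Y f. is_kernel (opposite C) X Y f K k" if "mono_arr (opposite C) K X k" for K X k
      using epi_is_cokernel that by simp
    show "\<exists>X f. is_cokernel (opposite C) X Y f Q q" if "epi_arr (opposite C) Y Q q" for Y Q q
      using mono_is_kernel that by simp
  qed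
qed

section \<open>Abelian categories\<close>

context abelian_category
begin

lemmas opposite_abelian = opposite_abelian_category[OF abelian_category_axioms]

lemma short_exact_cokernel_of_mono:
  assumes m: "mono_arr C X Y i" and q: "is_cokernel C X Y i Q q"
  shows "short_exact C X Y Q i q"
proof -
  obtain Z f where f: "is_kernel C Y Z f X i" using mono_is_kernel[OF m] by blast
  have fi: "f \<in> hom C Y Z" "f \<cdot> i = 0"
    using f by (auto intro: is_kernel_hom' is_kernel_zero)
  obtain f' where f': "f' \<in> hom C Q Z" "f' \<cdot> q = f" using is_cokernel_factor[OF q fi] .
  note q' = is_cokernel_hom[OF q]
  have "is_kernel C Y Q q X i"
  proof (rule is_kernelI[OF m])
    show "q \<in> hom C Y Q" "q \<cdot> i = 0" using q by (auto intro: is_cokernel_hom is_cokernel_zero)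
    fix W h assume h: "h \<in> hom C W Y" "q \<cdot> h = 0"
    have "f \<cdot> h = f' \<cdot> (q \<cdot> h)" using cmp_assoc[OF h(1) q' f'(1)] f'(2) by simp
    then have "f \<cdot> h = 0" using h(2) cmp_zero_right[OF f'(1)] by simp
    then show "\<exists>h'\<in>hom C W X. i \<cdot> h' = h" using is_kernel_factor[OF f h(1)] by metis
  qed
  with q show ?thesis by (simp add: short_exact_def)
qed

lemma short_exact_kernel_of_epi:
  assumes "epi_arr C Y Z p" "is_kernel C Y Z p K k"
  shows "short_exact C K Y Z k p"
  using abelian_category.short_exact_cokernel_of_mono[OF opposite_abelian, of Z Y p K k] assms
  by simp

lemma mono_extend_exact:
  assumes "mono_arr C X Y i"
  obtains Q q where "short_exact C X Y Q i q"
  using cokernel_exists[OF mono_arr_in_hom[OF assms]] short_exact_cokernel_of_mono[OF assms]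
  by blast

lemma epi_extend_exact:
  assumes "epi_arr C Y Z p"
  obtains K k where "short_exact C K Y Z k p"
  using kernel_exists[OF epi_arr_in_hom[OF assms]] short_exact_kernel_of_epi[OF assms] by blast

lemma mono_epi_iso:
  assumes "mono_arr C X Y f" "epi_arr C X Y f"
  shows "iso_arr C X Y f"
proof -
  obtain Q q where q: "short_exact C X Y Q f q" using mono_extend_exact[OF assms(1)] .
  note D = short_exactD[OF q]
  have f: "f \<in> hom C X Y" by (rule D)
  have "q = 0" using epi_arr_eq_0[OF assms(2) D(5,3)] .
  then obtain g where g: "g \<in> hom C Y X" "f \<cdot> g = idn C Y"
    using short_exact_factor[OF q idn_in_hom] cmp_zero_left[OF idn_in_hom] by metis
  have "f \<cdot> (g \<cdot> f) = f \<cdot> idn C X"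
    using cmp_assoc[OF f g(1) f] g(2) by (simp add: cmp_idn_left[OF f] cmp_idn_right[OF f])
  then have "g \<cdot> f = idn C X"
    using mono_arr_cancel[OF assms(1)] cmp_in_hom[OF f g(1)] idn_in_hom by blast
  with f g show ?thesis by (auto simp: iso_arr_def)
qed

lemma zero_kernel_mono:
  assumes k: "is_kernel C X Y f K k" and "k = 0"
  shows "mono_arr C X Y f"
proof (rule mono_arrI[OF is_kernel_hom'[OF k]])
  fix W g assume g: "g \<in> hom C W X" "f \<cdot> g = 0"
  obtain g' where "g' \<in> hom C W K" "k \<cdot> g' = g" using is_kernel_factor[OF k g] .
  then show "g = 0" using cmp_zero_left \<open>k = 0\<close> by blast
qed

lemma zero_cokernel_epi:
  assumes "is_cokernel C X Y f Q q" "q = 0"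
  shows "epi_arr C X Y f"
  using abelian_category.zero_kernel_mono[OF opposite_abelian, of Y X f Q q] assms by simp

lemma simple_source_mono:
  assumes S: "simple_object C S" and f: "f \<in> hom C S Y" "f \<noteq> 0"
  shows "mono_arr C S Y f"
proof -
  obtain K k where k: "is_kernel C S Y f K k" using kernel_exists[OF f(1)] by blast
  have "\<not> iso_arr C K S k"
    using f is_kernel_zero[OF k] epi_arr_eq_0[OF iso_arr_epi f(1)] by blast
  then have "zero_object C K" using S is_kernel_mono[OF k] by (auto simp: simple_object_def)
  then have "k = 0" using from_zero_object is_kernel_hom[OF k] by blast
  with k show ?thesis by (rule zero_kernel_mono)
qed

lemma simple_target_epi:
  assumes S: "simple_object C S" and f: "f \<in> hom C X S" "f \<noteq> 0"
  shows "epi_arr C X S f"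
proof -
  obtain Q q where q: "is_cokernel C X S f Q q" using cokernel_exists[OF f(1)] by blast
  note q' = is_cokernel_hom[OF q]
  obtain I i where i: "is_kernel C S Q q I i" using kernel_exists[OF q'] by blast
  obtain f' where f': "f' \<in> hom C X I" "i \<cdot> f' = f"
    using is_kernel_factor[OF i f(1) is_cokernel_zero[OF q]] .
  have "\<not> zero_object C I"
    using f' f(2) into_zero_object cmp_zero_right[OF is_kernel_hom[OF i]] by metis
  then have "iso_arr C I S i" using S is_kernel_mono[OF i] by (auto simp: simple_object_def)
  then have "q = 0" using epi_arr_eq_0[OF iso_arr_epi q' is_kernel_zero[OF i]] by blast
  with q show ?thesis by (rule zero_cokernel_epi)
qed

text \<open>
  An epimorphism stays one after pulling back.  The pullback of \<open>p : B \<rightarrow> Z\<close> and \<open>f : X \<rightarrow> Z\<close> is the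
  kernel of \<open>d = (p, -f) : B \<oplus> X \<rightarrow> Z\<close>.  This \<open>d\<close> is epi because \<open>p\<close> is, so it is the cokernel of
  that kernel, and a morphism out of \<open>X\<close> that vanishes on the pullback factors through \<open>d\<close>.
\<close>

lemma pullback_of_epi:
  assumes p: "epi_arr C B Z p" and f: "f \<in> hom C X Z"
  obtains P a b where "epi_arr C P X a" "b \<in> hom C P B" "p \<cdot> b = f \<cdot> a"
    "\<And>W u v. u \<in> hom C W X \<Longrightarrow> v \<in> hom C W B \<Longrightarrow> p \<cdot> v = f \<cdot> u \<Longrightarrow>
       \<exists>w\<in>hom C W P. a \<cdot> w = u \<and> b \<cdot> w = v"
    "\<And>W w. w \<in> hom C W P \<Longrightarrow> a \<cdot> w = 0 \<Longrightarrow> b \<cdot> w = 0 \<Longrightarrow> w = 0"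
proof -
  obtain S i\<^sub>1 i\<^sub>2 p\<^sub>1 p\<^sub>2 where bi: "biproduct C B X S i\<^sub>1 i\<^sub>2 p\<^sub>1 p\<^sub>2" using biproduct_exists by blast
  then have [simp]: "i\<^sub>1 \<in> hom C B S" "i\<^sub>2 \<in> hom C X S" "p\<^sub>1 \<in> hom C S B" "p\<^sub>2 \<in> hom C S X"
    and bieq: "p\<^sub>1 \<cdot> i\<^sub>1 = idn C B" "p\<^sub>2 \<cdot> i\<^sub>2 = idn C X" "p\<^sub>1 \<cdot> i\<^sub>2 = 0" "p\<^sub>2 \<cdot> i\<^sub>1 = 0"
      "i\<^sub>1 \<cdot> p\<^sub>1 + i\<^sub>2 \<cdot> p\<^sub>2 = idn C S"
    by (auto simp: biproduct_def)
  have ph [simp]: "p \<in> hom C B Z" using p by (rule epi_arr_in_hom)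
  note [simp] = f
  define d where "d = p \<cdot> p\<^sub>1 - f \<cdot> p\<^sub>2"
  have pp: "p \<cdot> p\<^sub>1 \<in> hom C S Z" "f \<cdot> p\<^sub>2 \<in> hom C S Z"
    by (simp_all add: cmp_in_hom[of p\<^sub>1 S B] cmp_in_hom[of p\<^sub>2 S X])
  have d [simp]: "d \<in> hom C S Z" unfolding d_def using pp by (rule hom_diff)
  have dw: "d \<cdot> w = p \<cdot> (p\<^sub>1 \<cdot> w) - f \<cdot> (p\<^sub>2 \<cdot> w)" if "w \<in> hom C W S" for W w
    using that pp unfolding d_def
    by (simp add: cmp_diff_left cmp_assoc[of w W S p\<^sub>1 B p Z] cmp_assoc[of w W S p\<^sub>2 X f Z])
  have di1: "d \<cdot> i\<^sub>1 = p"
    using dw[of i\<^sub>1 B] by (simp add: bieq cmp_idn_right[OF ph] cmp_zero_right[OF f])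
  have "epi_arr C B Z (d \<cdot> i\<^sub>1)" using p di1 by simp
  then have epi_d: "epi_arr C S Z d" by (rule epi_left_factor[rotated 2]) simp_all
  obtain P k where k: "short_exact C P S Z k d" using epi_extend_exact[OF epi_d] .
  note kD = short_exactD[OF k]
  have kh [simp]: "k \<in> hom C P S" by (rule kD)
  define a b where "a = p\<^sub>2 \<cdot> k" and "b = p\<^sub>1 \<cdot> k"
  have a [simp]: "a \<in> hom C P X" and b [simp]: "b \<in> hom C P B"
    by (simp_all add: a_def b_def cmp_in_hom[of k P S])
  have split: "w = i\<^sub>1 \<cdot> (p\<^sub>1 \<cdot> w) + i\<^sub>2 \<cdot> (p\<^sub>2 \<cdot> w)" if "w \<in> hom C W S" for W w
  proof -
    have "w = (i\<^sub>1 \<cdot> p\<^sub>1 + i\<^sub>2 \<cdot> p\<^sub>2) \<cdot> w" using that by (simp add: bieq cmp_idn_left)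
    also have "\<dots> = (i\<^sub>1 \<cdot> p\<^sub>1) \<cdot> w + (i\<^sub>2 \<cdot> p\<^sub>2) \<cdot> w"
      using that cmp_add_left[of w W S "i\<^sub>1 \<cdot> p\<^sub>1" S "i\<^sub>2 \<cdot> p\<^sub>2"]
        cmp_in_hom[of p\<^sub>1 S B i\<^sub>1 S] cmp_in_hom[of p\<^sub>2 S X i\<^sub>2 S] by simp
    finally show ?thesis
      using that by (simp add: cmp_assoc[of w W S p\<^sub>1 B i\<^sub>1 S] cmp_assoc[of w W S p\<^sub>2 X i\<^sub>2 S])
  qed
  show thesis
  proof
    show "epi_arr C P X a"
    proof (rule epi_arrI[OF a])
      fix V h assume h: "h \<in> hom C X V" "h \<cdot> a = 0"
      have hp: "h \<cdot> p\<^sub>2 \<in> hom C S V" using h by (simp add: cmp_in_hom[of p\<^sub>2 S X])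
      have "(h \<cdot> p\<^sub>2) \<cdot> k = 0" using h cmp_assoc[of k P S p\<^sub>2 X h V] by (simp add: a_def)
      then obtain h' where h': "h' \<in> hom C Z V" "h' \<cdot> d = h \<cdot> p\<^sub>2"
        using short_exact_cofactor[OF k hp] by metis
      have "h' \<cdot> p = (h \<cdot> p\<^sub>2) \<cdot> i\<^sub>1"
        using h'(2) cmp_assoc[of i\<^sub>1 B S d Z h' V] h'(1) di1 by simp
      also have "\<dots> = 0"
        using cmp_assoc[of i\<^sub>1 B S p\<^sub>2 X h V] h(1) by (simp add: bieq cmp_zero_right)
      finally have "h' = 0" using epi_arr_eq_0[OF p h'(1)] by simp
      then have "h \<cdot> p\<^sub>2 = 0" using h'(2) cmp_zero_left[OF d] by simp
      then have "h \<cdot> (p\<^sub>2 \<cdot> i\<^sub>2) = 0"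
        using cmp_assoc[of i\<^sub>2 X S p\<^sub>2 X h V] h(1) cmp_zero_left[of i\<^sub>2 X S] by simp
      then show "h = 0" using h(1) by (simp add: bieq cmp_idn_right)
    qed
    show "b \<in> hom C P B" by simp
    show "p \<cdot> b = f \<cdot> a" using dw[of k P] kD(3) by (simp add: a_def b_def)
  next
    fix W u v assume uv: "u \<in> hom C W X" "v \<in> hom C W B" "p \<cdot> v = f \<cdot> u"
    define w where "w = i\<^sub>1 \<cdot> v + i\<^sub>2 \<cdot> u"
    have iv: "i\<^sub>1 \<cdot> v \<in> hom C W S" "i\<^sub>2 \<cdot> u \<in> hom C W S"
      using uv by (simp_all add: cmp_in_hom[of v W B] cmp_in_hom[of u W X])
    then have w: "w \<in> hom C W S" unfolding w_def by (rule hom_add)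
    have "p\<^sub>1 \<cdot> w = (p\<^sub>1 \<cdot> i\<^sub>1) \<cdot> v + (p\<^sub>1 \<cdot> i\<^sub>2) \<cdot> u"
      unfolding w_def using iv uv
      by (simp add: cmp_add_right[of _ W S _ p\<^sub>1 B] cmp_assoc[of v W B i\<^sub>1 S p\<^sub>1 B] cmp_assoc[of u W X i\<^sub>2 S p\<^sub>1 B])
    then have p1w: "p\<^sub>1 \<cdot> w = v" using uv by (simp add: bieq cmp_idn_left cmp_zero_left)
    have "p\<^sub>2 \<cdot> w = (p\<^sub>2 \<cdot> i\<^sub>1) \<cdot> v + (p\<^sub>2 \<cdot> i\<^sub>2) \<cdot> u"
      unfolding w_def using iv uv
      by (simp add: cmp_add_right[of _ W S _ p\<^sub>2 X] cmp_assoc[of v W B i\<^sub>1 S p\<^sub>2 X] cmp_assoc[of u W X i\<^sub>2 S p\<^sub>2 X])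
    then have p2w: "p\<^sub>2 \<cdot> w = u" using uv by (simp add: bieq cmp_idn_left cmp_zero_left)
    have "d \<cdot> w = 0" using dw[OF w] p1w p2w uv(3) by simp
    then obtain w' where w': "w' \<in> hom C W P" "k \<cdot> w' = w" using short_exact_factor[OF k w] by metis
    then have "a \<cdot> w' = u \<and> b \<cdot> w' = v"
      using cmp_assoc[of w' W P k S p\<^sub>2 X] cmp_assoc[of w' W P k S p\<^sub>1 B] p1w p2w
      by (simp add: a_def b_def)
    then show "\<exists>w\<in>hom C W P. a \<cdot> w = u \<and> b \<cdot> w = v" using w' by blast
  next
    fix W w assume w: "w \<in> hom C W P" "a \<cdot> w = 0" "b \<cdot> w = 0"
    have "p\<^sub>1 \<cdot> (k \<cdot> w) = 0" "p\<^sub>2 \<cdot> (k \<cdot> w) = 0"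
      using w cmp_assoc[of w W P k S p\<^sub>2 X] cmp_assoc[of w W P k S p\<^sub>1 B]
      by (simp_all add: a_def b_def)
    moreover have "k \<cdot> w \<in> hom C W S" using w by (simp add: cmp_in_hom[of w W P])
    ultimately have "k \<cdot> w = 0" 
      using split[of "k \<cdot> w" W] cmp_zero_right[of i\<^sub>1 B S] cmp_zero_right[of i\<^sub>2 X S] by simp
    then show "w = 0" using mono_arr_eq_0[OF kD(1) w(1)] by simp
  qed
qed

end

section \<open>Vanishing of first extension groups\<close>

text \<open>\<open>Ext\<^sup>1(X, Y) = 0\<close>, expressed by the splitting of all extensions of \<open>X\<close> by \<open>Y\<close>.\<close>

definition ext1_vanishes :: "('o, 'm::ab_group_add, 'k::field) lincat \<Rightarrow> 'o \<Rightarrow> 'o \<Rightarrow> bool" where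
  "ext1_vanishes C X Y \<longleftrightarrow>
     (\<forall>E i p. short_exact C Y E X i p \<longrightarrow> (\<exists>s\<in>hom C X E. cmp C p s = idn C X))"

context abelian_category
begin

lemma section_imp_retraction:
  assumes E: "short_exact C Y E X i p" and s: "s \<in> hom C X E" "p \<cdot> s = idn C X"
  shows "\<exists>r\<in>hom C E Y. r \<cdot> i = idn C Y"
proof -
  note D = short_exactD[OF E]
  have sp: "s \<cdot> p \<in> hom C E E" using s D by (auto intro: cmp_in_hom)
  have h: "idn C E - s \<cdot> p \<in> hom C E E" using sp by (simp add: hom_diff idn_in_hom)
  have "p \<cdot> (idn C E - s \<cdot> p) = p - (p \<cdot> s) \<cdot> p"
    using cmp_diff_right[OF idn_in_hom sp D(5)] cmp_assoc[OF D(5) s(1) D(5)]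
    by (simp add: cmp_idn_right[OF D(5)])
  also have "\<dots> = 0" using s(2) by (simp add: cmp_idn_left[OF D(5)])
  finally obtain r where r: "r \<in> hom C E Y" "i \<cdot> r = idn C E - s \<cdot> p"
    using short_exact_factor[OF E h] by metis
  have "i \<cdot> (r \<cdot> i) = (idn C E - s \<cdot> p) \<cdot> i" using cmp_assoc[OF D(4) r(1) D(4)] r(2) by simp
  also have "\<dots> = i - s \<cdot> (p \<cdot> i)"
    using cmp_diff_left[OF D(4) idn_in_hom sp] cmp_assoc[OF D(4,5) s(1)]
    by (simp add: cmp_idn_left[OF D(4)])
  also have "\<dots> = i \<cdot> idn C Y"
    using D(3) by (simp add: cmp_zero_right[OF s(1)] cmp_idn_right[OF D(4)])
  finally have "r \<cdot> i = idn C Y"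
    using mono_arr_cancel[OF D(1) cmp_in_hom[OF D(4) r(1)] idn_in_hom] by blast
  with r show ?thesis by blast
qed

lemma retraction_imp_section:
  assumes "short_exact C Y E X i p" "r \<in> hom C E Y" "r \<cdot> i = idn C Y"
  shows "\<exists>s\<in>hom C X E. p \<cdot> s = idn C X"
  using abelian_category.section_imp_retraction[OF opposite_abelian, of X E Y p i r] assms by simp

lemma opposite_ext1_vanishes [simp]:
  "ext1_vanishes (opposite C) X Y \<longleftrightarrow> ext1_vanishes C Y X"
  unfolding ext1_vanishes_def opposite_short_exact opposite_simps
  using section_imp_retraction retraction_imp_section by (meson idn_in_hom)

text \<open>
  Pull the extension back along \<open>f\<close>.  A section of the pullback, followed by the projection to \<open>B\<close>,
  is the lift.
\<close>

lemma ext1_lift: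
  assumes v: "ext1_vanishes C X Y" and E: "short_exact C Y B Z i p" and f: "f \<in> hom C X Z"
  shows "\<exists>f'\<in>hom C X B. p \<cdot> f' = f"
proof -
  note D = short_exactD[OF E]
  obtain P a b where ab: "epi_arr C P X a" "b \<in> hom C P B" "p \<cdot> b = f \<cdot> a"
    and univ: "\<And>W u v. u \<in> hom C W X \<Longrightarrow> v \<in> hom C W B \<Longrightarrow> p \<cdot> v = f \<cdot> u \<Longrightarrow>
       \<exists>w\<in>hom C W P. a \<cdot> w = u \<and> b \<cdot> w = v"
    and uniq: "\<And>W w. w \<in> hom C W P \<Longrightarrow> a \<cdot> w = 0 \<Longrightarrow> b \<cdot> w = 0 \<Longrightarrow> w = 0"
    using pullback_of_epi[OF D(2) f] by metis
  have a: "a \<in> hom C P X" using ab(1) by (rule epi_arr_in_hom)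
  obtain i' where i': "i' \<in> hom C Y P" "a \<cdot> i' = 0" "b \<cdot> i' = i"
    using univ[OF zero_in_hom D(4)] D(3) cmp_zero_right[OF f] by metis
  have "is_kernel C P X a Y i'"
  proof (rule is_kernelI)
    have "mono_arr C Y B (b \<cdot> i')" using i' D by simp
    then show "mono_arr C Y P i'" by (rule mono_right_factor[OF i'(1) ab(2)])
    show "a \<in> hom C P X" "a \<cdot> i' = 0" by fact+
    fix W w assume w: "w \<in> hom C W P" "a \<cdot> w = 0"
    have bw: "b \<cdot> w \<in> hom C W B" using w ab by (auto intro: cmp_in_hom)
    have "p \<cdot> (b \<cdot> w) = f \<cdot> (a \<cdot> w)"
      using cmp_assoc[OF w(1) ab(2) D(5)] cmp_assoc[OF w(1) a f] ab(3) by simp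
    also have "\<dots> = 0" using w(2) cmp_zero_right[OF f] by simp
    finally obtain y where y: "y \<in> hom C W Y" "i \<cdot> y = b \<cdot> w"
      using short_exact_factor[OF E bw] by metis
    have iy: "i' \<cdot> y \<in> hom C W P" using y i' by (auto intro: cmp_in_hom)
    have "a \<cdot> (i' \<cdot> y) = 0"
      using cmp_assoc[OF y(1) i'(1) a] i'(2) cmp_zero_left[OF y(1)] by simp
    then have "a \<cdot> (i' \<cdot> y - w) = 0" using cmp_diff_right[OF iy w(1) a] w(2) by simp
    moreover have "b \<cdot> (i' \<cdot> y) = b \<cdot> w"
      using cmp_assoc[OF y(1) i'(1) ab(2)] i'(3) y(2) by simp
    then have "b \<cdot> (i' \<cdot> y - w) = 0" using cmp_diff_right[OF iy w(1) ab(2)] by simp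
    ultimately have "i' \<cdot> y - w = 0" using uniq hom_diff[OF iy w(1)] by blast
    then show "\<exists>h'\<in>hom C W Y. i' \<cdot> h' = w" using y by auto
  qed
  then have "short_exact C Y P X i' a" by (rule short_exact_kernel_of_epi[OF ab(1)])
  then obtain s where s: "s \<in> hom C X P" "a \<cdot> s = idn C X"
    using v unfolding ext1_vanishes_def by blast
  have "p \<cdot> (b \<cdot> s) = f \<cdot> (a \<cdot> s)"
    using cmp_assoc[OF s(1) ab(2) D(5)] cmp_assoc[OF s(1) a f] ab(3) by simp
  then have "p \<cdot> (b \<cdot> s) = f" using s(2) cmp_idn_right[OF f] by simp
  moreover have "b \<cdot> s \<in> hom C X B" using s ab by (auto intro: cmp_in_hom)
  ultimately show ?thesis by blast
qed

lemma ext1_extend: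
  assumes "ext1_vanishes C X Y" "short_exact C A B X i p" "f \<in> hom C A Y"
  shows "\<exists>f'\<in>hom C B Y. f' \<cdot> i = f"
  using abelian_category.ext1_lift[OF opposite_abelian, of Y X B A p i f] assms by simp

text \<open>
  Given an extension \<open>0 \<rightarrow> B \<rightarrow> E \<rightarrow> X \<rightarrow> 0\<close>, the map \<open>q\<close> extends to \<open>t : E \<rightarrow> Z\<close> because
  \<open>Ext\<^sup>1(X, Z) = 0\<close>.  Then \<open>(p, t) : E \<rightarrow> X \<oplus> Z\<close> is an epimorphism with kernel \<open>A\<close>, and
  \<open>Ext\<^sup>1(X, A) = 0\<close> lifts the inclusion of \<open>X\<close> along it.
\<close>

lemma ext1_vanishes_middle:
  assumes vA: "ext1_vanishes C X A" and vZ: "ext1_vanishes C X Z"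
    and B: "short_exact C A B Z i q"
  shows "ext1_vanishes C X B"
  unfolding ext1_vanishes_def
proof (intro allI impI)
  fix E j p assume E: "short_exact C B E X j p"
  note D = short_exactD[OF B] and F = short_exactD[OF E]
  obtain t where t: "t \<in> hom C E Z" "t \<cdot> j = q" using ext1_extend[OF vZ E D(5)] by blast
  obtain S i\<^sub>1 i\<^sub>2 p\<^sub>1 p\<^sub>2 where bi: "biproduct C X Z S i\<^sub>1 i\<^sub>2 p\<^sub>1 p\<^sub>2" using biproduct_exists by blast
  then have [simp]: "i\<^sub>1 \<in> hom C X S" "i\<^sub>2 \<in> hom C Z S" "p\<^sub>1 \<in> hom C S X" "p\<^sub>2 \<in> hom C S Z"
    and bieq: "p\<^sub>1 \<cdot> i\<^sub>1 = idn C X" "p\<^sub>2 \<cdot> i\<^sub>2 = idn C Z" "p\<^sub>1 \<cdot> i\<^sub>2 = 0" "p\<^sub>2 \<cdot> i\<^sub>1 = 0"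
      "i\<^sub>1 \<cdot> p\<^sub>1 + i\<^sub>2 \<cdot> p\<^sub>2 = idn C S"
    by (auto simp: biproduct_def)
  note [simp] = D(4,5) F(4,5) t(1)
  define d where "d = i\<^sub>1 \<cdot> p + i\<^sub>2 \<cdot> t"
  have dd: "i\<^sub>1 \<cdot> p \<in> hom C E S" "i\<^sub>2 \<cdot> t \<in> hom C E S"
    by (simp_all add: cmp_in_hom[of p E X] cmp_in_hom[of t E Z])
  have d [simp]: "d \<in> hom C E S" unfolding d_def using dd by (rule hom_add)
  have p1d: "p\<^sub>1 \<cdot> d = p"
    using cmp_add_right[OF dd, of p\<^sub>1 X] cmp_assoc[of p E X i\<^sub>1 S p\<^sub>1 X] cmp_assoc[of t E Z i\<^sub>2 S p\<^sub>1 X]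
      cmp_idn_left[OF F(5)] cmp_zero_left[OF t(1)]
    by (simp add: bieq d_def)
  have p2d: "p\<^sub>2 \<cdot> d = t"
    using cmp_add_right[OF dd, of p\<^sub>2 Z] cmp_assoc[of p E X i\<^sub>1 S p\<^sub>2 Z] cmp_assoc[of t E Z i\<^sub>2 S p\<^sub>2 Z]
      cmp_idn_left[OF t(1)] cmp_zero_left[OF F(5)]
    by (simp add: bieq d_def)
  have dj: "d \<cdot> j = i\<^sub>2 \<cdot> q"
  proof -
    have "d \<cdot> j = i\<^sub>1 \<cdot> (p \<cdot> j) + i\<^sub>2 \<cdot> (t \<cdot> j)"
      using cmp_add_left[OF F(4) dd] cmp_assoc[of j B E p X i\<^sub>1 S] cmp_assoc[of j B E t Z i\<^sub>2 S]
      by (simp add: d_def)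
    then show ?thesis using F(3) t(2) cmp_zero_right[of i\<^sub>1 X S] by simp
  qed
  have ji [simp]: "j \<cdot> i \<in> hom C A E" using cmp_in_hom[OF D(4) F(4)] .
  have epi: "epi_arr C E S d"
  proof (rule epi_arrI[OF d])
    fix V h assume h: "h \<in> hom C S V" "h \<cdot> d = 0"
    note [simp] = h(1)
    have hi: "h \<cdot> i\<^sub>1 \<in> hom C X V" "h \<cdot> i\<^sub>2 \<in> hom C Z V"
      by (simp_all add: cmp_in_hom[of i\<^sub>1 X S] cmp_in_hom[of i\<^sub>2 Z S])
    have "(h \<cdot> i\<^sub>2) \<cdot> q = (h \<cdot> d) \<cdot> j"
      using dj cmp_assoc[of q B Z i\<^sub>2 S h V] cmp_assoc[of j B E d S h V] by simp
    then have h2: "h \<cdot> i\<^sub>2 = 0"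
      using h(2) cmp_zero_left[OF F(4)] epi_arr_eq_0[OF D(2) hi(2)] by simp
    have "(h \<cdot> i\<^sub>1) \<cdot> p + (h \<cdot> i\<^sub>2) \<cdot> t = h \<cdot> d"
      using cmp_assoc[of p E X i\<^sub>1 S h V] cmp_assoc[of t E Z i\<^sub>2 S h V] cmp_add_right[OF dd h(1)]
      by (simp add: d_def)
    then have h1: "h \<cdot> i\<^sub>1 = 0"
      using h(2) h2 cmp_zero_left[OF t(1)] epi_arr_eq_0[OF F(2) hi(1)] by simp
    have "h = h \<cdot> (i\<^sub>1 \<cdot> p\<^sub>1) + h \<cdot> (i\<^sub>2 \<cdot> p\<^sub>2)"
      using cmp_add_right[of "i\<^sub>1 \<cdot> p\<^sub>1" S S "i\<^sub>2 \<cdot> p\<^sub>2" h V] cmp_idn_right[OF h(1)] bieq(5)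
        cmp_in_hom[of p\<^sub>1 S X i\<^sub>1 S] cmp_in_hom[of p\<^sub>2 S Z i\<^sub>2 S] by simp
    also have "\<dots> = 0"
      using cmp_assoc[of p\<^sub>1 S X i\<^sub>1 S h V] cmp_assoc[of p\<^sub>2 S Z i\<^sub>2 S h V] h1 h2
        cmp_zero_left[of p\<^sub>1 S X] cmp_zero_left[of p\<^sub>2 S Z] by simp
    finally show "h = 0" .
  qed
  have "is_kernel C E S d A (j \<cdot> i)"
  proof (rule is_kernelI[OF mono_comp[OF D(1) F(1)] d])
    show "d \<cdot> (j \<cdot> i) = 0"
      using cmp_assoc[of i A B j E d S] dj cmp_assoc[of i A B q Z i\<^sub>2 S] D(3)
        cmp_zero_right[of i\<^sub>2 Z S] by simp
    fix W w assume w: "w \<in> hom C W E" "d \<cdot> w = 0"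
    note [simp] = w(1)
    have "p \<cdot> w = 0"
      using cmp_assoc[of w W E d S p\<^sub>1 X] p1d w(2) cmp_zero_right[of p\<^sub>1 S X] by simp
    then obtain b where b: "b \<in> hom C W B" "j \<cdot> b = w" using short_exact_factor[OF E w(1)] by metis
    have "q \<cdot> b = t \<cdot> w" using t(2) b cmp_assoc[of b W B j E t Z] by simp
    also have "\<dots> = 0"
      using cmp_assoc[of w W E d S p\<^sub>2 Z] p2d w(2) cmp_zero_right[of p\<^sub>2 S Z] by simp
    finally obtain y where "y \<in> hom C W A" "i \<cdot> y = b" using short_exact_factor[OF B b(1)] by metis
    then show "\<exists>h'\<in>hom C W A. (j \<cdot> i) \<cdot> h' = w"
      using b(2) cmp_assoc[of _ W A i B j E] by auto
  qed
  then have "short_exact C A E S (j \<cdot> i) d" by (rule short_exact_kernel_of_epi[OF epi])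
  then obtain s where s: "s \<in> hom C X E" "d \<cdot> s = i\<^sub>1" using ext1_lift[OF vA, of E S _ d i\<^sub>1] by auto
  then have "p \<cdot> s = idn C X" using p1d cmp_assoc[of s X E d S p\<^sub>1 X] bieq(1) by simp
  with s show "\<exists>s\<in>hom C X E. p \<cdot> s = idn C X" by blast
qed

lemma ext1_vanishes_middle_left:
  assumes "ext1_vanishes C A Y" "ext1_vanishes C Z Y" "short_exact C A B Z i q"
  shows "ext1_vanishes C B Y"
  using abelian_category.ext1_vanishes_middle[OF opposite_abelian, of Y Z A B q i] assms by simp

text \<open>
  The piece \<open>Hom(X, B) \<rightarrow> Hom(X, Z) \<rightarrow> Ext\<^sup>1(X, A) \<rightarrow> Ext\<^sup>1(X, B)\<close> of the long exact sequence.  For an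
  extension \<open>0 \<rightarrow> A \<rightarrow> E \<rightarrow> X \<rightarrow> 0\<close>, the inclusion of \<open>A\<close> in \<open>B\<close> extends to \<open>E\<close>; correcting this
  extension by a map that factors through \<open>X\<close> pushes it into \<open>A\<close>, which gives a retraction.
\<close>

lemma ext1_vanishes_kernel:
  assumes v: "ext1_vanishes C X B" and B: "short_exact C A B Z i q"
    and surj: "\<And>c. c \<in> hom C X Z \<Longrightarrow> \<exists>b\<in>hom C X B. q \<cdot> b = c"
  shows "ext1_vanishes C X A"
  unfolding ext1_vanishes_def
proof (intro allI impI)
  fix E j p assume E: "short_exact C A E X j p"
  note D = short_exactD[OF B] and F = short_exactD[OF E]
  obtain t where t: "t \<in> hom C E B" "t \<cdot> j = i" using ext1_extend[OF v E D(4)] by blast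
  have qt: "q \<cdot> t \<in> hom C E Z" using cmp_in_hom[OF t(1) D(5)] .
  have "(q \<cdot> t) \<cdot> j = 0" using cmp_assoc[OF F(4) t(1) D(5)] t(2) D(3) by simp
  then obtain c where c: "c \<in> hom C X Z" "c \<cdot> p = q \<cdot> t" using short_exact_cofactor[OF E qt] by metis
  obtain b where b: "b \<in> hom C X B" "q \<cdot> b = c" using surj[OF c(1)] by blast
  have bp: "b \<cdot> p \<in> hom C E B" using cmp_in_hom[OF F(5) b(1)] .
  have tb: "t - b \<cdot> p \<in> hom C E B" using t(1) bp by (rule hom_diff)
  have "q \<cdot> (t - b \<cdot> p) = 0"
    using cmp_diff_right[OF t(1) bp D(5)] cmp_assoc[OF F(5) b(1) D(5)] b(2) c(2) by simp
  then obtain r where r: "r \<in> hom C E A" "i \<cdot> r = t - b \<cdot> p" using short_exact_factor[OF B tb] by metis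
  have "i \<cdot> (r \<cdot> j) = (t - b \<cdot> p) \<cdot> j" using cmp_assoc[OF F(4) r(1) D(4)] r(2) by simp
  also have "\<dots> = i - b \<cdot> (p \<cdot> j)"
    using cmp_diff_left[OF F(4) t(1) bp] cmp_assoc[OF F(4,5) b(1)] t(2) by simp
  also have "\<dots> = i \<cdot> idn C A" using F(3) cmp_zero_right[OF b(1)] cmp_idn_right[OF D(4)] by simp
  finally have "r \<cdot> j = idn C A"
    using mono_arr_cancel[OF D(1) cmp_in_hom[OF F(4) r(1)] idn_in_hom] by blast
  then show "\<exists>s\<in>hom C X E. p \<cdot> s = idn C X" using retraction_imp_section[OF E r(1)] by blast
qed

lemma ext1_vanishes_zero_left:
  assumes "zero_object C X"
  shows "ext1_vanishes C X Y"
  unfolding ext1_vanishes_def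
  using assms cmp_zero_right short_exactD(5) zero_in_hom by (metis zero_object_iff)

lemma ext1_vanishes_zero_right:
  assumes "zero_object C Y"
  shows "ext1_vanishes C X Y"
  using abelian_category.ext1_vanishes_zero_left[OF opposite_abelian, of Y X] assms by simp

end

section \<open>Yoneda extensions and splitting\<close>

context abelian_category
begin

lemma exact_at_iff_short_exact:
  assumes i: "mono_arr C Y E i" and p: "epi_arr C E X p"
  shows "exact_at C Y E X i p \<longleftrightarrow> short_exact C Y E X i p"
proof
  assume "exact_at C Y E X i p"
  then obtain Q q I u where q: "is_cokernel C Y E i Q q" "is_kernel C E Q q I u"
    and u: "is_kernel C E X p I u"
    by (auto simp: exact_at_def is_image_def)
  have iq: "short_exact C Y E Q i q" by (rule short_exact_cokernel_of_mono[OF i q(1)])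
  note uh = is_kernel_hom[OF u] and ph = epi_arr_in_hom[OF p] and ih = mono_arr_in_hom[OF i]
    and qh = is_cokernel_hom[OF q(1)]
  have "is_kernel C E X p Y i"
  proof (rule is_kernelI[OF i ph])
    obtain i' where i': "i' \<in> hom C Y I" "u \<cdot> i' = i"
      using is_kernel_factor[OF q(2) ih is_cokernel_zero[OF q(1)]] .
    then show "p \<cdot> i = 0"
      using cmp_assoc[OF i'(1) uh ph] is_kernel_zero[OF u] cmp_zero_left[OF i'(1)] by simp
    fix W h assume h: "h \<in> hom C W E" "p \<cdot> h = 0"
    obtain h' where h': "h' \<in> hom C W I" "u \<cdot> h' = h" using is_kernel_factor[OF u h] .
    then have "q \<cdot> h = 0"
      using cmp_assoc[OF h'(1) uh qh] is_kernel_zero[OF q(2)] cmp_zero_left[OF h'(1)] by simp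
    then show "\<exists>h'\<in>hom C W Y. i \<cdot> h' = h" using short_exact_factor[OF iq h(1)] by metis
  qed
  then show "short_exact C Y E X i p" by (rule short_exact_kernel_of_epi[OF p])
next
  assume "short_exact C Y E X i p"
  then show "exact_at C Y E X i p" unfolding exact_at_def is_image_def short_exact_def by blast
qed

lemma extensions_1_iff:
  "e \<in> extensions C 1 X Y \<longleftrightarrow> (\<exists>E i p. e = ([Y, E, X], [i, p]) \<and> short_exact C Y E X i p)"
proof
  assume e: "e \<in> extensions C 1 X Y"
  obtain Es ds where [simp]: "e = (Es, ds)" by fastforce
  have "length Es = 3" "length ds = 2" using e by (auto simp: extensions_def)
  then obtain Y' E X' i p where "Es = [Y', E, X']" "ds = [i, p]"
    by (auto simp: length_Suc_conv numeral_eq_Suc)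
  with e show "\<exists>E i p. e = ([Y, E, X], [i, p]) \<and> short_exact C Y E X i p"
    by (auto simp: extensions_def exact_at_iff_short_exact)
next
  assume "\<exists>E i p. e = ([Y, E, X], [i, p]) \<and> short_exact C Y E X i p"
  then obtain E i p where e: "e = ([Y, E, X], [i, p])" and E: "short_exact C Y E X i p" by blast
  note D = short_exactD(1,2)[OF E]
  show "e \<in> extensions C 1 X Y"
    using D E exact_at_iff_short_exact[OF D] by (simp add: e extensions_def)
qed

lemma split_short_exact:
  assumes "biproduct C A B P i\<^sub>1 i\<^sub>2 p\<^sub>1 p\<^sub>2"
  shows "short_exact C A P B i\<^sub>1 p\<^sub>2"
proof -
  have h: "i\<^sub>1 \<in> hom C A P" "i\<^sub>2 \<in> hom C B P" "p\<^sub>1 \<in> hom C P A" "p\<^sub>2 \<in> hom C P B"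
    and eq: "p\<^sub>1 \<cdot> i\<^sub>1 = idn C A" "p\<^sub>2 \<cdot> i\<^sub>2 = idn C B" "p\<^sub>2 \<cdot> i\<^sub>1 = 0" "i\<^sub>1 \<cdot> p\<^sub>1 + i\<^sub>2 \<cdot> p\<^sub>2 = idn C P"
    using assms by (auto simp: biproduct_def)
  have ip: "i\<^sub>1 \<cdot> p\<^sub>1 \<in> hom C P P" "i\<^sub>2 \<cdot> p\<^sub>2 \<in> hom C P P" using h by (auto intro: cmp_in_hom)
  have "iso_arr C A A (p\<^sub>1 \<cdot> i\<^sub>1)" "iso_arr C B B (p\<^sub>2 \<cdot> i\<^sub>2)"
    unfolding eq iso_arr_def using idn_in_hom cmp_idn_left by blast+
  then have "mono_arr C A A (p\<^sub>1 \<cdot> i\<^sub>1)" "epi_arr C B B (p\<^sub>2 \<cdot> i\<^sub>2)"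
    using iso_arr_mono iso_arr_epi by blast+
  then have mono: "mono_arr C A P i\<^sub>1" and epi: "epi_arr C P B p\<^sub>2"
    using h mono_right_factor epi_left_factor by blast+
  have "is_kernel C P B p\<^sub>2 A i\<^sub>1"
  proof (rule is_kernelI[OF mono h(4) eq(3)])
    fix W w assume w: "w \<in> hom C W P" "p\<^sub>2 \<cdot> w = 0"
    have "w = (i\<^sub>1 \<cdot> p\<^sub>1) \<cdot> w + (i\<^sub>2 \<cdot> p\<^sub>2) \<cdot> w"
      using cmp_add_left[OF w(1) ip] cmp_idn_left[OF w(1)] eq(4) by simp
    also have "\<dots> = i\<^sub>1 \<cdot> (p\<^sub>1 \<cdot> w)"
      using cmp_assoc[OF w(1) h(3,1)] cmp_assoc[OF w(1) h(4,2)] w(2) cmp_zero_right[OF h(2)] by simp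
    finally show "\<exists>h'\<in>hom C W A. i\<^sub>1 \<cdot> h' = w" using cmp_in_hom[OF w(1) h(3)] by metis
  qed
  then show ?thesis by (rule short_exact_kernel_of_epi[OF epi])
qed

text \<open>
  Splitting is invariant under morphisms of extensions in both directions: a section is pushed
  forward, a retraction is pulled back.  So all extensions connected to the split one split.
\<close>

lemma ext1_vanishes_if_yoneda_ext_singleton:
  assumes "is_singleton (yoneda_ext C 1 X Y)"
  shows "ext1_vanishes C X Y"
proof -
  define splits where "splits e \<longleftrightarrow> (\<exists>s\<in>hom C X (fst e ! 1). (snd e ! 1) \<cdot> s = idn C X)" for e
  define R where "R = extension_morphism C 1 X Y"
  have step: "splits e \<longleftrightarrow> splits e'" if "(e, e') \<in> R" for e e'
  proof -
    have "e \<in> extensions C 1 X Y" "e' \<in> extensions C 1 X Y"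
      using that by (auto simp: R_def extension_morphism_def)
    then obtain E i p E' i' p'
      where e: "e = ([Y, E, X], [i, p])" "e' = ([Y, E', X], [i', p'])"
        and ex: "short_exact C Y E X i p" "short_exact C Y E' X i' p'"
      unfolding extensions_1_iff by blast
    note D = short_exactD[OF ex(1)] and D' = short_exactD[OF ex(2)]
    have "(([Y, E, X], [i, p]), ([Y, E', X], [i', p'])) \<in> extension_morphism C 1 X Y"
      using that by (simp only: R_def e)
    then obtain as where as: "as ! 0 = idn C Y" "as ! (1 + 1) = idn C X"
      "\<forall>i\<le>1 + 1. as ! i \<in> hom C ([Y, E, X] ! i) ([Y, E', X] ! i)"
      "\<forall>j\<le>1. (as ! (j + 1)) \<cdot> ([i, p] ! j) = ([i', p'] ! j) \<cdot> (as ! j)"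
      unfolding extension_morphism_def mem_Collect_eq prod.case by blast
    define a where "a = as ! 1"
    have a: "a \<in> hom C E E'" "a \<cdot> i = i' \<cdot> idn C Y" "idn C X \<cdot> p = p' \<cdot> a"
      using as(3)[rule_format, of 1] as(4)[rule_format, of 0] as(4)[rule_format, of 1] as(1,2)
      by (simp_all add: a_def)
    then have eq: "a \<cdot> i = i'" "p' \<cdot> a = p" by (simp_all add: cmp_idn_left[OF D(5)] cmp_idn_right[OF D'(4)])
    show ?thesis
    proof
      assume "splits e"
      then obtain s where s: "s \<in> hom C X E" "p \<cdot> s = idn C X" by (auto simp: splits_def e)
      then have "p' \<cdot> (a \<cdot> s) = idn C X" using cmp_assoc[OF s(1) a(1) D'(5)] eq by simp
      then show "splits e'" using cmp_in_hom[OF s(1) a(1)] by (auto simp: splits_def e)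
    next
      assume "splits e'"
      then obtain s where "s \<in> hom C X E'" "p' \<cdot> s = idn C X" by (auto simp: splits_def e)
      then obtain r where r: "r \<in> hom C E' Y" "r \<cdot> i' = idn C Y"
        using section_imp_retraction[OF ex(2)] by blast
      then have "(r \<cdot> a) \<cdot> i = idn C Y" using cmp_assoc[OF D(4) a(1) r(1)] eq by simp
      then show "splits e"
        using retraction_imp_section[OF ex(1) cmp_in_hom[OF a(1) r(1)]] by (auto simp: splits_def e)
    qed
  qed
  have steps: "splits e \<longleftrightarrow> splits e'" if "(e, e') \<in> (R \<union> R\<inverse>)\<^sup>*" for e e'
    using that by induction (auto dest: step)
  obtain P i\<^sub>1 i\<^sub>2 p\<^sub>1 p\<^sub>2 where bi: "biproduct C Y X P i\<^sub>1 i\<^sub>2 p\<^sub>1 p\<^sub>2" using biproduct_exists by blast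
  define e0 where "e0 = ([Y, P, X], [i\<^sub>1, p\<^sub>2])"
  have e0: "e0 \<in> extensions C 1 X Y"
    unfolding extensions_1_iff e0_def using split_short_exact[OF bi] by blast
  have s0: "splits e0" unfolding splits_def e0_def using bi by (auto simp: biproduct_def)
  show ?thesis
    unfolding ext1_vanishes_def
  proof (intro allI impI)
    fix E i p assume E: "short_exact C Y E X i p"
    let ?e = "([Y, E, X], [i, p])"
    let ?R = "(R \<union> R\<inverse>)\<^sup>*"
    have "?e \<in> extensions C 1 X Y" unfolding extensions_1_iff using E by blast
    then have "?R `` {?e} \<in> yoneda_ext C 1 X Y" "?R `` {e0} \<in> yoneda_ext C 1 X Y"
      using e0 by (auto simp: yoneda_ext_def R_def quotientI)
    then have "?R `` {?e} = ?R `` {e0}" using assms by (auto simp: is_singleton_def)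
    then have "(e0, ?e) \<in> ?R" by blast
    then have "splits ?e" using steps s0 by blast
    then show "\<exists>s\<in>hom C X E. p \<cdot> s = idn C X" by (simp add: splits_def)
  qed
qed

section \<open>Composition factors\<close>

lemma filtration_source_factor:
  assumes "filtration C Ss X" "\<forall>S\<in>set Ss. simple_object C S"
    and P: "\<And>S h. simple_object C S \<Longrightarrow> h \<in> hom C D S \<Longrightarrow> h \<noteq> 0 \<Longrightarrow> P S"
    and "f \<in> hom C D X" "f \<noteq> 0"
  shows "\<exists>S\<in>set Ss. P S"
  using assms(1,2,4,5)
proof (induction arbitrary: f)
  case (filtration_zero X)
  then show ?case using into_zero_object by blast
next
  case (filtration_step Qs X Y Q i p)
  note D = short_exactD[OF filtration_step.hyps(2)]
  show ?case
  proof (cases "p \<cdot> f = 0")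
    case True
    then obtain f' where f': "f' \<in> hom C D X" "i \<cdot> f' = f"
      using short_exact_factor[OF filtration_step.hyps(2) filtration_step.prems(2)] by metis
    then have "f' \<noteq> 0" using filtration_step.prems(3) cmp_zero_right[OF D(4)] by auto
    then show ?thesis using filtration_step.IH[of f'] f' filtration_step.prems(1) by auto
  next
    case False
    then have "P Q" using P cmp_in_hom[OF filtration_step.prems(2) D(5)] filtration_step.prems(1) by simp
    then show ?thesis by simp
  qed
qed

lemma filtration_target_factor:
  assumes "filtration C Ss X" "\<forall>S\<in>set Ss. simple_object C S"
    and P: "\<And>S h. simple_object C S \<Longrightarrow> h \<in> hom C S N \<Longrightarrow> h \<noteq> 0 \<Longrightarrow> P S"
    and "f \<in> hom C X N" "f \<noteq> 0"
  shows "\<exists>S\<in>set Ss. P S"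
  using assms(1,2,4,5)
proof (induction arbitrary: f)
  case (filtration_zero X)
  then show ?case using from_zero_object by blast
next
  case (filtration_step Qs X Y Q i p)
  note D = short_exactD[OF filtration_step.hyps(2)]
  show ?case
  proof (cases "f \<cdot> i = 0")
    case True
    then obtain f' where f': "f' \<in> hom C Q N" "f' \<cdot> p = f"
      using short_exact_cofactor[OF filtration_step.hyps(2) filtration_step.prems(2)] by metis
    then have "f' \<noteq> 0" using filtration_step.prems(3) cmp_zero_left[OF D(5)] by auto
    then have "P Q" using P f' filtration_step.prems(1) by simp
    then show ?thesis by simp
  next
    case False
    then show ?thesis
      using filtration_step.IH[of "f \<cdot> i"] cmp_in_hom[OF D(4) filtration_step.prems(2)]
        filtration_step.prems(1) by auto
  qed
qed

text \<open>
  Both \<open>a\<close> and \<open>b\<close> detect a member of the series that satisfies \<open>P\<close>.  These cannot be the same: at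
  the top \<open>Q\<close> of the series, \<open>a\<close> and \<open>b\<close> would induce \<open>D \<rightarrow> Q \<rightarrow> N\<close> with composite zero, but the
  second of these morphisms is injective, as \<open>Q\<close> is simple.
\<close>

lemma filtration_two_factors:
  assumes "filtration C Ss X" "\<forall>S\<in>set Ss. simple_object C S"
    and P: "\<And>S h. simple_object C S \<Longrightarrow> h \<in> hom C D S \<Longrightarrow> h \<noteq> 0 \<Longrightarrow> P S"
      "\<And>S h. simple_object C S \<Longrightarrow> h \<in> hom C S N \<Longrightarrow> h \<noteq> 0 \<Longrightarrow> P S"
    and "a \<in> hom C D X" "a \<noteq> 0" "b \<in> hom C X N" "b \<noteq> 0" "b \<cdot> a = 0"
  shows "2 \<le> length (filter P Ss)"
  using assms(1,2,5-)
proof (induction arbitrary: a b)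
  case (filtration_zero X)
  then show ?case using from_zero_object by blast
next
  case (filtration_step Qs X Y Q i p)
  note D = short_exactD[OF filtration_step.hyps(2)]
  note a = filtration_step.prems(2,3) and b = filtration_step.prems(4,5) and ba = filtration_step.prems(6)
  have simple: "simple_object C Q" "\<forall>S\<in>set Qs. simple_object C S"
    using filtration_step.prems(1) by auto
  have pos: "Suc 0 \<le> length (filter P Qs)" if "\<exists>S\<in>set Qs. P S"
    using that by (auto simp: filter_empty_conv Suc_le_eq)
  show ?case
  proof (cases "p \<cdot> a = 0")
    case True
    then obtain a' where a': "a' \<in> hom C D X" "i \<cdot> a' = a"
      using short_exact_factor[OF filtration_step.hyps(2) a(1)] by metis
    then have a'0: "a' \<noteq> 0" using a cmp_zero_right[OF D(4)] by auto
    show ?thesis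
    proof (cases "b \<cdot> i = 0")
      case True
      then obtain b' where b': "b' \<in> hom C Q N" "b' \<cdot> p = b"
        using short_exact_cofactor[OF filtration_step.hyps(2) b(1)] by metis
      then have "b' \<noteq> 0" using b cmp_zero_left[OF D(5)] by auto
      then have "P Q" using P(2) b' simple by blast
      moreover have "\<exists>S\<in>set Qs. P S"
        using filtration_source_factor[OF filtration_step.hyps(1) simple(2) P(1) a'(1) a'0] .
      ultimately show ?thesis using pos by simp
    next
      case False
      have "(b \<cdot> i) \<cdot> a' = 0" using cmp_assoc[OF a'(1) D(4) b(1)] a'(2) ba by simp
      then show ?thesis
        using filtration_step.IH[OF simple(2) a'(1) a'0 cmp_in_hom[OF D(4) b(1)] False] by simp
    qed
  next
    case False
    then have PQ: "P Q" using P(1) cmp_in_hom[OF a(1) D(5)] simple by simp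
    have bi: "b \<cdot> i \<noteq> 0"
    proof
      assume "b \<cdot> i = 0"
      then obtain b' where b': "b' \<in> hom C Q N" "b' \<cdot> p = b"
        using short_exact_cofactor[OF filtration_step.hyps(2) b(1)] by metis
      then have "b' \<noteq> 0" using b cmp_zero_left[OF D(5)] by auto
      then have "mono_arr C Q N b'" using simple_source_mono[OF simple(1)] b'(1) by blast
      moreover have "b' \<cdot> (p \<cdot> a) = 0" using cmp_assoc[OF a(1) D(5) b'(1)] b'(2) ba by simp
      ultimately show False using False mono_arr_eq_0 cmp_in_hom[OF a(1) D(5)] by blast
    qed
    have "\<exists>S\<in>set Qs. P S"
      by (rule filtration_target_factor[OF filtration_step.hyps(1) simple(2), where f = "b \<cdot> i" and N = N])
        (use P(2) cmp_in_hom[OF D(4) b(1)] bi in blast)+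
    then show ?thesis using PQ pos by simp
  qed
qed

lemma iso_arr_sym:
  assumes "iso_arr C X Y f"
  obtains g where "iso_arr C Y X g"
  using assms by (auto simp: iso_arr_def)

lemma isomorphic_sym: "isomorphic C X Y \<Longrightarrow> isomorphic C Y X"
  using iso_arr_sym unfolding isomorphic_def by metis

lemma simple_not_zero: "simple_object C S \<Longrightarrow> \<not> zero_object C S"
  by (simp add: simple_object_def)

text \<open>The kernel of a nonzero morphism to a simple object is a maximal subobject, so contains the radical.\<close>

lemma standard_simple_quotient:
  assumes D: "standard_object C \<Lambda> L l D" and L: "simple_object C (L l)"
    and Q: "simple_object C Q" and f: "f \<in> hom C D Q" "f \<noteq> 0"
  shows "isomorphic C Q (L l)"
proof -
  obtain R r H h where r: "is_radical C D R r" and rh: "short_exact C R D H r h"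
    and H: "isomorphic C H (L l)"
    using D unfolding standard_object_def by blast
  have epi: "epi_arr C D Q f" by (rule simple_target_epi[OF Q f])
  obtain K k where k: "short_exact C K D Q k f" using epi_extend_exact[OF epi] .
  note kD = short_exactD[OF k]
  have "maximal_subobject C D K k"
    unfolding maximal_subobject_def
  proof (intro conjI allI impI)
    show "mono_arr C K D k" by (rule kD)
    show "\<not> iso_arr C K D k" using epi_arr_eq_0[OF iso_arr_epi f(1) kD(3)] f(2) by blast
    fix V v assume "mono_arr C V D v \<and> sub_le C K k V v"
    then obtain m where v: "mono_arr C V D v" and m: "m \<in> hom C K V" "k = v \<cdot> m"
      by (auto simp: sub_le_def)
    note vh = mono_arr_in_hom[OF v]
    have fv: "f \<cdot> v \<in> hom C V Q" using cmp_in_hom[OF vh f(1)] .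
    show "sub_le C V v K k \<or> iso_arr C V D v"
    proof (cases "f \<cdot> v = 0")
      case True
      then show ?thesis using short_exact_factor[OF k vh] by (metis sub_le_def)
    next
      case False
      then have fv_epi: "epi_arr C V Q (f \<cdot> v)" using simple_target_epi[OF Q fv] by blast
      have "epi_arr C V D v"
      proof (rule epi_arrI[OF vh])
        fix Z g assume g: "g \<in> hom C D Z" "g \<cdot> v = 0"
        have "g \<cdot> k = 0" using cmp_assoc[OF m(1) vh g(1)] m(2) g(2) cmp_zero_left[OF m(1)] by simp
        then obtain g' where g': "g' \<in> hom C Q Z" "g' \<cdot> f = g"
          using short_exact_cofactor[OF k g(1)] by metis
        then have "g' \<cdot> (f \<cdot> v) = 0" using cmp_assoc[OF vh f(1) g'(1)] g(2) by simp
        then have "g' = 0" using epi_arr_eq_0[OF fv_epi g'(1)] by simp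
        then show "g = 0" using g' cmp_zero_left[OF f(1)] by simp
      qed
      then show ?thesis using mono_epi_iso[OF v] by blast
    qed
  qed
  then have "sub_le C R r K k" using r by (auto simp: is_radical_def)
  then obtain m where m: "m \<in> hom C R K" "r = k \<cdot> m" by (auto simp: sub_le_def)
  have "f \<cdot> r = 0" using cmp_assoc[OF m(1) kD(4) f(1)] m(2) kD(3) cmp_zero_left[OF m(1)] by simp
  then obtain f' where f': "f' \<in> hom C H Q" "f' \<cdot> h = f" using short_exact_cofactor[OF rh f(1)] by metis
  have "epi_arr C H Q f'" using epi_left_factor[OF short_exactD(5)[OF rh] f'(1)] epi f'(2) by simp
  moreover obtain u where u: "iso_arr C (L l) H u" using isomorphic_sym[OF H] by (auto simp: isomorphic_def)
  ultimately have e: "epi_arr C (L l) Q (f' \<cdot> u)" using epi_comp iso_arr_epi by blast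
  have "f' \<cdot> u \<noteq> 0" using e zero_epi_target simple_not_zero[OF Q] by metis
  then have "mono_arr C (L l) Q (f' \<cdot> u)" using simple_source_mono[OF L epi_arr_in_hom[OF e]] by blast
  then have "isomorphic C (L l) Q" using mono_epi_iso[OF _ e] by (auto simp: isomorphic_def)
  then show ?thesis by (rule isomorphic_sym)
qed

text \<open>The image of a nonzero morphism from a simple object is a minimal subobject, so lies in the socle.\<close>

lemma costandard_simple_sub:
  assumes N: "costandard_object C \<Lambda> L l N" and L: "simple_object C (L l)"
    and Q: "simple_object C Q" and f: "f \<in> hom C Q N" "f \<noteq> 0"
  shows "isomorphic C Q (L l)"
proof -
  obtain S s where s: "is_socle C N S s" and S: "isomorphic C S (L l)"
    using N unfolding costandard_object_def by blast
  have mono: "mono_arr C Q N f" by (rule simple_source_mono[OF Q f])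
  have "minimal_subobject C N Q f"
    unfolding minimal_subobject_def
  proof (intro conjI allI impI)
    show "mono_arr C Q N f" by (rule mono)
    show "\<not> zero_object C Q" by (rule simple_not_zero[OF Q])
    fix V v assume "mono_arr C V N v \<and> sub_le C V v Q f"
    then obtain m where v: "mono_arr C V N v" and m: "m \<in> hom C V Q" "v = f \<cdot> m"
      by (auto simp: sub_le_def)
    have "mono_arr C V Q m" using mono_right_factor[OF m(1) f(1)] v m(2) by simp
    then consider "zero_object C V" | "iso_arr C V Q m" using Q by (auto simp: simple_object_def)
    then show "sub_le C Q f V v \<or> zero_object C V"
    proof cases
      case 2
      then obtain m' where m': "m' \<in> hom C Q V" "m \<cdot> m' = idn C Q" by (auto simp: iso_arr_def)
      then have "f = v \<cdot> m'" using cmp_assoc[OF m'(1) m(1) f(1)] m(2) cmp_idn_right[OF f(1)] by simp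
      then show ?thesis using m' by (auto simp: sub_le_def)
    qed simp
  qed
  then have "sub_le C Q f S s" using s by (auto simp: is_socle_def)
  then obtain f' where f': "f' \<in> hom C Q S" "f = s \<cdot> f'" by (auto simp: sub_le_def)
  have "s \<in> hom C S N" using s mono_arr_in_hom by (auto simp: is_socle_def)
  then have "mono_arr C Q S f'" using mono_right_factor[OF f'(1)] mono f'(2) by simp
  moreover obtain u where u: "iso_arr C S (L l) u" using S by (auto simp: isomorphic_def)
  ultimately have "mono_arr C Q (L l) (u \<cdot> f')" using mono_comp iso_arr_mono by blast
  then show ?thesis using L simple_not_zero[OF Q] unfolding simple_object_def isomorphic_def by blast
qed

end

context standard_category
begin

lemma multiplicity_composition_series:
  obtains Ss where "filtration C Ss X" "\<forall>S\<in>set Ss. simple_object C S"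
    "multiplicity C X S = length (filter (\<lambda>Q. isomorphic C Q S) Ss)"
proof -
  have "composition_series C (SOME Ss. composition_series C Ss X) X"
    using finite_length[of X] unfolding finite_length_def by (rule someI_ex)
  then show thesis using that unfolding composition_series_def multiplicity_def by blast
qed

lemma simple_factor_Delta:
  "l \<in> \<Lambda> \<Longrightarrow> simple_object C S \<Longrightarrow> h \<in> hom C (\<Delta> l) S \<Longrightarrow> h \<noteq> 0 \<Longrightarrow> isomorphic C S (L l)"
  using standard_simple_quotient Delta_standard L_simple by blast

lemma simple_factor_Nabla:
  "l \<in> \<Lambda> \<Longrightarrow> simple_object C S \<Longrightarrow> h \<in> hom C S (Nabla l) \<Longrightarrow> h \<noteq> 0 \<Longrightarrow> isomorphic C S (L l)"
  using costandard_simple_sub Nabla_costandard L_simple by blast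

lemma multiplicity_nonzero_if_hom_Delta:
  assumes "l \<in> \<Lambda>" "f \<in> hom C (\<Delta> l) X" "f \<noteq> 0"
  shows "multiplicity C X (L l) \<noteq> 0"
proof -
  obtain Ss where Ss: "filtration C Ss X" "\<forall>S\<in>set Ss. simple_object C S"
    "multiplicity C X (L l) = length (filter (\<lambda>Q. isomorphic C Q (L l)) Ss)"
    by (rule multiplicity_composition_series)
  have "\<exists>S\<in>set Ss. isomorphic C S (L l)"
    by (rule filtration_source_factor[OF Ss(1,2) _ assms(2,3)]) (rule simple_factor_Delta[OF assms(1)])
  with Ss(3) show ?thesis by (auto simp: filter_empty_conv)
qed

lemma multiplicity_nonzero_if_hom_Nabla:
  assumes "l \<in> \<Lambda>" "f \<in> hom C X (Nabla l)" "f \<noteq> 0"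
  shows "multiplicity C X (L l) \<noteq> 0"
proof -
  obtain Ss where Ss: "filtration C Ss X" "\<forall>S\<in>set Ss. simple_object C S"
    "multiplicity C X (L l) = length (filter (\<lambda>Q. isomorphic C Q (L l)) Ss)"
    by (rule multiplicity_composition_series)
  have "\<exists>S\<in>set Ss. isomorphic C S (L l)"
    by (rule filtration_target_factor[OF Ss(1,2) _ assms(2,3)]) (rule simple_factor_Nabla[OF assms(1)])
  with Ss(3) show ?thesis by (auto simp: filter_empty_conv)
qed

text \<open>Otherwise \<open>a\<close> and \<open>b\<close> would detect two composition factors isomorphic to \<open>L l\<close>.\<close>

lemma cmp_nonzero_if_multiplicity_1:
  assumes l: "l \<in> \<Lambda>" and "multiplicity C X (L l) = 1"
    and "a \<in> hom C (\<Delta> l) X" "a \<noteq> 0" "b \<in> hom C X (Nabla l)" "b \<noteq> 0"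
  shows "b \<cdot> a \<noteq> 0"
proof
  assume "b \<cdot> a = 0"
  obtain Ss where Ss: "filtration C Ss X" "\<forall>S\<in>set Ss. simple_object C S"
    "multiplicity C X (L l) = length (filter (\<lambda>Q. isomorphic C Q (L l)) Ss)"
    by (rule multiplicity_composition_series)
  have "2 \<le> length (filter (\<lambda>Q. isomorphic C Q (L l)) Ss)"
    by (rule filtration_two_factors[OF Ss(1,2) _ _ assms(3-6) \<open>b \<cdot> a = 0\<close>])
      (rule simple_factor_Delta[OF l] simple_factor_Nabla[OF l], assumption+)+
  with Ss(3) assms(2) show False by simp
qed

end

section \<open>Lifting through tilting objects\<close>

text \<open>
  The smallest class of objects that contains the zero objects and all \<open>F l\<close> and is closed under
  extensions.  It contains the objects with a filtration by objects \<open>F l\<close> and, unlike the bottom-up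
  filtrations, its definition is self-dual.
\<close>

inductive ext_closure :: "('o, 'm::ab_group_add, 'k::field) lincat \<Rightarrow> 'l set \<Rightarrow> ('l \<Rightarrow> 'o) \<Rightarrow> 'o \<Rightarrow> bool"
  for C \<Lambda> F where
  ext_closure_zero: "zero_object C X \<Longrightarrow> ext_closure C \<Lambda> F X"
| ext_closure_gen: "l \<in> \<Lambda> \<Longrightarrow> ext_closure C \<Lambda> F (F l)"
| ext_closure_ext: "ext_closure C \<Lambda> F X \<Longrightarrow> ext_closure C \<Lambda> F Z \<Longrightarrow> short_exact C X Y Z i p \<Longrightarrow>
    ext_closure C \<Lambda> F Y"

lemma ext_closure_opposite:
  "ext_closure C \<Lambda> F X \<Longrightarrow> ext_closure (opposite C) \<Lambda> F X"
proof (induction rule: ext_closure.induct)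
  case (ext_closure_ext X Z Y i p)
  from ext_closure_ext.hyps(3) have "short_exact (opposite C) Z Y X p i" by simp
  with ext_closure_ext.IH(2,1) show ?case by (rule ext_closure.ext_closure_ext)
qed (simp_all add: ext_closure.ext_closure_zero ext_closure.ext_closure_gen)

lemma opposite_opposite [simp]: "opposite (opposite C) = C"
  by (simp add: opposite_def)

lemma opposite_ext_closure [simp]: "ext_closure (opposite C) \<Lambda> F X \<longleftrightarrow> ext_closure C \<Lambda> F X"
  using ext_closure_opposite[of C] ext_closure_opposite[of "opposite C"] by auto

definition source_support ::
  "('o, 'm::ab_group_add, 'k::field) lincat \<Rightarrow> 'l set \<Rightarrow> ('l \<Rightarrow> 'o) \<Rightarrow> 'o \<Rightarrow> 'l set" where
  "source_support C \<Lambda> F X = {l \<in> \<Lambda>. hom C (F l) X \<noteq> {0}}"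

definition target_support ::
  "('o, 'm::ab_group_add, 'k::field) lincat \<Rightarrow> 'l set \<Rightarrow> ('l \<Rightarrow> 'o) \<Rightarrow> 'o \<Rightarrow> 'l set" where
  "target_support C \<Lambda> F X = {l \<in> \<Lambda>. hom C X (F l) \<noteq> {0}}"

lemma opposite_support [simp]: "source_support (opposite C) = target_support C"
  by (intro ext) (simp add: source_support_def target_support_def)

context abelian_category
begin

lemma short_exact_iso_quotient:
  assumes E: "short_exact C X Y Q i p" and u: "iso_arr C Q Q' u"
  shows "short_exact C X Y Q' i (u \<cdot> p)"
proof (rule short_exact_kernel_of_epi)
  note D = short_exactD[OF E] and uh = iso_arr_in_hom[OF u]
  show "epi_arr C Y Q' (u \<cdot> p)" using epi_comp D iso_arr_epi[OF u] by blast
  show "is_kernel C Y Q' (u \<cdot> p) X i"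
  proof (rule is_kernelI[OF D(1) cmp_in_hom[OF D(5) uh]])
    show "(u \<cdot> p) \<cdot> i = 0" using cmp_assoc[OF D(4,5) uh] D(3) cmp_zero_right[OF uh] by simp
    fix W h assume h: "h \<in> hom C W Y" "(u \<cdot> p) \<cdot> h = 0"
    then have "p \<cdot> h = 0"
      using cmp_assoc[OF h(1) D(5) uh] mono_arr_eq_0[OF iso_arr_mono[OF u] cmp_in_hom[OF h(1) D(5)]]
      by simp
    then show "\<exists>h'\<in>hom C W X. i \<cdot> h' = h" using short_exact_factor[OF E h(1)] by metis
  qed
qed

lemma filtered_by_ext_closure:
  assumes "filtered_by C \<Lambda> F X"
  shows "ext_closure C \<Lambda> F X"
proof -
  obtain Qs where "filtration C Qs X" "\<forall>Q\<in>set Qs. \<exists>l\<in>\<Lambda>. isomorphic C Q (F l)"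
    using assms unfolding filtered_by_def by blast
  then show ?thesis
  proof induction
    case (filtration_step Qs X Y Q i p)
    then obtain l u where l: "l \<in> \<Lambda>" "iso_arr C Q (F l) u" by (auto simp: isomorphic_def)
    have "short_exact C X Y (F l) i (u \<cdot> p)"
      by (rule short_exact_iso_quotient[OF filtration_step.hyps(2) l(2)])
    moreover have "ext_closure C \<Lambda> F X" using filtration_step by auto
    ultimately show ?case using ext_closure_ext ext_closure_gen[OF l(1)] by metis
  qed (rule ext_closure_zero)
qed

end

text \<open>
  Consequences of the axioms of a standard category on which the construction of the basis rests,
  chosen so that the list is self-dual: reversing all arrows and exchanging \<open>\<Delta>\<close>, \<open>\<iota>\<close> with \<open>Nabla\<close>,
  \<open>\<pi>\<close> permutes the assumptions.
\<close>

locale tilting_setup = abelian_category C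
  for C :: "('o, 'm::ab_group_add, 'k::field) lincat" +
  fixes \<Lambda> :: "('l::order) set"
    and \<Delta> Nabla Tilt :: "'l \<Rightarrow> 'o"
    and \<iota> \<pi> :: "'l \<Rightarrow> 'm"
  assumes finite_dim: "\<exists>B. finite B \<and> span B = hom C X Y"
    and ext1_Delta_Nabla: "l \<in> \<Lambda> \<Longrightarrow> m \<in> \<Lambda> \<Longrightarrow> ext1_vanishes C (\<Delta> l) (Nabla m)"
    and iota_mono: "l \<in> \<Lambda> \<Longrightarrow> mono_arr C (\<Delta> l) (Tilt l) (\<iota> l)"
    and pi_epi: "l \<in> \<Lambda> \<Longrightarrow> epi_arr C (Tilt l) (Nabla l) (\<pi> l)"
    and pi_iota: "l \<in> \<Lambda> \<Longrightarrow> cmp C (\<pi> l) (\<iota> l) \<noteq> 0"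
    and hom_Delta_Nabla_eq:
      "l \<in> \<Lambda> \<Longrightarrow> h \<in> hom C (\<Delta> l) (Nabla l) \<Longrightarrow> \<exists>a. h = scl C a (cmp C (\<pi> l) (\<iota> l))"
    and hom_Delta_Nabla_neq:
      "l \<in> \<Lambda> \<Longrightarrow> m \<in> \<Lambda> \<Longrightarrow> l \<noteq> m \<Longrightarrow> h \<in> hom C (\<Delta> l) (Nabla m) \<Longrightarrow> h = 0"
    and Tilt_Delta: "l \<in> \<Lambda> \<Longrightarrow> ext_closure C \<Lambda> \<Delta> (Tilt l)"
    and Tilt_Nabla: "l \<in> \<Lambda> \<Longrightarrow> ext_closure C \<Lambda> Nabla (Tilt l)"
    and hom_Tilt_Nabla_weight:
      "l \<in> \<Lambda> \<Longrightarrow> m \<in> \<Lambda> \<Longrightarrow> h \<in> hom C (Tilt l) (Nabla m) \<Longrightarrow> h \<noteq> 0 \<Longrightarrow> m \<le> l"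
    and hom_Delta_Tilt_weight:
      "l \<in> \<Lambda> \<Longrightarrow> m \<in> \<Lambda> \<Longrightarrow> h \<in> hom C (\<Delta> m) (Tilt l) \<Longrightarrow> h \<noteq> 0 \<Longrightarrow> m \<le> l"
    and cmp_iota_nonzero:
      "l \<in> \<Lambda> \<Longrightarrow> h \<in> hom C (Tilt l) (Nabla l) \<Longrightarrow> h \<noteq> 0 \<Longrightarrow> cmp C h (\<iota> l) \<noteq> 0"
    and cmp_pi_nonzero:
      "l \<in> \<Lambda> \<Longrightarrow> h \<in> hom C (\<Delta> l) (Tilt l) \<Longrightarrow> h \<noteq> 0 \<Longrightarrow> cmp C (\<pi> l) h \<noteq> 0"
begin

lemma opposite_setup: "tilting_setup (opposite C) \<Lambda> Nabla \<Delta> Tilt \<pi> \<iota>"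
proof (intro tilting_setup.intro tilting_setup_axioms.intro opposite_abelian,
    unfold opposite_simps opposite_mono opposite_epi opposite_ext1_vanishes opposite_ext_closure)
  show "ext1_vanishes C (\<Delta> m) (Nabla l)" if "l \<in> \<Lambda>" "m \<in> \<Lambda>" for l m
    using ext1_Delta_Nabla that by blast
  show "h = 0" if "l \<in> \<Lambda>" "m \<in> \<Lambda>" "l \<noteq> m" "h \<in> hom C (\<Delta> m) (Nabla l)" for l m h
    using hom_Delta_Nabla_neq that by blast
qed (fact finite_dim pi_epi iota_mono pi_iota hom_Delta_Nabla_eq Tilt_Nabla Tilt_Delta
  hom_Delta_Tilt_weight hom_Tilt_Nabla_weight cmp_pi_nonzero cmp_iota_nonzero)+

lemma iota_in_hom: "l \<in> \<Lambda> \<Longrightarrow> \<iota> l \<in> hom C (\<Delta> l) (Tilt l)"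
  and pi_in_hom: "l \<in> \<Lambda> \<Longrightarrow> \<pi> l \<in> hom C (Tilt l) (Nabla l)"
  using iota_mono pi_epi by (auto dest: mono_arr_in_hom epi_arr_in_hom)

lemma ext1_Delta_left:
  assumes "ext_closure C \<Lambda> \<Delta> M" and "\<And>l. l \<in> \<Lambda> \<Longrightarrow> ext1_vanishes C (\<Delta> l) Y"
  shows "ext1_vanishes C M Y"
  using assms(1)
proof induction
  case (ext_closure_ext A Z B i q)
  from ext_closure_ext.IH ext_closure_ext.hyps(3) show ?case by (rule ext1_vanishes_middle_left)
qed (simp_all add: assms(2) ext1_vanishes_zero_left)

lemma ext1_Nabla_right:
  assumes "ext_closure C \<Lambda> Nabla N" and "\<And>l. l \<in> \<Lambda> \<Longrightarrow> ext1_vanishes C X (Nabla l)"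
  shows "ext1_vanishes C X N"
  using assms(1)
proof induction
  case (ext_closure_ext A Z B i q)
  from ext_closure_ext.IH ext_closure_ext.hyps(3) show ?case by (rule ext1_vanishes_middle)
qed (simp_all add: assms(2) ext1_vanishes_zero_right)

lemma ext1_Delta_Nabla_closure:
  assumes "ext_closure C \<Lambda> \<Delta> M" "ext_closure C \<Lambda> Nabla N"
  shows "ext1_vanishes C M N"
  using ext1_Delta_left[OF assms(1)] ext1_Nabla_right[OF assms(2)] ext1_Delta_Nabla by blast

text \<open>
  Let \<open>K\<close> be the kernel of \<open>\<pi> l\<close>.  It suffices that \<open>Ext\<^sup>1(\<Delta> m, K) = 0\<close> for all \<open>m\<close>, and this holds
  because every morphism from \<open>\<Delta> m\<close> to \<open>Nabla l\<close> lifts: it is zero or a multiple of \<open>\<pi> l \<cdot> \<iota> l\<close>.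
\<close>

lemma lift_along_pi:
  assumes M: "ext_closure C \<Lambda> \<Delta> M" and l: "l \<in> \<Lambda>" and f: "f \<in> hom C M (Nabla l)"
  shows "\<exists>f'\<in>hom C M (Tilt l). \<pi> l \<cdot> f' = f"
proof -
  obtain K k where k: "short_exact C K (Tilt l) (Nabla l) k (\<pi> l)"
    using epi_extend_exact[OF pi_epi[OF l]] .
  have "ext1_vanishes C (\<Delta> m) K" if m: "m \<in> \<Lambda>" for m
  proof (rule ext1_vanishes_kernel[OF _ k])
    show "ext1_vanishes C (\<Delta> m) (Tilt l)"
      by (rule ext1_Delta_Nabla_closure[OF ext_closure_gen[OF m] Tilt_Nabla[OF l]])
    fix c assume c: "c \<in> hom C (\<Delta> m) (Nabla l)"
    show "\<exists>b\<in>hom C (\<Delta> m) (Tilt l). \<pi> l \<cdot> b = c"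
    proof (cases "m = l")
      case True
      then obtain a where "c = scl C a (\<pi> l \<cdot> \<iota> l)" using hom_Delta_Nabla_eq l c by blast
      then have "\<pi> l \<cdot> scl C a (\<iota> l) = c" using cmp_scl_right[OF iota_in_hom pi_in_hom] l by simp
      then show ?thesis using hom_scl iota_in_hom[OF l] True by blast
    next
      case False
      then have "c = 0" using hom_Delta_Nabla_neq m l c by blast
      then show ?thesis using cmp_zero_right[OF pi_in_hom[OF l]] zero_in_hom by blast
    qed
  qed
  then have "ext1_vanishes C M K" by (rule ext1_Delta_left[OF M])
  then show ?thesis using ext1_lift[OF _ k f] by blast
qed

lemma finite_source_support:
  assumes "ext_closure C \<Lambda> Nabla N"
  shows "finite (source_support C \<Lambda> \<Delta> N)"
  using assms
proof induction
  case (ext_closure_zero X)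
  then show ?case by (simp add: source_support_def zero_object_def)
next
  case (ext_closure_gen l)
  then have "source_support C \<Lambda> \<Delta> (Nabla l) \<subseteq> {l}"
    using hom_Delta_Nabla_neq zero_in_hom by (fastforce simp: source_support_def)
  then show ?case using finite_subset by blast
next
  case (ext_closure_ext X Z Y i p)
  note E = short_exactD[OF ext_closure_ext.hyps(3)]
  have "source_support C \<Lambda> \<Delta> Y \<subseteq> source_support C \<Lambda> \<Delta> X \<union> source_support C \<Lambda> \<Delta> Z"
  proof
    fix l assume "l \<in> source_support C \<Lambda> \<Delta> Y"
    then obtain h where l: "l \<in> \<Lambda>" and h: "h \<in> hom C (\<Delta> l) Y" "h \<noteq> 0"
      using zero_in_hom by (fastforce simp: source_support_def)
    show "l \<in> source_support C \<Lambda> \<Delta> X \<union> source_support C \<Lambda> \<Delta> Z"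
    proof (cases "p \<cdot> h = 0")
      case True
      then obtain h' where h': "h' \<in> hom C (\<Delta> l) X" "i \<cdot> h' = h"
        using short_exact_factor[OF ext_closure_ext.hyps(3) h(1)] by metis
      then have "h' \<noteq> 0" using h(2) cmp_zero_right[OF E(4)] by auto
      then show ?thesis using l h' by (auto simp: source_support_def)
    next
      case False
      then show ?thesis using l cmp_in_hom[OF h(1) E(5)] by (auto simp: source_support_def)
    qed
  qed
  then show ?case using ext_closure_ext.IH finite_subset by blast
qed

lemma finite_target_support:
  assumes "ext_closure C \<Lambda> \<Delta> M"
  shows "finite (target_support C \<Lambda> Nabla M)"
  using tilting_setup.finite_source_support[OF opposite_setup, of M] assms by simp

section \<open>Factoring morphisms through indecomposable tilting objects\<close>

text \<open>
  In the step \<open>0 \<rightarrow> X \<rightarrow> Y \<rightarrow> Z \<rightarrow> 0\<close> the factorization of \<open>p \<cdot> \<phi>\<close> through the objects \<open>Tilt m\<close> lifts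
  to \<open>Y\<close>, because \<open>Ext\<^sup>1(Tilt m, X) = 0\<close>; the difference of \<open>\<phi>\<close> and the lift comes from \<open>X\<close>.  The
  lemma is applied below also to an object \<open>M\<close> for which no filtration is known; all that is required of
  \<open>M\<close> is a family \<open>V\<close> of morphisms to the \<open>Tilt m\<close> that lifts every morphism to a costandard object.
\<close>

lemma hom_spanned_via_Tilt:
  assumes N: "ext_closure C \<Lambda> Nabla N"
    and V: "\<And>m. m \<in> \<Lambda> \<Longrightarrow> V m \<subseteq> hom C M (Tilt m)"
    and lift: "\<And>m h. m \<in> \<Lambda> \<Longrightarrow> h \<in> hom C M (Nabla m) \<Longrightarrow> \<exists>v\<in>V m. \<pi> m \<cdot> v = h"
    and "\<phi> \<in> hom C M N"
  shows "\<phi> \<in> span {u \<cdot> v | u v m. m \<in> source_support C \<Lambda> \<Delta> N \<and> u \<in> hom C (Tilt m) N \<and> v \<in> V m}"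
  using assms(1,4)
proof (induction arbitrary: \<phi>)
  case (ext_closure_zero X)
  then have "\<phi> = 0" using into_zero_object by blast
  then show ?case by (simp add: span_zero)
next
  case (ext_closure_gen l)
  then obtain v where v: "v \<in> V l" "\<pi> l \<cdot> v = \<phi>" using lift by blast
  have "\<pi> l \<cdot> \<iota> l \<in> hom C (\<Delta> l) (Nabla l)"
    using cmp_in_hom[OF iota_in_hom pi_in_hom] ext_closure_gen by blast
  then have "l \<in> source_support C \<Lambda> \<Delta> (Nabla l)"
    using pi_iota ext_closure_gen.hyps by (auto simp: source_support_def)
  then show ?case using v pi_in_hom[OF ext_closure_gen.hyps] by (intro span_base) blast
next
  case (ext_closure_ext X Z Y i p)
  define S where "S N = {u \<cdot> v | u v m. m \<in> source_support C \<Lambda> \<Delta> N \<and> u \<in> hom C (Tilt m) N \<and> v \<in> V m}" for N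
  note ex = ext_closure_ext.hyps(3) and \<phi> = ext_closure_ext.prems
  note E = short_exactD[OF ex]
  have S_hom: "S N \<subseteq> hom C M N" for N
  proof
    fix x assume "x \<in> S N"
    then obtain u v m where "x = u \<cdot> v" "m \<in> \<Lambda>" "u \<in> hom C (Tilt m) N" "v \<in> V m"
      unfolding S_def source_support_def by blast
    then show "x \<in> hom C M N" using V cmp_in_hom by blast
  qed
  have supp: "source_support C \<Lambda> \<Delta> X \<subseteq> source_support C \<Lambda> \<Delta> Y"
  proof
    fix m assume m: "m \<in> source_support C \<Lambda> \<Delta> X"
    then obtain h where h: "m \<in> \<Lambda>" "h \<in> hom C (\<Delta> m) X" "h \<noteq> 0"
      using zero_in_hom by (fastforce simp: source_support_def)
    then have "i \<cdot> h \<noteq> 0" using mono_arr_eq_0[OF E(1)] by blast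
    then show "m \<in> source_support C \<Lambda> \<Delta> Y"
      using h cmp_in_hom[OF h(2) E(4)] by (auto simp: source_support_def)
  qed
  have supp': "source_support C \<Lambda> \<Delta> Z \<subseteq> source_support C \<Lambda> \<Delta> Y"
  proof
    fix m assume m: "m \<in> source_support C \<Lambda> \<Delta> Z"
    then obtain h where h: "m \<in> \<Lambda>" "h \<in> hom C (\<Delta> m) Z" "h \<noteq> 0"
      using zero_in_hom by (fastforce simp: source_support_def)
    obtain h' where "h' \<in> hom C (\<Delta> m) Y" "p \<cdot> h' = h"
      using ext1_lift[OF ext1_Delta_Nabla_closure[OF ext_closure_gen[OF h(1)] ext_closure_ext.hyps(1)]
          ex h(2)] by blast
    moreover have "h' \<noteq> 0" using calculation h(3) cmp_zero_right[OF E(5)] by auto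
    ultimately show "m \<in> source_support C \<Lambda> \<Delta> Y" using h(1) by (auto simp: source_support_def)
  qed
  have "S Z \<subseteq> (\<lambda>y. p \<cdot> y) ` S Y"
  proof
    fix z assume "z \<in> S Z"
    then obtain u v m where uv: "z = u \<cdot> v" "m \<in> source_support C \<Lambda> \<Delta> Z" "u \<in> hom C (Tilt m) Z" "v \<in> V m"
      unfolding S_def by blast
    have m: "m \<in> \<Lambda>" using uv(2) by (simp add: source_support_def)
    obtain u' where u': "u' \<in> hom C (Tilt m) Y" "p \<cdot> u' = u"
      using ext1_lift[OF ext1_Delta_Nabla_closure[OF Tilt_Delta[OF m] ext_closure_ext.hyps(1)] ex uv(3)]
      by blast
    have "v \<in> hom C M (Tilt m)" using V[OF m] uv(4) by blast
    then have "z = p \<cdot> (u' \<cdot> v)" using cmp_assoc[OF _ u'(1) E(5)] uv(1) u'(2) by simp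
    moreover have "u' \<cdot> v \<in> S Y" unfolding S_def using u'(1) uv(2,4) supp' by blast
    ultimately show "z \<in> (\<lambda>y. p \<cdot> y) ` S Y" by blast
  qed
  then have "span (S Z) \<subseteq> (\<lambda>y. p \<cdot> y) ` span (S Y)"
    unfolding linear_on_span_image[OF linear_on_post[OF E(5)] S_hom, symmetric] by (rule span_mono)
  moreover have "p \<cdot> \<phi> \<in> span (S Z)"
    unfolding S_def by (rule ext_closure_ext.IH(2)[OF cmp_in_hom[OF \<phi> E(5)]])
  ultimately have "p \<cdot> \<phi> \<in> (\<lambda>y. p \<cdot> y) ` span (S Y)" by (rule subsetD)
  then obtain y where y: "y \<in> span (S Y)" "p \<cdot> \<phi> = p \<cdot> y" by blast
  have yh: "y \<in> hom C M Y" using y(1) span_minimal[OF S_hom hom_subspace] by blast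
  have "p \<cdot> (\<phi> - y) = 0" using cmp_diff_right[OF \<phi> yh E(5)] y(2) by simp
  then obtain x where x: "x \<in> hom C M X" "i \<cdot> x = \<phi> - y"
    using short_exact_factor[OF ex hom_diff[OF \<phi> yh]] by metis
  have "(\<lambda>x. i \<cdot> x) ` S X \<subseteq> S Y"
  proof
    fix z assume "z \<in> (\<lambda>x. i \<cdot> x) ` S X"
    then obtain u v m where uv: "z = i \<cdot> (u \<cdot> v)" "m \<in> source_support C \<Lambda> \<Delta> X" "u \<in> hom C (Tilt m) X" "v \<in> V m"
      unfolding S_def by blast
    have "m \<in> \<Lambda>" using uv(2) by (simp add: source_support_def)
    then have "v \<in> hom C M (Tilt m)" using V uv(4) by blast
    then have "z = (i \<cdot> u) \<cdot> v" using cmp_assoc[OF _ uv(3) E(4)] uv(1) by simp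
    then show "z \<in> S Y" unfolding S_def using uv(2,4) supp cmp_in_hom[OF uv(3) E(4)] by blast
  qed
  then have "(\<lambda>x. i \<cdot> x) ` span (S X) \<subseteq> span (S Y)"
    unfolding linear_on_span_image[OF linear_on_post[OF E(4)] S_hom, symmetric] by (rule span_mono)
  moreover have "x \<in> span (S X)" unfolding S_def by (rule ext_closure_ext.IH(1)[OF x(1)])
  ultimately have "i \<cdot> x \<in> span (S Y)" by blast
  then have "\<phi> \<in> span (S Y)" using y(1) x(2) span_add[of "\<phi> - y" "S Y" y] by simp
  then show ?case by (simp add: S_def)
qed

text \<open>
  Such an \<open>h\<close> factors through \<open>Q = Tilt l / \<Delta> l\<close>.  A morphism from \<open>Q\<close> to \<open>Nabla m\<close> vanishes unless
  \<open>m < l\<close>; if \<open>m < l\<close>, it lifts to a morphism from \<open>Tilt l\<close> to \<open>Tilt m\<close>, and this lift kills \<open>\<Delta> l\<close> for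
  weight reasons and so comes from \<open>Q\<close>.
\<close>

lemma killing_iota_factors_below:
  assumes N: "ext_closure C \<Lambda> Nabla N" and l: "l \<in> \<Lambda>" and h: "h \<in> hom C (Tilt l) N" "h \<cdot> \<iota> l = 0"
  shows "h \<in> span {u \<cdot> v | u v m. m \<in> source_support C \<Lambda> \<Delta> N \<and> m < l \<and>
    u \<in> hom C (Tilt m) N \<and> v \<in> hom C (Tilt l) (Tilt m)}" (is "_ \<in> span ?R")
proof -
  obtain Q q where q: "short_exact C (\<Delta> l) (Tilt l) Q (\<iota> l) q"
    using mono_extend_exact[OF iota_mono[OF l]] .
  note D = short_exactD[OF q]
  obtain h' where h': "h' \<in> hom C Q N" "h' \<cdot> q = h" using short_exact_cofactor[OF q h] .
  define V where "V m = (if m < l then hom C Q (Tilt m) else {0})" for m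
  have V: "V m \<subseteq> hom C Q (Tilt m)" for m by (simp add: V_def)
  have lift: "\<exists>v\<in>V m. \<pi> m \<cdot> v = f" if m: "m \<in> \<Lambda>" and f: "f \<in> hom C Q (Nabla m)" for m f
  proof (cases "m < l")
    case True
    note pm = pi_in_hom[OF m]
    have fq: "f \<cdot> q \<in> hom C (Tilt l) (Nabla m)" using cmp_in_hom[OF D(5) f] .
    obtain v where v: "v \<in> hom C (Tilt l) (Tilt m)" "\<pi> m \<cdot> v = f \<cdot> q"
      using lift_along_pi[OF Tilt_Delta[OF l] m fq] by blast
    have "v \<cdot> \<iota> l = 0"
      using hom_Delta_Tilt_weight[OF m l cmp_in_hom[OF D(4) v(1)]] True
      by (auto simp: less_le_not_le)
    then obtain v' where v': "v' \<in> hom C Q (Tilt m)" "v' \<cdot> q = v"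
      using short_exact_cofactor[OF q v(1)] by metis
    then have "(\<pi> m \<cdot> v') \<cdot> q = f \<cdot> q" using cmp_assoc[OF D(5) v'(1) pm] v(2) by simp
    then have "\<pi> m \<cdot> v' = f" using epi_arr_cancel[OF D(2) cmp_in_hom[OF v'(1) pm] f] by blast
    then show ?thesis using v' True by (auto simp: V_def)
  next
    case False
    have fq: "f \<cdot> q \<in> hom C (Tilt l) (Nabla m)" using cmp_in_hom[OF D(5) f] .
    have "f \<cdot> q = 0"
    proof (rule ccontr)
      assume nz: "f \<cdot> q \<noteq> 0"
      then have "m \<le> l" using hom_Tilt_Nabla_weight[OF l m fq] by blast
      then have "m = l" using False by simp
      moreover have "(f \<cdot> q) \<cdot> \<iota> l = 0"
        using cmp_assoc[OF D(4,5) f] D(3) cmp_zero_right[OF f] by simp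
      ultimately show False using cmp_iota_nonzero[OF l] fq nz by blast
    qed
    then have "f = 0" using epi_arr_eq_0[OF D(2) f] by blast
    then show ?thesis using False cmp_zero_right[OF pi_in_hom[OF m]] by (simp add: V_def)
  qed
  let ?S = "{u \<cdot> v | u v m. m \<in> source_support C \<Lambda> \<Delta> N \<and> u \<in> hom C (Tilt m) N \<and> v \<in> V m}"
  have h'S: "h' \<in> span ?S" by (rule hom_spanned_via_Tilt[OF N V lift h'(1)])
  have S_hom: "?S \<subseteq> hom C Q N"
  proof
    fix x assume "x \<in> ?S"
    then obtain u v m where "x = u \<cdot> v" "u \<in> hom C (Tilt m) N" "v \<in> hom C Q (Tilt m)"
      using V by blast
    then show "x \<in> hom C Q N" using cmp_in_hom by blast
  qed
  have "h \<in> span ((\<lambda>x. x \<cdot> q) ` ?S)"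
    unfolding linear_on_span_image[OF linear_on_pre[OF D(5)] S_hom]
    using h'S by (rule rev_image_eqI) (simp add: h'(2))
  moreover have "(\<lambda>x. x \<cdot> q) ` ?S \<subseteq> span ?R"
  proof
    fix x assume "x \<in> (\<lambda>x. x \<cdot> q) ` ?S"
    then obtain u v m where uv: "x = (u \<cdot> v) \<cdot> q" "m \<in> source_support C \<Lambda> \<Delta> N"
      "u \<in> hom C (Tilt m) N" "v \<in> V m"
      by blast
    have "v \<in> hom C Q (Tilt m)" using V uv(4) by blast
    then have x: "x = u \<cdot> (v \<cdot> q)" using cmp_assoc[OF D(5) _ uv(3)] uv(1) by simp
    show "x \<in> span ?R"
    proof (cases "m < l")
      case True
      then have "v \<cdot> q \<in> hom C (Tilt l) (Tilt m)" using uv(4) cmp_in_hom[OF D(5)] by (simp add: V_def)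
      then show ?thesis using x uv(2,3) True by (intro span_base) blast
    next
      case False
      then have "x = 0" using x uv(4) cmp_zero_left[OF D(5)] cmp_zero_right[OF uv(3)] by (simp add: V_def)
      then show ?thesis by (simp add: span_zero)
    qed
  qed
  then have "span ((\<lambda>x. x \<cdot> q) ` ?S) \<subseteq> span ?R" by (rule span_minimal) (rule subspace_span)
  ultimately show ?thesis by (rule subsetD[rotated])
qed

section \<open>The dimension of the space of morphisms\<close>

lemma finite_dim_hom:
  obtains S where "finite S" "hom C X Y \<subseteq> span S"
  using finite_dim by (metis order_refl)

lemma dim_hom_short_exact:
  assumes v: "ext1_vanishes C X A" and E: "short_exact C A B Z i p"
  shows "dim (hom C X B) = dim (hom C X A) + dim (hom C X Z)"
proof -
  note D = short_exactD[OF E]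
  obtain S S' where S: "finite S" "hom C X A \<subseteq> span S" "finite S'" "hom C X B \<subseteq> span S'"
    using finite_dim_hom by metis
  show ?thesis
  proof (rule dim_exact_sequence[OF linear_on_post[OF D(4)] linear_on_post[OF D(5)] S])
    show "{h \<in> hom C X B. p \<cdot> h = 0} = (\<lambda>f. i \<cdot> f) ` hom C X A"
    proof
      show "{h \<in> hom C X B. p \<cdot> h = 0} \<subseteq> (\<lambda>f. i \<cdot> f) ` hom C X A"
        using short_exact_factor[OF E] by (auto simp: image_iff) metis
      show "(\<lambda>f. i \<cdot> f) ` hom C X A \<subseteq> {h \<in> hom C X B. p \<cdot> h = 0}"
        using cmp_in_hom[OF _ D(4)] cmp_assoc[OF _ D(4,5)] D(3) cmp_zero_left by fastforce
    qed
    show "inj_on (\<lambda>f. i \<cdot> f) (hom C X A)" using mono_arr_cancel[OF D(1)] by (intro inj_onI) blast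
    show "(\<lambda>f. p \<cdot> f) ` hom C X B = hom C X Z"
      using ext1_lift[OF v E] cmp_in_hom[OF _ D(5)] by blast
  qed
qed

lemma dim_zero_space: "dim {0} = 0"
  using dim_le_card[of "{0}" "{}"] by simp

text \<open>
  By vanishing of \<open>Ext\<^sup>1\<close> both sides are additive in \<open>N\<close> on short exact sequences, which reduces the
  claim to \<open>N = Nabla l\<close>, where only the summand for \<open>m = l\<close> can be nonzero.
\<close>

lemma dim_hom_ge:
  assumes M: "ext_closure C \<Lambda> \<Delta> M" and N: "ext_closure C \<Lambda> Nabla N" and W: "finite W" "W \<subseteq> \<Lambda>"
  shows "(\<Sum>m\<in>W. dim (hom C (\<Delta> m) N) * dim (hom C M (Nabla m))) \<le> dim (hom C M N)"
  using N
proof induction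
  case (ext_closure_zero X)
  then show ?case by (simp add: zero_object_def dim_zero_space)
next
  case (ext_closure_gen l)
  have "dim (hom C (\<Delta> m) (Nabla l)) = 0" if "m \<in> W" "m \<noteq> l" for m
  proof -
    have "hom C (\<Delta> m) (Nabla l) = {0}" using hom_Delta_Nabla_neq ext_closure_gen that W zero_in_hom by blast
    then show ?thesis by (simp add: dim_zero_space)
  qed
  moreover have "dim (hom C (\<Delta> l) (Nabla l)) \<le> 1"
    using dim_le_card[of "hom C (\<Delta> l) (Nabla l)" "{\<pi> l \<cdot> \<iota> l}"]
      hom_Delta_Nabla_eq[OF ext_closure_gen.hyps] by (auto simp: span_singleton)
  ultimately have "dim (hom C (\<Delta> m) (Nabla l)) * dim (hom C M (Nabla m))
      \<le> (if m = l then dim (hom C M (Nabla l)) else 0)" if "m \<in> W" for m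
    using that by auto
  then have "(\<Sum>m\<in>W. dim (hom C (\<Delta> m) (Nabla l)) * dim (hom C M (Nabla m)))
      \<le> (\<Sum>m\<in>W. if m = l then dim (hom C M (Nabla l)) else 0)"
    by (rule sum_mono)
  also have "\<dots> \<le> dim (hom C M (Nabla l))" using W by (simp add: sum.delta)
  finally show ?case .
next
  case (ext_closure_ext X Z Y i p)
  note ex = ext_closure_ext.hyps(3) and X = ext_closure_ext.hyps(1)
  have "dim (hom C (\<Delta> m) Y) = dim (hom C (\<Delta> m) X) + dim (hom C (\<Delta> m) Z)" if "m \<in> W" for m
    using dim_hom_short_exact[OF ext1_Delta_Nabla_closure[OF ext_closure_gen X] ex] that W by blast
  then have "(\<Sum>m\<in>W. dim (hom C (\<Delta> m) Y) * dim (hom C M (Nabla m))) =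
      (\<Sum>m\<in>W. dim (hom C (\<Delta> m) X) * dim (hom C M (Nabla m))) +
      (\<Sum>m\<in>W. dim (hom C (\<Delta> m) Z) * dim (hom C M (Nabla m)))"
    by (simp add: distrib_right sum.distrib)
  also have "\<dots> \<le> dim (hom C M X) + dim (hom C M Z)" using ext_closure_ext.IH by (rule add_mono)
  also have "\<dots> = dim (hom C M Y)" using dim_hom_short_exact[OF ext1_Delta_Nabla_closure[OF M X] ex] by simp
  finally show ?case .
qed

end

section \<open>Bases of Hom-spaces from lifts\<close>

lemma (in vector_space) indexed_basis_expand:
  assumes b: "indexed_basis scale V I b" and "finite I" "x \<in> V"
  obtains r where "x = (\<Sum>i\<in>I. scale (r i) (b i))"
proof -
  have "x \<in> span (b ` I)" using b assms(3) by (simp add: indexed_basis_def)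
  then obtain u where "x = (\<Sum>v\<in>b ` I. scale (u v) v)"
    using span_finite[of "b ` I"] assms(2) by auto
  also have "\<dots> = (\<Sum>i\<in>I. scale (u (b i)) (b i))"
    using b by (simp add: indexed_basis_def sum.reindex)
  finally show thesis by (rule that)
qed

lemma (in vector_space) indexed_basis_finite:
  assumes b: "indexed_basis scale V I b" and S: "finite S" "V \<subseteq> span S"
  shows "finite I" "card I = dim V"
proof -
  have b': "inj_on b I" "independent (b ` I)" "span (b ` I) = V"
    using b by (auto simp: indexed_basis_def)
  have "b ` I \<subseteq> span S" using span_superset[of "b ` I"] b'(3) S(2) by simp
  then have "finite (b ` I)" using independent_span_bound[OF S(1) b'(2)] by simp
  then show "finite I" using b'(1) by (rule finite_imageD)
  show "card I = dim V"
    using dim_span_eq_card_independent[OF b'(2)] b'(1,3) by (simp add: card_image)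
qed

text \<open>
  Morphisms between two objects are considered, instead of endomorphisms of one: then the setting
  is self-dual, reversing all arrows exchanges \<open>M\<close>, \<open>J\<close>, \<open>f\<close> with \<open>N\<close>, \<open>I\<close>, \<open>g\<close>.
\<close>

locale lifted_bases = tilting_setup C \<Lambda> \<Delta> Nabla Tilt \<iota> \<pi>
  for C :: "('o, 'm::ab_group_add, 'k::field) lincat"
    and \<Lambda> :: "('l::order) set" and \<Delta> Nabla Tilt :: "'l \<Rightarrow> 'o" and \<iota> \<pi> :: "'l \<Rightarrow> 'm" +
  fixes M N :: 'o and I J :: "'l \<Rightarrow> 'i set" and g f :: "'l \<Rightarrow> 'i \<Rightarrow> 'm"
  assumes M: "ext_closure C \<Lambda> \<Delta> M" and N: "ext_closure C \<Lambda> Nabla N"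
    and g_in_hom: "l \<in> \<Lambda> \<Longrightarrow> i \<in> I l \<Longrightarrow> g l i \<in> hom C (Tilt l) N"
    and f_in_hom: "l \<in> \<Lambda> \<Longrightarrow> j \<in> J l \<Longrightarrow> f l j \<in> hom C M (Tilt l)"
    and g_basis: "l \<in> \<Lambda> \<Longrightarrow> indexed_basis (scl C) (hom C (\<Delta> l) N) (I l) (\<lambda>i. cmp C (g l i) (\<iota> l))"
    and f_basis: "l \<in> \<Lambda> \<Longrightarrow> indexed_basis (scl C) (hom C M (Nabla l)) (J l) (\<lambda>j. cmp C (\<pi> l) (f l j))"
begin

definition composites :: "'l set \<Rightarrow> 'm set" where
  "composites P = {g m i \<cdot> f m j | m i j. m \<in> P \<and> i \<in> I m \<and> j \<in> J m}"

lemma opposite_lifted_bases: "lifted_bases (opposite C) \<Lambda> Nabla \<Delta> Tilt \<pi> \<iota> N M J I f g"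
  by (intro lifted_bases.intro opposite_setup lifted_bases_axioms.intro)
    (simp_all add: M N g_in_hom f_in_hom g_basis f_basis)

lemma opposite_composites:
  "lifted_bases.composites (opposite C) J I f g P = composites P"
  unfolding lifted_bases.composites_def[OF opposite_lifted_bases] composites_def
  by auto

lemma composites_mono: "P \<subseteq> P' \<Longrightarrow> span (composites P) \<subseteq> span (composites P')"
  by (rule span_mono) (auto simp: composites_def)

lemma finite_I: "l \<in> \<Lambda> \<Longrightarrow> finite (I l)" and card_I: "l \<in> \<Lambda> \<Longrightarrow> card (I l) = dim (hom C (\<Delta> l) N)"
  using indexed_basis_finite[OF g_basis] finite_dim_hom by metis+

lemma finite_J: "l \<in> \<Lambda> \<Longrightarrow> finite (J l)" and card_J: "l \<in> \<Lambda> \<Longrightarrow> card (J l) = dim (hom C M (Nabla l))"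
  using indexed_basis_finite[OF f_basis] finite_dim_hom by metis+

lemma expand_modulo_killing_iota:
  assumes l: "l \<in> \<Lambda>" and u: "u \<in> hom C (Tilt l) N"
  obtains r where "(\<Sum>k\<in>I l. scl C (r k) (g l k)) \<in> hom C (Tilt l) N"
    "(u - (\<Sum>k\<in>I l. scl C (r k) (g l k))) \<cdot> \<iota> l = 0"
proof -
  note i = iota_in_hom[OF l]
  obtain r where r: "u \<cdot> \<iota> l = (\<Sum>k\<in>I l. scl C (r k) (g l k \<cdot> \<iota> l))"
    using indexed_basis_expand[OF g_basis[OF l] finite_I[OF l] cmp_in_hom[OF i u]] .
  have gr: "scl C (r k) (g l k) \<in> hom C (Tilt l) N" if "k \<in> I l" for k
    using g_in_hom[OF l that] by (rule hom_scl)
  then have s: "(\<Sum>k\<in>I l. scl C (r k) (g l k)) \<in> hom C (Tilt l) N" by (rule hom_sum)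
  have "(\<Sum>k\<in>I l. scl C (r k) (g l k)) \<cdot> \<iota> l = (\<Sum>k\<in>I l. scl C (r k) (g l k) \<cdot> \<iota> l)"
    using linear_on_sum[OF linear_on_pre[OF i] gr] .
  also have "\<dots> = u \<cdot> \<iota> l"
    unfolding r by (intro sum.cong refl cmp_scl_left[OF i g_in_hom[OF l]])
  finally show thesis using that[OF s] cmp_diff_left[OF i u s] by simp
qed

text \<open>
  The hypothesis \<open>IH\<close> will be an induction hypothesis.  It is required only for the finitely many
  \<open>m\<close> in the support of \<open>N\<close>, so that the induction terminates in an arbitrary poset.
\<close>

lemma killing_iota_step:
  assumes l: "l \<in> \<Lambda>" and h: "h \<in> hom C (Tilt l) N" "h \<cdot> \<iota> l = 0" and v: "v \<in> hom C M (Tilt l)"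
    and IH: "\<And>m u v. m \<in> source_support C \<Lambda> \<Delta> N \<Longrightarrow> m < l \<Longrightarrow> u \<in> hom C (Tilt m) N \<Longrightarrow>
      v \<in> hom C M (Tilt m) \<Longrightarrow> u \<cdot> v \<in> span (composites {k \<in> \<Lambda>. k \<le> m})"
  shows "h \<cdot> v \<in> span (composites {m \<in> \<Lambda>. m < l})"
proof -
  let ?R = "{u \<cdot> v | u v m. m \<in> source_support C \<Lambda> \<Delta> N \<and> m < l \<and>
    u \<in> hom C (Tilt m) N \<and> v \<in> hom C (Tilt l) (Tilt m)}"
  have R_hom: "?R \<subseteq> hom C (Tilt l) N" using cmp_in_hom by blast
  have "(\<lambda>x. x \<cdot> v) ` ?R \<subseteq> span (composites {m \<in> \<Lambda>. m < l})"
  proof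
    fix x assume "x \<in> (\<lambda>x. x \<cdot> v) ` ?R"
    then obtain u w m where x: "x = (u \<cdot> w) \<cdot> v" and m: "m \<in> source_support C \<Lambda> \<Delta> N" "m < l"
      and uw: "u \<in> hom C (Tilt m) N" "w \<in> hom C (Tilt l) (Tilt m)"
      by blast
    have "x \<in> span (composites {k \<in> \<Lambda>. k \<le> m})"
      using IH[OF m uw(1) cmp_in_hom[OF v uw(2)]] x cmp_assoc[OF v uw(2,1)] by simp
    moreover have "{k \<in> \<Lambda>. k \<le> m} \<subseteq> {k \<in> \<Lambda>. k < l}" using m(2) by auto
    ultimately show "x \<in> span (composites {m \<in> \<Lambda>. m < l})" using composites_mono by blast
  qed
  then have "span ((\<lambda>x. x \<cdot> v) ` ?R) \<subseteq> span (composites {m \<in> \<Lambda>. m < l})"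
    by (rule span_minimal) (rule subspace_span)
  moreover have "h \<cdot> v \<in> span ((\<lambda>x. x \<cdot> v) ` ?R)"
    unfolding linear_on_span_image[OF linear_on_pre[OF v] R_hom]
    by (rule imageI) (rule killing_iota_factors_below[OF N l h])
  ultimately show ?thesis by (rule subsetD)
qed

lemma expand_modulo_killed_by_pi:
  assumes "l \<in> \<Lambda>" "v \<in> hom C M (Tilt l)"
  obtains r where "(\<Sum>k\<in>J l. scl C (r k) (f l k)) \<in> hom C M (Tilt l)"
    "\<pi> l \<cdot> (v - (\<Sum>k\<in>J l. scl C (r k) (f l k))) = 0"
  using lifted_bases.expand_modulo_killing_iota[OF opposite_lifted_bases, of l v] assms by auto

lemma killed_by_pi_step:
  assumes "l \<in> \<Lambda>" "h \<in> hom C M (Tilt l)" "\<pi> l \<cdot> h = 0" "u \<in> hom C (Tilt l) N"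
    and "\<And>m u v. m \<in> target_support C \<Lambda> Nabla M \<Longrightarrow> m < l \<Longrightarrow> u \<in> hom C (Tilt m) N \<Longrightarrow>
      v \<in> hom C M (Tilt m) \<Longrightarrow> u \<cdot> v \<in> span (composites {k \<in> \<Lambda>. k \<le> m})"
  shows "u \<cdot> h \<in> span (composites {m \<in> \<Lambda>. m < l})"
  using lifted_bases.killing_iota_step[OF opposite_lifted_bases, of l h u] assms
  by (simp add: opposite_composites)

text \<open>
  Expand \<open>u = a + u'\<close> in the lifts \<open>g l i\<close>, with \<open>u' \<cdot> \<iota> l = 0\<close>, and \<open>v = b + v'\<close> in the lifts
  \<open>f l j\<close>, with \<open>\<pi> l \<cdot> v' = 0\<close>.  In \<open>u \<cdot> v = a \<cdot> b + a \<cdot> v' + u' \<cdot> v\<close> the last two terms factor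
  through tilting objects of smaller index, and smaller indices in the finite set \<open>W\<close> suffice.
\<close>

lemma cmp_via_Tilt:
  assumes "l \<in> \<Lambda>" "u \<in> hom C (Tilt l) N" "v \<in> hom C M (Tilt l)"
  shows "u \<cdot> v \<in> span (composites {m \<in> \<Lambda>. m \<le> l})"
proof -
  define W where "W = source_support C \<Lambda> \<Delta> N \<union> target_support C \<Lambda> Nabla M"
  have W: "finite W" "W \<subseteq> \<Lambda>"
    using finite_source_support[OF N] finite_target_support[OF M]
    by (auto simp: W_def source_support_def target_support_def)
  show ?thesis
    using assms
  proof (induction "card {m \<in> W. m < l}" arbitrary: l u v rule: less_induct)
    case less
    note l = less.prems(1) and u = less.prems(2) and v = less.prems(3)
    have IH: "u \<cdot> v \<in> span (composites {k \<in> \<Lambda>. k \<le> m})"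
      if "m \<in> W" "m < l" "u \<in> hom C (Tilt m) N" "v \<in> hom C M (Tilt m)" for m u v
    proof (rule less.hyps)
      show "card {k \<in> W. k < m} < card {k \<in> W. k < l}"
        using that(1,2) W(1) by (intro psubset_card_mono) (auto intro: less_trans)
      show "m \<in> \<Lambda>" using that(1) W(2) by blast
    qed (use that in auto)
    obtain r where r: "(\<Sum>k\<in>I l. scl C (r k) (g l k)) \<in> hom C (Tilt l) N"
      "(u - (\<Sum>k\<in>I l. scl C (r k) (g l k))) \<cdot> \<iota> l = 0"
      using expand_modulo_killing_iota[OF l u] .
    obtain s where s: "(\<Sum>k\<in>J l. scl C (s k) (f l k)) \<in> hom C M (Tilt l)"
      "\<pi> l \<cdot> (v - (\<Sum>k\<in>J l. scl C (s k) (f l k))) = 0"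
      using expand_modulo_killed_by_pi[OF l v] .
    define a b where "a = (\<Sum>k\<in>I l. scl C (r k) (g l k))" and "b = (\<Sum>k\<in>J l. scl C (s k) (f l k))"
    have a: "a \<in> hom C (Tilt l) N" "(u - a) \<cdot> \<iota> l = 0"
      and b: "b \<in> hom C M (Tilt l)" "\<pi> l \<cdot> (v - b) = 0"
      using r s by (simp_all add: a_def b_def)
    have "(u - a) \<cdot> v \<in> span (composites {m \<in> \<Lambda>. m < l})"
      by (rule killing_iota_step[OF l hom_diff[OF u a(1)] a(2) v]) (simp add: IH W_def)
    moreover have "a \<cdot> (v - b) \<in> span (composites {m \<in> \<Lambda>. m < l})"
      by (rule killed_by_pi_step[OF l hom_diff[OF v b(1)] b(2) a(1)]) (simp add: IH W_def)
    moreover have "{m \<in> \<Lambda>. m < l} \<subseteq> {m \<in> \<Lambda>. m \<le> l}" by auto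
    ultimately have small: "(u - a) \<cdot> v + a \<cdot> (v - b) \<in> span (composites {m \<in> \<Lambda>. m \<le> l})"
      using composites_mono span_add by blast
    have "a \<cdot> b \<in> span (composites {m \<in> \<Lambda>. m \<le> l})"
    proof -
      have gh: "scl C (r i) (g l i) \<in> hom C (Tilt l) N" if "i \<in> I l" for i
        using hom_scl g_in_hom[OF l that] .
      have fh: "scl C (s j) (f l j) \<in> hom C M (Tilt l)" if "j \<in> J l" for j
        using hom_scl f_in_hom[OF l that] .
      have "a \<cdot> b = (\<Sum>i\<in>I l. scl C (r i) (g l i) \<cdot> b)"
        unfolding a_def by (rule linear_on_sum[OF linear_on_pre[OF b(1)] gh])
      also have "\<dots> = (\<Sum>i\<in>I l. \<Sum>j\<in>J l. scl C (r i) (g l i) \<cdot> scl C (s j) (f l j))"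
        unfolding b_def by (intro sum.cong refl linear_on_sum[OF linear_on_post[OF gh] fh])
      also have "\<dots> \<in> span (composites {m \<in> \<Lambda>. m \<le> l})"
      proof (intro span_sum)
        fix i j assume i: "i \<in> I l" and j: "j \<in> J l"
        have "scl C (r i) (g l i) \<cdot> scl C (s j) (f l j) = scl C (s j) (scl C (r i) (g l i \<cdot> f l j))"
          using cmp_scl_right[OF f_in_hom[OF l j] gh[OF i]]
            cmp_scl_left[OF f_in_hom[OF l j] g_in_hom[OF l i]] by simp
        moreover have "g l i \<cdot> f l j \<in> composites {m \<in> \<Lambda>. m \<le> l}"
          using i j l by (auto simp: composites_def)
        ultimately show "scl C (r i) (g l i) \<cdot> scl C (s j) (f l j) \<in> span (composites {m \<in> \<Lambda>. m \<le> l})"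
          by (simp add: span_scale span_base)
      qed
      finally show ?thesis .
    qed
    moreover have "u \<cdot> v = a \<cdot> b + ((u - a) \<cdot> v + a \<cdot> (v - b))"
      using cmp_diff_left[OF v u a(1)] cmp_diff_right[OF v b(1) a(1)] by simp
    ultimately show ?case using small span_add by simp
  qed
qed

lemma killing_iota:
  assumes "l \<in> \<Lambda>" "h \<in> hom C (Tilt l) N" "h \<cdot> \<iota> l = 0" "v \<in> hom C M (Tilt l)"
  shows "h \<cdot> v \<in> span (composites {m \<in> \<Lambda>. m < l})"
  using assms cmp_via_Tilt by (intro killing_iota_step) (auto simp: source_support_def)

lemma span_composites: "span (composites \<Lambda>) = hom C M N"
proof
  have "composites \<Lambda> \<subseteq> hom C M N"
  proof
    fix x assume "x \<in> composites \<Lambda>"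
    then show "x \<in> hom C M N" unfolding composites_def using g_in_hom f_in_hom cmp_in_hom by blast
  qed
  then show "span (composites \<Lambda>) \<subseteq> hom C M N" by (rule span_minimal[OF _ hom_subspace])
  show "hom C M N \<subseteq> span (composites \<Lambda>)"
  proof
    fix x assume x: "x \<in> hom C M N"
    let ?R = "{u \<cdot> v | u v m. m \<in> source_support C \<Lambda> \<Delta> N \<and> u \<in> hom C (Tilt m) N \<and> v \<in> hom C M (Tilt m)}"
    have "x \<in> span ?R" by (rule hom_spanned_via_Tilt[OF N _ _ x]) (auto intro: lift_along_pi[OF M])
    moreover have "?R \<subseteq> span (composites \<Lambda>)"
    proof
      fix y assume "y \<in> ?R"
      then obtain u v m where y: "y = u \<cdot> v" "m \<in> \<Lambda>" "u \<in> hom C (Tilt m) N" "v \<in> hom C M (Tilt m)"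
        unfolding source_support_def by blast
      have "{k \<in> \<Lambda>. k \<le> m} \<subseteq> \<Lambda>" by blast
      then show "y \<in> span (composites \<Lambda>)" using cmp_via_Tilt[OF y(2-4)] y(1) composites_mono by blast
    qed
    then have "span ?R \<subseteq> span (composites \<Lambda>)" by (rule span_minimal) (rule subspace_span)
    ultimately show "x \<in> span (composites \<Lambda>)" by (rule subsetD[rotated])
  qed
qed

lemma composites_basis:
  "indexed_basis (scl C) (hom C M N) (SIGMA l:\<Lambda>. I l \<times> J l) (\<lambda>(l, i, j). g l i \<cdot> f l j)"
proof (rule spanning_family_is_basis)
  define W where "W = source_support C \<Lambda> \<Delta> N"
  have W: "finite W" "W \<subseteq> \<Lambda>"
    using finite_source_support[OF N] by (auto simp: W_def source_support_def)
  \<comment> \<open>The poset may be infinite, but only finitely many \<open>l\<close> contribute.\<close>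
  have "I l = {}" if "l \<in> \<Lambda>" "l \<notin> W" for l
  proof -
    have "hom C (\<Delta> l) N = {0}" using that by (auto simp: W_def source_support_def)
    then show ?thesis using card_I[OF that(1)] finite_I[OF that(1)] by (simp add: dim_zero_space)
  qed
  then have eq: "(SIGMA l:\<Lambda>. I l \<times> J l) = (SIGMA l:W. I l \<times> J l)" using W(2) by auto
  show "finite (SIGMA l:\<Lambda>. I l \<times> J l)"
    unfolding eq using W finite_I finite_J by (intro finite_SigmaI finite_cartesian_product) auto
  have "card (SIGMA l:\<Lambda>. I l \<times> J l) = (\<Sum>l\<in>W. card (I l \<times> J l))"
    unfolding eq using W finite_I finite_J by (intro card_SigmaI) auto
  also have "\<dots> = (\<Sum>l\<in>W. dim (hom C (\<Delta> l) N) * dim (hom C M (Nabla l)))"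
    using W(2) card_I card_J by (intro sum.cong) (auto simp: card_cartesian_product)
  also have "\<dots> \<le> dim (hom C M N)" by (rule dim_hom_ge[OF M N W])
  finally show "card (SIGMA l:\<Lambda>. I l \<times> J l) \<le> dim (hom C M N)" .
  have "(\<lambda>(l, i, j). g l i \<cdot> f l j) ` (SIGMA l:\<Lambda>. I l \<times> J l) = composites \<Lambda>"
    by (auto simp: composites_def image_iff) blast+
  then show "span ((\<lambda>(l, i, j). g l i \<cdot> f l j) ` (SIGMA l:\<Lambda>. I l \<times> J l)) = hom C M N"
    using span_composites by simp
qed

text \<open>
  The coefficients are those of \<open>\<phi> \<cdot> g l i \<cdot> \<iota> l\<close> in the basis of \<open>Hom(\<Delta> l, N)\<close>, so they do not
  depend on \<open>j\<close>; the error is a morphism that kills \<open>\<Delta> l\<close>, composed with \<open>f l j\<close>.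
\<close>

lemma left_multiplication:
  assumes l: "l \<in> \<Lambda>" and i: "i \<in> I l" and \<phi>: "\<phi> \<in> hom C N N"
  shows "\<exists>r. \<forall>j\<in>J l. \<phi> \<cdot> (g l i \<cdot> f l j) - (\<Sum>k\<in>I l. scl C (r k) (g l k \<cdot> f l j))
    \<in> span (composites {m \<in> \<Lambda>. m < l})"
proof -
  note gi = g_in_hom[OF l i]
  have \<phi>g: "\<phi> \<cdot> g l i \<in> hom C (Tilt l) N" using cmp_in_hom[OF gi \<phi>] .
  obtain r where r: "(\<Sum>k\<in>I l. scl C (r k) (g l k)) \<in> hom C (Tilt l) N"
    "(\<phi> \<cdot> g l i - (\<Sum>k\<in>I l. scl C (r k) (g l k))) \<cdot> \<iota> l = 0"
    using expand_modulo_killing_iota[OF l \<phi>g] .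
  have "\<phi> \<cdot> (g l i \<cdot> f l j) - (\<Sum>k\<in>I l. scl C (r k) (g l k \<cdot> f l j)) \<in> span (composites {m \<in> \<Lambda>. m < l})"
    if j: "j \<in> J l" for j
  proof -
    note fj = f_in_hom[OF l j]
    have "(\<Sum>k\<in>I l. scl C (r k) (g l k)) \<cdot> f l j = (\<Sum>k\<in>I l. scl C (r k) (g l k) \<cdot> f l j)"
      by (rule linear_on_sum[OF linear_on_pre[OF fj] hom_scl[OF g_in_hom[OF l]]])
    also have "\<dots> = (\<Sum>k\<in>I l. scl C (r k) (g l k \<cdot> f l j))"
      by (intro sum.cong refl cmp_scl_left[OF fj g_in_hom[OF l]])
    finally have "\<phi> \<cdot> (g l i \<cdot> f l j) - (\<Sum>k\<in>I l. scl C (r k) (g l k \<cdot> f l j)) =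
        (\<phi> \<cdot> g l i - (\<Sum>k\<in>I l. scl C (r k) (g l k))) \<cdot> f l j"
      using cmp_assoc[OF fj gi \<phi>] cmp_diff_left[OF fj \<phi>g r(1)] by simp
    then show ?thesis using killing_iota[OF l hom_diff[OF \<phi>g r(1)] r(2) fj] by simp
  qed
  then show ?thesis by blast
qed

lemma right_multiplication:
  assumes "l \<in> \<Lambda>" "j \<in> J l" "\<phi> \<in> hom C M M"
  shows "\<exists>r. \<forall>i\<in>I l. (g l i \<cdot> f l j) \<cdot> \<phi> - (\<Sum>k\<in>J l. scl C (r k) (g l i \<cdot> f l k))
    \<in> span (composites {m \<in> \<Lambda>. m < l})"
  using lifted_bases.left_multiplication[OF opposite_lifted_bases, of l j \<phi>] assms
  by (simp add: opposite_composites)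

lemma span_below_composites:
  "span_below (scl C) \<Lambda> I J (\<lambda>l i j. g l i \<cdot> f l j) l = span (composites {m \<in> \<Lambda>. m < l})"
proof -
  have "(\<Union>m\<in>{m \<in> \<Lambda>. m < l}. {g m i \<cdot> f m j | i j. i \<in> I m \<and> j \<in> J m}) = composites {m \<in> \<Lambda>. m < l}"
    unfolding composites_def by blast
  then show ?thesis by (simp only: span_below_def)
qed

end

lemma (in tilting_setup) endomorphism_algebra:
  "fin_dim_algebra (scl C) (cmp C) (idn C X) (hom C X X)"
  unfolding fin_dim_algebra_def
  using vector_space_axioms finite_dim idn_in_hom cmp_idn_left cmp_idn_right cmp_in_hom cmp_assoc
    cmp_add_left cmp_add_right cmp_scl_left cmp_scl_right
  by auto

lemma (in lifted_bases) composites_standard_basis: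
  assumes "M = N"
  shows "standard_basis (scl C) (cmp C) (idn C N) (hom C N N) \<Lambda> I J (\<lambda>l i j. g l i \<cdot> f l j)"
  unfolding standard_basis_def span_below_composites
proof (intro conjI)
  show "fin_dim_algebra (scl C) (cmp C) (idn C N) (hom C N N)" by (rule endomorphism_algebra)
  show "indexed_basis (scl C) (hom C N N) (SIGMA l:\<Lambda>. I l \<times> J l) (\<lambda>(l, i, j). g l i \<cdot> f l j)"
    using composites_basis assms by simp
  define r where "r l i \<phi> = (SOME r. \<forall>j\<in>J l. \<phi> \<cdot> (g l i \<cdot> f l j)
      - (\<Sum>k\<in>I l. scl C (r k) (g l k \<cdot> f l j)) \<in> span (composites {m \<in> \<Lambda>. m < l}))" for l i \<phi>
  have "\<forall>j\<in>J l. \<phi> \<cdot> (g l i \<cdot> f l j) - (\<Sum>k\<in>I l. scl C (r l i \<phi> k) (g l k \<cdot> f l j))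
      \<in> span (composites {m \<in> \<Lambda>. m < l})" if "l \<in> \<Lambda>" "i \<in> I l" "\<phi> \<in> hom C N N" for l i \<phi>
    unfolding r_def by (rule someI_ex[OF left_multiplication[OF that]])
  then show "\<exists>r. \<forall>\<phi>\<in>hom C N N. \<forall>l\<in>\<Lambda>. \<forall>i\<in>I l. \<forall>j\<in>J l.
      \<phi> \<cdot> (g l i \<cdot> f l j) - (\<Sum>k\<in>I l. scl C (r l k \<phi> i) (g l k \<cdot> f l j))
        \<in> span (composites {m \<in> \<Lambda>. m < l})"
    by (intro exI[of _ "\<lambda>l k \<phi> i. r l i \<phi> k"]) blast
  define r' where "r' l j \<phi> = (SOME r. \<forall>i\<in>I l. (g l i \<cdot> f l j) \<cdot> \<phi>
      - (\<Sum>k\<in>J l. scl C (r k) (g l i \<cdot> f l k)) \<in> span (composites {m \<in> \<Lambda>. m < l}))" for l j \<phi>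
  have "\<forall>i\<in>I l. (g l i \<cdot> f l j) \<cdot> \<phi> - (\<Sum>k\<in>J l. scl C (r' l j \<phi> k) (g l i \<cdot> f l k))
      \<in> span (composites {m \<in> \<Lambda>. m < l})" if "l \<in> \<Lambda>" "j \<in> J l" "\<phi> \<in> hom C N N" for l j \<phi>
    unfolding r'_def using that assms by (intro someI_ex[OF right_multiplication]) simp_all
  then show "\<exists>r. \<forall>\<phi>\<in>hom C N N. \<forall>l\<in>\<Lambda>. \<forall>i\<in>I l. \<forall>j\<in>J l.
      (g l i \<cdot> f l j) \<cdot> \<phi> - (\<Sum>k\<in>J l. scl C (r l k j \<phi>) (g l i \<cdot> f l k))
        \<in> span (composites {m \<in> \<Lambda>. m < l})"
    by (intro exI[of _ "\<lambda>l k j \<phi>. r' l j \<phi> k"]) blast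
qed

section \<open>Standard categories\<close>

context standard_category
begin

lemma ext1_vanishes_Delta_Nabla:
  assumes "l \<in> \<Lambda>" "m \<in> \<Lambda>"
  shows "ext1_vanishes C (\<Delta> l) (Nabla m)"
  using ext_Delta_Nabla[OF assms, of 1]
  by (intro ext1_vanishes_if_yoneda_ext_singleton) (simp add: ext_is_zero_def)

lemma hom_Delta_Nabla_multiple:
  assumes l: "l \<in> \<Lambda>" and x: "x \<in> hom C (\<Delta> l) (Nabla l)" "x \<noteq> 0" and h: "h \<in> hom C (\<Delta> l) (Nabla l)"
  shows "\<exists>a. h = scl C a x"
proof -
  obtain S where "finite S" "span S = hom C (\<Delta> l) (Nabla l)" using hom_finite_dim by blast
  then obtain B where B: "span B = hom C (\<Delta> l) (Nabla l)" "card B = 1"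
    using basis_of_subspace[OF hom_subspace] hom_Delta_Nabla[OF l] by (metis order_refl)
  then obtain b where "B = {b}" by (auto simp: card_1_singleton_iff)
  then have "hom C (\<Delta> l) (Nabla l) = range (\<lambda>a. scl C a b)" using B(1) by (simp add: span_singleton)
  then obtain c d where cd: "x = scl C c b" "h = scl C d b" using x(1) h by blast
  then have "h = scl C (d / c) x" using x(2) by simp
  then show ?thesis ..
qed

lemma Delta_nonzero: "\<not> zero_object C (\<Delta> l)" and Nabla_nonzero: "\<not> zero_object C (Nabla l)"
  if "l \<in> \<Lambda>"
proof -
  have "hom C (\<Delta> l) (Nabla l) \<noteq> {0}"
    using hom_Delta_Nabla[OF that] dim_le_card[of "{0}" "{}"] by auto
  then show "\<not> zero_object C (\<Delta> l)" "\<not> zero_object C (Nabla l)"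
    unfolding zero_object_def by blast+
qed

lemma tilting_setup:
  assumes \<iota>: "\<And>l. l \<in> \<Lambda> \<Longrightarrow> mono_arr C (\<Delta> l) (Tilt l) (\<iota> l)"
    and \<pi>: "\<And>l. l \<in> \<Lambda> \<Longrightarrow> epi_arr C (Tilt l) (Nabla l) (\<pi> l)"
  shows "tilting_setup C \<Lambda> \<Delta> Nabla Tilt \<iota> \<pi>"
proof (intro tilting_setup.intro tilting_setup_axioms.intro)
  show "abelian_category C" by (rule abelian_category_axioms)
  have i: "\<iota> l \<in> hom C (\<Delta> l) (Tilt l)" "\<iota> l \<noteq> 0"
    and p: "\<pi> l \<in> hom C (Tilt l) (Nabla l)" "\<pi> l \<noteq> 0" if "l \<in> \<Lambda>" for l
    using \<iota>[OF that] \<pi>[OF that] Delta_nonzero[OF that] Nabla_nonzero[OF that]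
      mono_arr_in_hom epi_arr_in_hom zero_mono_source zero_epi_target by metis+
  show pi_iota: "\<pi> l \<cdot> \<iota> l \<noteq> 0" if l: "l \<in> \<Lambda>" for l
    using cmp_nonzero_if_multiplicity_1[OF l Tilt_top_weight[OF l] i[OF l] p[OF l]] .
  show "h \<cdot> \<iota> l \<noteq> 0" if "l \<in> \<Lambda>" "h \<in> hom C (Tilt l) (Nabla l)" "h \<noteq> 0" for l h
    using cmp_nonzero_if_multiplicity_1[OF that(1) Tilt_top_weight[OF that(1)] i[OF that(1)] that(2,3)] .
  show "\<pi> l \<cdot> h \<noteq> 0" if "l \<in> \<Lambda>" "h \<in> hom C (\<Delta> l) (Tilt l)" "h \<noteq> 0" for l h
    using cmp_nonzero_if_multiplicity_1[OF that(1) Tilt_top_weight[OF that(1)] that(2,3) p[OF that(1)]] .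
  show "\<exists>a. h = scl C a (\<pi> l \<cdot> \<iota> l)" if "l \<in> \<Lambda>" "h \<in> hom C (\<Delta> l) (Nabla l)" for l h
    using hom_Delta_Nabla_multiple[OF that(1) cmp_in_hom[OF i(1)[OF that(1)] p(1)[OF that(1)]]
        pi_iota[OF that(1)] that(2)] .
  show "h = 0" if "l \<in> \<Lambda>" "m \<in> \<Lambda>" "l \<noteq> m" "h \<in> hom C (\<Delta> l) (Nabla m)" for l m h
    using ext_Delta_Nabla[OF that(1,2), of 0] that(3,4) by (simp add: ext_is_zero_def)
  show "m \<le> l" if "l \<in> \<Lambda>" "m \<in> \<Lambda>" "h \<in> hom C (Tilt l) (Nabla m)" "h \<noteq> 0" for l m h
    using Tilt_weights[OF that(1,2)] multiplicity_nonzero_if_hom_Nabla[OF that(2-4)] .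
  show "m \<le> l" if "l \<in> \<Lambda>" "m \<in> \<Lambda>" "h \<in> hom C (\<Delta> m) (Tilt l)" "h \<noteq> 0" for l m h
    using Tilt_weights[OF that(1,2)] multiplicity_nonzero_if_hom_Delta[OF that(2-4)] .
  show "ext_closure C \<Lambda> \<Delta> (Tilt l)" "ext_closure C \<Lambda> Nabla (Tilt l)" if "l \<in> \<Lambda>" for l
    using Tilt_tilting[OF that] filtered_by_ext_closure unfolding tilting_object_def by blast+
qed (fact hom_finite_dim ext1_vanishes_Delta_Nabla \<iota> \<pi>)+

end

theorem theorem3p8:
  fixes C :: "('o, 'm::ab_group_add, 'k::field) lincat"
    and \<Lambda> :: "('l::order) set"
    and L \<Delta> Nabla Tilt :: "'l \<Rightarrow> 'o"
    and T :: 'o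
    and \<iota> \<pi> :: "'l \<Rightarrow> 'm"
    and I J :: "'l \<Rightarrow> nat set"
    and g g' f f' :: "'l \<Rightarrow> nat \<Rightarrow> 'm"
  assumes "standard_category C \<Lambda> L \<Delta> Nabla Tilt"
    and "tilting_object C \<Lambda> \<Delta> Nabla T"
    and "\<And>l. l \<in> \<Lambda> \<Longrightarrow> mono_arr C (\<Delta> l) (Tilt l) (\<iota> l)"
    and "\<And>l. l \<in> \<Lambda> \<Longrightarrow> epi_arr C (Tilt l) (Nabla l) (\<pi> l)"
    and "\<And>l. I l = {1..vector_space.dim (scl C) (hom C (\<Delta> l) T)}"
    and "\<And>l. J l = {1..vector_space.dim (scl C) (hom C T (Nabla l))}"
    and "\<And>l. l \<in> \<Lambda> \<Longrightarrow> indexed_basis (scl C) (hom C (\<Delta> l) T) (I l) (g l)"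
    and "\<And>l i. l \<in> \<Lambda> \<Longrightarrow> i \<in> I l \<Longrightarrow> g' l i \<in> hom C (Tilt l) T \<and> cmp C (g' l i) (\<iota> l) = g l i"
    and "\<And>l. l \<in> \<Lambda> \<Longrightarrow> indexed_basis (scl C) (hom C T (Nabla l)) (J l) (f l)"
    and "\<And>l j. l \<in> \<Lambda> \<Longrightarrow> j \<in> J l \<Longrightarrow> f' l j \<in> hom C T (Tilt l) \<and> cmp C (\<pi> l) (f' l j) = f l j"
  shows "standard_basis (scl C) (cmp C) (idn C T) (hom C T T) \<Lambda> I J
    (\<lambda>l i j. cmp C (g' l i) (f' l j))"
proof -
  interpret standard_category C \<Lambda> L \<Delta> Nabla Tilt by fact
  interpret tilting_setup C \<Lambda> \<Delta> Nabla Tilt \<iota> \<pi> using assms(3,4) by (rule tilting_setup)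
  have cong: "indexed_basis (scl C) V K b \<longleftrightarrow> indexed_basis (scl C) V K b'"
    if "\<And>k. k \<in> K \<Longrightarrow> b k = b' k" for V and K :: "nat set" and b b' :: "nat \<Rightarrow> 'm"
    using that inj_on_cong[of K b b'] image_cong[of K K b b'] by (simp add: indexed_basis_def)
  interpret lifted_bases C \<Lambda> \<Delta> Nabla Tilt \<iota> \<pi> T T I J g' f'
  proof
    show "ext_closure C \<Lambda> \<Delta> T" "ext_closure C \<Lambda> Nabla T"
      using assms(2) filtered_by_ext_closure unfolding tilting_object_def by blast+
    show "indexed_basis (scl C) (hom C (\<Delta> l) T) (I l) (\<lambda>i. cmp C (g' l i) (\<iota> l))" if "l \<in> \<Lambda>" for l
      using assms(7)[OF that] assms(8)[OF that] cong[of "I l" "g l" "\<lambda>i. cmp C (g' l i) (\<iota> l)"] by simp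
    show "indexed_basis (scl C) (hom C T (Nabla l)) (J l) (\<lambda>j. cmp C (\<pi> l) (f' l j))" if "l \<in> \<Lambda>" for l
      using assms(9)[OF that] assms(10)[OF that] cong[of "J l" "f l" "\<lambda>j. cmp C (\<pi> l) (f' l j)"] by simp
  qed (use assms(8,10) in blast)+
  show ?thesis by (rule composites_standard_basis) (rule refl)
qed

end
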